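(* Let $\bm{\tau}=(\tau_1,\ldots,\tau_d)$ have positive entries and let $\bm{u}=\{u^{(j)}\}_{j=0}^{d-1}$ be an orthogonal basis on $\bm{p}=\bm{\tau}/|\bm{\tau}|$, with $u^{(0)}\equiv1$ and $\sum_{i=1}^du_i^{(k)}u_i^{(l)}p_i=\delta_{kl}a_k$. Let $\{\rho_{\bm{n}}\}_{\bm{n}\in\mathbb{Z}_+^d}$ be real numbers with $\rho_{\bm{0}}=1$. Then $$f(\bm{x};\bm{\tau})f(\bm{y};\bm{\tau})\Big\{1+\sum_{|\bm{n}|\ge1}\rho_{\bm{n}}\,h_{\bm{n}}(|\bm{\tau}|,\bm{u})\,H_{\bm{n}}(\bm{x};\bm{\tau},\bm{u})\,H_{\bm{n}}(\bm{y};\bm{\tau},\bm{u})\Big\}$$ is non-negative, and thus a proper bivariate normal distribution (a joint distribution of $(\bm{X},\bm{Y})$ in which each of $\bm{X},\bm{Y}$ has marginal density $f(\cdot;\bm{\tau})$), if and only if for all $\bm{n}=(n_0,\ldots,n_{d-1})\in\mathbb{Z}_+^d$ $$\rho_{\bm{n}}=\mathbb{E}\Big[\prod_{j=0}^{d-1}\xi_j^{n_j}\Big],$$ where $\bm{\xi}=(\xi_0,\ldots,\xi_{d-1})$ is a random vector with elements in $[-1,1]$. An equivalent statement to this characterization is that, conditional on $\bm{\xi}$, $(\bm{X},\bm{Y})$ is a (jointly normal) bivariate normal pair of random vectors, independent within vectors, with means $(\bm{0},\bm{0})$, variances $(\bm{\tau},\bm{\tau})$ and cross covariances $V(\bm{\xi})=(v_{ij}(\bm{\xi}))$,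 where $$v_{ij}(\bm{\xi})=\operatorname{Cov}(X_i,Y_j\mid\bm{\xi})=|\bm{\tau}|\,p_ip_j\sum_{l=0}^{d-1}\xi_l\,a_l^{-1}u_i^{(l)}u_j^{(l)},\qquad i,j=1,\ldots,d.$$
   Context: For a vector $\bm{z}$, $|\bm{z}|$ denotes the sum of its entries. A basis $\bm{u}$ is a complete set of real orthogonal functions on $\{1,\ldots,d\}$ with respect to the probability distribution $\bm{p}$; $a_0=1$. Normal product density: $f(\bm{x};\bm{\tau})=\prod_{i=1}^d(2\pi\tau_i)^{-1/2}e^{-x_i^2/(2\tau_i)}$, $\bm{x}\in\mathbb{R}^d$. One-dimensional Hermite-Chebycheff polynomials $H_n(X;\tau)$, orthogonal on $N(0,\tau)$: $\sum_{n\ge0}H_n(X;\tau)z^n/n!=\exp\{Xz-\tfrac12\tau z^2\}$, with $\mathbb{E}[H_m(X;\tau)H_n(X;\tau)]=\delta_{mn}n!\,\tau^n$. Multivariate Hermite-Chebycheff polynomials: with $\widehat{X}_j=\sum_{i=1}^du_i^{(j)}X_i$, $j=0,\ldots,d-1$, $$H_{\bm{n}}(\bm{X};\bm{\tau},\bm{u})=\prod_{j=0}^{d-1}H_{n_j}\big(\widehat{X}_j;|\bm{\tau}|a_j\big),\qquad \bm{n}\in\mathbb{Z}_+^d.$$ They are orthogonal on $f(\cdot;\bm{\tau})$, and $h_{\bm{n}}(|\bm{\tau}|,\bm{u})$ is the inverse squared norm, $h_{\bm{n}}(|\bm{\tau}|,\bm{u})^{-1}=\mathbb{E}[H_{\bm{n}}(\bm{X};\bm{\tau},\bm{u})^2]=|\bm{\tau}|^{|\bm{n}|}\prod_{j=0}^{d-1}n_j!\,a_j^{n_j}$.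 The displayed Lancaster expansion is understood as representing the joint distribution of $(\bm{X},\bm{Y})$ whose correlation sequence is $\{\rho_{\bm{n}}\}$, i.e. $\mathbb{E}[H_{\bm{m}}(\bm{X};\bm{\tau},\bm{u})H_{\bm{n}}(\bm{Y};\bm{\tau},\bm{u})]=\delta_{\bm{m}\bm{n}}\rho_{\bm{n}}h_{\bm{n}}(|\bm{\tau}|,\bm{u})^{-1}$ for all $\bm{m},\bm{n}$; this includes degenerate cases such as $\bm{X}=\bm{Y}$ ($\rho_{\bm{n}}\equiv1$), in which the joint law has no density. *)

theory Defs
  imports
    "HOL-Probability.Probability"
    "HOL-Computational_Algebra.Formal_Power_Series"
begin

(* |z|, the sum (not the norm) of the entries of a vector; used for reals and for multi-indices *)
definition total :: "'b::comm_monoid_add ^ 'd \<Rightarrow> 'b" where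
  "total z = (\<Sum>i\<in>UNIV. z $ i)"

definition weights :: "real ^ 'd \<Rightarrow> real ^ 'd" where
  "weights \<tau> = (\<chi> i. \<tau> $ i / total \<tau>)"

(* Functions on the d points are vectors in real ^ 'd. The d labels 0, ..., d-1 of the basis
   functions (and hence of the entries of multi-indices and of \<xi>) are represented by the same
   finite type 'd; the label that plays the role of 0 is singled out where it is needed.
   Completeness is the spanning condition; it forces all u j to be nonzero, so a j > 0. *)
definition orthogonal_basis :: "real ^ 'd \<Rightarrow> ('d \<Rightarrow> real ^ 'd) \<Rightarrow> ('d \<Rightarrow> real) \<Rightarrow> bool" where
  "orthogonal_basis p u a \<longleftrightarrow>
     (\<forall>k l. (\<Sum>i\<in>UNIV. u k $ i * u l $ i * p $ i) = (if k = l then a k else 0)) \<and>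
     span (range u) = UNIV"

definition normal_product_density :: "real ^ 'd \<Rightarrow> real ^ 'd \<Rightarrow> real" where
  "normal_product_density \<tau> x = (\<Prod>i\<in>UNIV. normal_density 0 (sqrt (\<tau> $ i)) (x $ i))"

definition normal_product :: "real ^ 'd \<Rightarrow> (real ^ 'd) measure" where
  "normal_product \<tau> = density lborel (\<lambda>x. ennreal (normal_product_density \<tau> x))"

(* H_n(x; t) is n! times the coefficient of z^n in exp(x z - t z^2 / 2), a power series in z *)
definition hermite :: "nat \<Rightarrow> real \<Rightarrow> real \<Rightarrow> real" where
  "hermite n t x =
     fact n * fps_nth (fps_compose (fps_exp 1)
       (fps_const x * fps_X - fps_const (t / 2) * fps_X ^ 2)) n"

definition multi_hermite ::
    "real ^ 'd \<Rightarrow> ('d \<Rightarrow> real ^ 'd) \<Rightarrow> ('d \<Rightarrow> real) \<Rightarrow> nat ^ 'd \<Rightarrow> real ^ 'd \<Rightarrow> real" where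
  "multi_hermite \<tau> u a n x =
     (\<Prod>j\<in>UNIV. hermite (n $ j) (total \<tau> * a j) (\<Sum>i\<in>UNIV. u j $ i * x $ i))"

(* inverse squared norm; equals 1 / (total \<tau> ^ total n * (\<Prod>j. fact (n $ j) * a j ^ (n $ j))) *)
definition hermite_h ::
    "real ^ 'd \<Rightarrow> ('d \<Rightarrow> real ^ 'd) \<Rightarrow> ('d \<Rightarrow> real) \<Rightarrow> nat ^ 'd \<Rightarrow> real" where
  "hermite_h \<tau> u a n = 1 / (\<integral>x. (multi_hermite \<tau> u a n x)\<^sup>2 \<partial>normal_product \<tau>)"

(* \<mu> is the joint law of (X, Y) represented by the Lancaster expansion
     f(x) f(y) (1 + \<Sum>_{|n| \<ge> 1} \<rho>_n h_n H_n(x) H_n(y)).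
   The expansion is read through its marginals and its correlation sequence, since \<mu> need not
   have a density and the series need not converge (e.g. X = Y, where \<rho> is identically 1).
   The product H_m(x) H_n(y) is always integrable by Cauchy-Schwarz. *)
definition lancaster_law ::
    "real ^ 'd \<Rightarrow> ('d \<Rightarrow> real ^ 'd) \<Rightarrow> ('d \<Rightarrow> real) \<Rightarrow> (nat ^ 'd \<Rightarrow> real) \<Rightarrow>
     ((real ^ 'd) \<times> (real ^ 'd)) measure \<Rightarrow> bool" where
  "lancaster_law \<tau> u a \<rho> \<mu> \<longleftrightarrow>
     prob_space \<mu> \<and> sets \<mu> = sets borel \<and>
     distr \<mu> borel fst = normal_product \<tau> \<and>
     distr \<mu> borel snd = normal_product \<tau> \<and>
     (\<forall>m n. (\<integral>z. multi_hermite \<tau> u a m (fst z) * multi_hermite \<tau> u a n (snd z) \<partial>\<mu>) =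
        (if m = n then \<rho> n / hermite_h \<tau> u a n else 0))"

(* law of a random vector \<xi> with all its elements in [-1, 1] *)
definition cube_law :: "(real ^ 'd) measure \<Rightarrow> bool" where
  "cube_law \<nu> \<longleftrightarrow>
     prob_space \<nu> \<and> sets \<nu> = sets borel \<and> (AE s in \<nu>. \<forall>j. s $ j \<in> {-1..1})"

definition is_moment_sequence :: "(nat ^ 'd \<Rightarrow> real) \<Rightarrow> (real ^ 'd) measure \<Rightarrow> bool" where
  "is_moment_sequence \<rho> \<nu> \<longleftrightarrow> (\<forall>n. \<rho> n = (\<integral>s. (\<Prod>j\<in>UNIV. (s $ j) ^ (n $ j)) \<partial>\<nu>))"

(* univariate normal law with mean m and variance v \<ge> 0, a point mass when v = 0 *)
definition normal_law :: "real \<Rightarrow> real \<Rightarrow> real measure" where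
  "normal_law m v =
     (if v = 0 then return borel m
      else density lborel (\<lambda>x. ennreal (normal_density m (sqrt v) x)))"

(* every linear functional is normal; singular covariances are allowed, as they do occur here
   (when some |\<xi>_l| = 1) *)
definition jointly_normal :: "'a::euclidean_space measure \<Rightarrow> bool" where
  "jointly_normal N \<longleftrightarrow>
     prob_space N \<and> sets N = sets borel \<and>
     (\<forall>t. \<exists>m v. v \<ge> 0 \<and> distr N borel (\<lambda>z. z \<bullet> t) = normal_law m v)"

definition covariance :: "'a measure \<Rightarrow> ('a \<Rightarrow> real) \<Rightarrow> ('a \<Rightarrow> real) \<Rightarrow> real" where
  "covariance N f g = (\<integral>z. (f z - integral\<^sup>L N f) * (g z - integral\<^sup>L N g) \<partial>N)"

(* law of a jointly normal pair of random vectors, independent within vectors, with means 0,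
   variances \<tau> in each vector, and cross covariances V *)
definition normal_pair ::
    "real ^ 'd \<Rightarrow> real ^ 'd ^ 'd \<Rightarrow> ((real ^ 'd) \<times> (real ^ 'd)) measure \<Rightarrow> bool" where
  "normal_pair \<tau> V N \<longleftrightarrow>
     jointly_normal N \<and>
     prob_space.indep_vars N (\<lambda>_. borel) (\<lambda>i z. fst z $ i) UNIV \<and>
     prob_space.indep_vars N (\<lambda>_. borel) (\<lambda>i z. snd z $ i) UNIV \<and>
     (\<forall>i. (\<integral>z. fst z $ i \<partial>N) = 0 \<and> (\<integral>z. snd z $ i \<partial>N) = 0) \<and>
     (\<forall>i. covariance N (\<lambda>z. fst z $ i) (\<lambda>z. fst z $ i) = \<tau> $ i \<and>
          covariance N (\<lambda>z. snd z $ i) (\<lambda>z. snd z $ i) = \<tau> $ i) \<and>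
     (\<forall>i j. covariance N (\<lambda>z. fst z $ i) (\<lambda>z. snd z $ j) = V $ i $ j)"

definition cross_covariance ::
    "real ^ 'd \<Rightarrow> ('d \<Rightarrow> real ^ 'd) \<Rightarrow> ('d \<Rightarrow> real) \<Rightarrow> real ^ 'd \<Rightarrow> real ^ 'd ^ 'd" where
  "cross_covariance \<tau> u a s =
     (\<chi> i j. total \<tau> * weights \<tau> $ i * weights \<tau> $ j *
        (\<Sum>l\<in>UNIV. s $ l * inverse (a l) * u l $ i * u l $ j))"

(* the kernel K is a regular conditional distribution of Z given \<xi> *)
definition conditional_law ::
    "'w measure \<Rightarrow> ('w \<Rightarrow> 'a::topological_space) \<Rightarrow> ('w \<Rightarrow> 'b::topological_space) \<Rightarrow>
     ('a \<Rightarrow> 'b measure) \<Rightarrow> bool" where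
  "conditional_law M \<xi> Z K \<longleftrightarrow>
     \<xi> \<in> M \<rightarrow>\<^sub>M borel \<and> Z \<in> M \<rightarrow>\<^sub>M borel \<and> K \<in> borel \<rightarrow>\<^sub>M prob_algebra borel \<and>
     (\<forall>A\<in>sets borel. \<forall>B\<in>sets borel.
        emeasure M {\<omega> \<in> space M. \<xi> \<omega> \<in> A \<and> Z \<omega> \<in> B} =
        (\<integral>\<^sup>+ s. emeasure (K s) B * indicator A s \<partial>distr M borel \<xi>))"

definition conditionally_normal ::
    "real ^ 'd \<Rightarrow> ('d \<Rightarrow> real ^ 'd) \<Rightarrow> ('d \<Rightarrow> real) \<Rightarrow> 'w measure \<Rightarrow>
     ('w \<Rightarrow> real ^ 'd) \<Rightarrow> ('w \<Rightarrow> real ^ 'd) \<Rightarrow> ('w \<Rightarrow> real ^ 'd) \<Rightarrow> bool" where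
  "conditionally_normal \<tau> u a M \<xi> X Y \<longleftrightarrow>
     (\<exists>K. conditional_law M \<xi> (\<lambda>\<omega>. (X \<omega>, Y \<omega>)) K \<and>
        (AE s in distr M borel \<xi>. normal_pair \<tau> (cross_covariance \<tau> u a s) (K s)))"

(* There are random vectors \<xi> with law \<nu> and (X, Y) with law \<mu>, on a common probability space,
   such that (X, Y) is conditionally normal given \<xi>. As this only depends on the joint law of
   (\<xi>, (X, Y)), the sample space is taken to be the space of its values. *)
definition normal_mixture ::
    "real ^ 'd \<Rightarrow> ('d \<Rightarrow> real ^ 'd) \<Rightarrow> ('d \<Rightarrow> real) \<Rightarrow> (real ^ 'd) measure \<Rightarrow>
     ((real ^ 'd) \<times> (real ^ 'd)) measure \<Rightarrow> bool" where
  "normal_mixture \<tau> u a \<nu> \<mu> \<longleftrightarrow>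
     (\<exists>M :: ((real ^ 'd) \<times> ((real ^ 'd) \<times> (real ^ 'd))) measure.
        prob_space M \<and> sets M = sets borel \<and>
        distr M borel fst = \<nu> \<and> distr M borel snd = \<mu> \<and>
        conditionally_normal \<tau> u a M fst (\<lambda>\<omega>. fst (snd \<omega>)) (\<lambda>\<omega>. snd (snd \<omega>)))"

end

theory Submission
  imports Defs
begin

text \<open>
  In the coordinates \<open>X'\<^sub>j = \<Sum>\<^sub>i u\<^sub>i\<^sup>(\<^sup>j\<^sup>) X\<^sub>i\<close> the marginals are products of the laws \<open>N(0, |\<tau>| a\<^sub>j)\<close>, and a
  Lancaster law is a coupling for which the products of Hermite polynomials are biorthogonal. This
  fixes all mixed moments, hence the law, because the marginals are Gaussian.

  If \<open>\<nu>\<close> has moments \<open>\<rho>\<close>, then the mixture over \<open>s \<sim> \<nu>\<close> of the pairs \<open>(W, s W + sqrt (1 - s\<^sup>2) Z)\<close> with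
  independent Gaussian \<open>W\<close>, \<open>Z\<close> is a Lancaster law for \<open>\<rho>\<close> by Mehler's formula. By uniqueness it is the
  only one, and being conditionally normal with the stated covariances characterizes it as well.

  Conversely, tilt a Lancaster law by \<open>exp (\<theta> \<bullet> X')\<close> with \<open>\<theta>\<^sub>j = r / (|\<tau>| a\<^sub>j)\<close>. Under the tilted law the
  Hermite polynomial of \<open>Y'\<close> with index \<open>n\<close> has mean \<open>\<rho>\<^sub>n r\<^bsup>|n|\<^esup>\<close>, so the moments of \<open>Y' / r\<close> tend to
  \<open>\<rho>\<close> as \<open>r \<rightarrow> \<infinity>\<close>. The even ones are at most \<open>1\<close> in the limit, which pushes the mass of \<open>Y' / r\<close> into
  the cube, and a weak limit point of these laws has moments \<open>\<rho>\<close>. Limit points are obtained from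
  Helly's theorem on the line by means of a space-filling curve.
\<close>

section \<open>Characteristic functions on Euclidean spaces\<close>

text \<open>The tilt is suggested by the mixture it has to recover. If
  \<open>Y' = s X' + noise\<close> with \<open>X'\<close> independent of the random s, weighting by
  a function of \<open>X'\<close> leaves the law of s alone. The exponential weight moves the mean
  of each coordinate of \<open>X'\<close> to r and keeps the variances, so as r grows
  \<open>X' / r\<close> tends to the vector of ones, the noise divided by r to 0, and
  \<open>Y' / r\<close> to s. The converse direction performs this limit on an arbitrary Lancaster
  law, before any mixture is known to exist. The obstacle is that such a law may be singular and its
  expansion divergent, so positivity cannot be tested pointwise. It enters only through the fact
  that the law is a measure: the tilted laws are then probability measures, and the mean square of
  \<open>H_n(X') - H_n(Y')\<close> is nonnegative. The latter gives \<rho> \<le> 1, the source of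
  the bound on the even moments.\<close>

lemma iexp_eq_cos_sin: "iexp y = complex_of_real (cos y) + \<i> * complex_of_real (sin y)"
  by (simp add: exp_Euler cos_of_real sin_of_real)

text \<open>For a weight of positive mass m this is Levy's uniqueness theorem on the line, applied
  to the laws of \<open>X\<close> under the densities \<open>w / m\<close>. The phase q supplies
  cosine and sine, hence both parts of the characteristic function, and r = 0 the equality of the
  two masses.\<close>

lemma weighted_indicator_integral_eqI:
  fixes w X :: "'a \<Rightarrow> real"
  assumes M: "prob_space M" and N: "prob_space N" and MN: "sets M = sets N"
    and [measurable]: "w \<in> borel_measurable M" "X \<in> borel_measurable M" "B \<in> sets borel"
    and w: "\<And>z. 0 \<le> w z" "\<And>z. w z \<le> K"
    and cos: "\<And>r q. (\<integral>z. w z * cos (r * X z + q) \<partial>M) = (\<integral>z. w z * cos (r * X z + q) \<partial>N)"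
  shows "(\<integral>z. w z * indicator B (X z) \<partial>M) = (\<integral>z. w z * indicator B (X z) \<partial>N)"
proof -
  have c: "(\<integral>z. w z * cos (r * X z) \<partial>M) = (\<integral>z. w z * cos (r * X z) \<partial>N)" for r
    using cos[of r 0] by simp
  have s: "(\<integral>z. w z * sin (r * X z) \<partial>M) = (\<integral>z. w z * sin (r * X z) \<partial>N)" for r
    using cos[of r "- (pi / 2)"] by (simp add: cos_diff)
  define m where "m = (\<integral>z. w z \<partial>M)"
  have m': "m = (\<integral>z. w z \<partial>N)"
    using c[of 0] by (simp add: m_def)
  have K: "0 \<le> K" using w[of undefined] by linarith
  have [measurable_cong]: "sets N = sets M" using MN by simp
  have int: "integrable L (\<lambda>z. w z * f z)" 
    if "prob_space L" "sets L = sets M" "f \<in> borel_measurable M" "\<And>z. \<bar>f z\<bar> \<le> 1" for L and f :: "'a \<Rightarrow> real"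
  proof -
    interpret L: prob_space L by fact
    have [measurable_cong]: "sets L = sets M" by fact
    have [measurable]: "f \<in> borel_measurable M" by fact
    have "\<bar>w z * f z\<bar> \<le> K" for z
      using mult_mono[OF w(2)[of z] that(4)[of z] K] w(1)[of z] by (simp add: abs_mult)
    then show ?thesis
      by (intro L.integrable_const_bound[where B=K]) auto
  qed
  show ?thesis
  \<comment> \<open>Mass zero cannot be normalized; there the weight vanishes almost
    everywhere.\<close>
  proof (cases "m = 0")
    case True
    have "(\<integral>z. w z * indicator B (X z) \<partial>L) = 0" if L: "prob_space L" "sets L = sets M" "(\<integral>z. w z \<partial>L) = 0" for L
    proof -
      have [measurable_cong]: "sets L = sets M" by fact
      have "AE z in L. w z = 0"
        using that(3) int[OF L(1,2), of "\<lambda>_. 1"] w(1) by (subst (asm) integral_nonneg_eq_0_iff_AE) auto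
      then have "AE z in L. w z * indicator B (X z) = 0" by eventually_elim simp
      then show ?thesis by (simp add: integral_eq_zero_AE)
    qed
    from this[OF M] this[OF N] True m' MN show ?thesis by (simp add: m_def)
  next
    case False
    have m_pos: "m > 0"
      using False Bochner_Integration.integral_nonneg[of M w] w(1) by (simp add: m_def less_le)
    define D where "D L = distr (density L (\<lambda>z. ennreal (w z / m))) borel X" for L
    have D: "real_distribution (D L)" "\<And>r. char (D L) r =
          complex_of_real (\<integral>z. w z * cos (r * X z) \<partial>L) / m + \<i> * (complex_of_real (\<integral>z. w z * sin (r * X z) \<partial>L) / m)"
        "measure (D L) B = (\<integral>z. w z * indicator B (X z) \<partial>L) / m"
      if L: "prob_space L" "sets L = sets M" "(\<integral>z. w z \<partial>L) = m" for L
    proof -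
      interpret L: prob_space L by fact
      have [measurable_cong]: "sets L = sets M" by fact
      have "(\<integral>\<^sup>+z. ennreal (w z / m) \<partial>L) = ennreal (\<integral>z. w z / m \<partial>L)"
        using int[OF L(1,2), of "\<lambda>_. 1/m"] int[OF L(1,2), of "\<lambda>_. 1"] w(1) m_pos
        by (intro nn_integral_eq_integral) auto
      also have "\<dots> = 1" using L(3) m_pos by simp
      finally have "emeasure (density L (\<lambda>z. ennreal (w z / m))) (space L) = 1"
        by (subst emeasure_density) (auto intro!: nn_integral_cong simp: cong: nn_integral_cong)
      then interpret P: prob_space "density L (\<lambda>z. ennreal (w z / m))"
        by (intro prob_spaceI) simp
      interpret Q: prob_space "D L" unfolding D_def by (rule P.prob_space_distr) simp
      show rd: "real_distribution (D L)"
        by unfold_locales (simp add: D_def)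
      have integral_D: "integral\<^sup>L (D L) f = (\<integral>z. w z * f (X z) \<partial>L) / m"
        if [measurable]: "f \<in> borel_measurable borel" for f :: "real \<Rightarrow> real"
      proof -
        have "integral\<^sup>L (D L) f = (\<integral>z. (w z / m) *\<^sub>R f (X z) \<partial>L)"
          unfolding D_def using w(1) m_pos by (simp add: integral_distr integral_density)
        then show ?thesis by simp
      qed
      show "measure (D L) B = (\<integral>z. w z * indicator B (X z) \<partial>L) / m"
        using integral_D[of "indicator B"] Q.emeasure_finite[of B]
        by (simp add: D_def)
      have i: "integrable (D L) (\<lambda>x. cos (r * x))" "integrable (D L) (\<lambda>x. sin (r * x))" for r
        by (rule Q.integrable_const_bound[where B=1], simp, simp add: D_def)+
      show "char (D L) r =
          complex_of_real (\<integral>z. w z * cos (r * X z) \<partial>L) / m + \<i> * (complex_of_real (\<integral>z. w z * sin (r * X z) \<partial>L) / m)" for r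
      proof -
        have "char (D L) r = (CLINT x|D L. complex_of_real (cos (r * x)) + \<i> * complex_of_real (sin (r * x)))"
          by (simp only: char_def iexp_eq_cos_sin)
        also have "\<dots> = complex_of_real (\<integral>x. cos (r * x) \<partial>D L) + \<i> * complex_of_real (\<integral>x. sin (r * x) \<partial>D L)"
          using i[of r] by (subst Bochner_Integration.integral_add) auto
        also have "\<dots> = complex_of_real (\<integral>z. w z * cos (r * X z) \<partial>L) / m + \<i> * (complex_of_real (\<integral>z. w z
            * sin (r * X z) \<partial>L) / m)"
          by (simp add: integral_D)
        finally show ?thesis .
      qed
    qed
    note DM = D[OF M refl m_def[symmetric]] and DN = D[OF N MN[symmetric] m'[symmetric]]
    have "D M = D N"
      by (rule Levy_uniqueness[OF DM(1) DN(1)]) (simp add: fun_eq_iff DM(2) DN(2) c s)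
    with DM(3) DN(3) show ?thesis using m_pos by simp
  qed
qed

text \<open>The exponential is replaced by indicators one coordinate at a time. The phase \<open>q\<close> in the induction
  covers cosines and sines at once, and the signed weight \<open>cos (t \<bullet> z + q)\<close> is made nonnegative by adding \<open>1\<close>.\<close>
theorem char_functional_uniqueness:
  fixes M N :: "'a::euclidean_space measure"
  assumes M: "prob_space M" and N: "prob_space N" and setsM: "sets M = sets borel" and setsN: "sets N = sets borel"
    and char: "\<And>t. (CLINT z|M. iexp (t \<bullet> z)) = (CLINT z|N. iexp (t \<bullet> z))"
  shows "M = N"
proof -
  have [measurable_cong]: "sets M = sets borel" "sets N = sets borel" by fact+
  have ibd: "integrable L f" if "prob_space L" "sets L = sets borel" "f \<in> borel_measurable borel" "\<And>z. \<bar>f z\<bar> \<le> 1" 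
    for L and f :: "'a \<Rightarrow> real"
    using that measurable_cong_sets[OF that(2) refl, of borel]
    by (intro finite_measure.integrable_const_bound[where B=1] prob_space.finite_measure) auto
  have split: "(CLINT z|L. iexp (t \<bullet> z)) = Complex (\<integral>z. cos (t \<bullet> z) \<partial>L) (\<integral>z. sin (t \<bullet> z) \<partial>L)"
    if L: "prob_space L" "sets L = sets borel" for L :: "'a measure" and t
  proof -
    have "(CLINT z|L. iexp (t \<bullet> z)) = (CLINT z|L. complex_of_real (cos (t \<bullet> z)) + \<i> * complex_of_real (sin (t \<bullet> z)))"
      by (simp only: iexp_eq_cos_sin)
    also have "\<dots> = complex_of_real (\<integral>z. cos (t \<bullet> z) \<partial>L) + \<i> * complex_of_real (\<integral>z. sin (t \<bullet> z) \<partial>L)"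
      using ibd[OF L, of "\<lambda>z. cos (t \<bullet> z)"] ibd[OF L, of "\<lambda>z. sin (t \<bullet> z)"]
      by (subst Bochner_Integration.integral_add) auto
    finally show ?thesis by (simp add: complex_eq_iff)
  qed
  have base: "(\<integral>z. cos (t \<bullet> z) \<partial>M) = (\<integral>z. cos (t \<bullet> z) \<partial>N)"
     "(\<integral>z. sin (t \<bullet> z) \<partial>M) = (\<integral>z. sin (t \<bullet> z) \<partial>N)" for t
    using char[of t] by (auto simp: split[OF M setsM] split[OF N setsN])
  have main: "(\<integral>z. (\<Prod>b\<in>S. indicator (A b) (z \<bullet> b)) * cos (t \<bullet> z + q) \<partial>M) =
      (\<integral>z. (\<Prod>b\<in>S. indicator (A b) (z \<bullet> b)) * cos (t \<bullet> z + q) \<partial>N)"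
    if "finite S" "\<And>b. b \<in> S \<Longrightarrow> A b \<in> sets borel" for S and A :: "'a \<Rightarrow> real set" and t q
    using that
  proof (induction arbitrary: t q rule: finite_induct)
    case empty
    have e: "cos (t \<bullet> z + q) = cos q * cos (t \<bullet> z) - sin q * sin (t \<bullet> z)" for z
      by (simp add: cos_add mult.commute)
    have i: "integrable L (\<lambda>z. cos (t \<bullet> z))" "integrable L (\<lambda>z. sin (t \<bullet> z))" if "L = M \<or> L = N" for L
      using that M N setsM setsN by (auto intro!: ibd)
    show ?case unfolding e using i by (simp add: base)
  next
    case (insert b S)
    define F :: "'a \<Rightarrow> real" where "F z = (\<Prod>b\<in>S. indicator (A b) (z \<bullet> b))" for z
    have Ab[measurable]: "A b \<in> sets borel" and AS: "\<And>c. c \<in> S \<Longrightarrow> A c \<in> sets borel"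
      using insert.prems by auto
    have "(\<lambda>z. indicator (A c) (z \<bullet> c) :: real) \<in> borel_measurable borel" if "c \<in> S" for c
      using AS[OF that] by measurable
    then have F[measurable]: "F \<in> borel_measurable borel"
      unfolding F_def by (intro borel_measurable_prod)
    have F0: "0 \<le> F z" "F z \<le> 1" for z
      unfolding F_def by (auto intro!: prod_nonneg prod_le_1 split: split_indicator)
    have IH: "(\<integral>z. F z * cos (t \<bullet> z + q) \<partial>M) = (\<integral>z. F z * cos (t \<bullet> z + q) \<partial>N)" for t q
      using insert.IH[of t q] AS by (auto simp: F_def)
    have Fi: "\<bar>F z * g\<bar> \<le> 1" if "\<bar>g\<bar> \<le> 1" for z g
      using mult_mono[OF F0(2)[of z] that] F0(1)[of z] by (simp add: abs_mult)
    have I: "integrable L (\<lambda>z. F z * cos (t \<bullet> z + q))" if "L = M \<or> L = N" for L t q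
      using that M N setsM setsN by (auto intro!: ibd Fi)
    have J: "integrable L (\<lambda>z. F z * indicator (A b) (z \<bullet> b))"
         "integrable L (\<lambda>z. F z * indicator (A b) (z \<bullet> b) * cos (t \<bullet> z + q))"
      if "L = M \<or> L = N" for L t q
      using that M N setsM setsN by (auto intro!: ibd Fi simp: mult.assoc split: split_indicator)
    have U: "(\<integral>z. w z * indicator (A b) (z \<bullet> b) \<partial>M) = (\<integral>z. w z * indicator (A b) (z \<bullet> b) \<partial>N)"
      if "w \<in> borel_measurable borel" "\<And>z. 0 \<le> w z" "\<And>z. w z \<le> 2"
         "\<And>r q. (\<integral>z. w z * cos (r * (z \<bullet> b) + q) \<partial>M) = (\<integral>z. w z * cos (r * (z \<bullet> b) + q) \<partial>N)" for w
      by (rule weighted_indicator_integral_eqI[OF M N _ _ _ _ that(2,3,4)])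
         (use setsM setsN that(1) in \<open>auto simp: measurable_cong_sets[OF setsM refl]\<close>)
    have 0: "(\<integral>z. F z * indicator (A b) (z \<bullet> b) \<partial>M) = (\<integral>z. F z * indicator (A b) (z \<bullet> b) \<partial>N)"
      using IH[of "r *\<^sub>R b" for r] F0
      by (intro U) (auto simp: inner_commute intro: order_trans[OF F0(2)])
    have "(\<integral>z. (F z * (1 + cos (t \<bullet> z + q))) * indicator (A b) (z \<bullet> b) \<partial>M) =
          (\<integral>z. (F z * (1 + cos (t \<bullet> z + q))) * indicator (A b) (z \<bullet> b) \<partial>N)"
    proof (rule U)
      fix z :: 'a
      show "0 \<le> F z * (1 + cos (t \<bullet> z + q))"
        using F0(1)[of z] cos_ge_minus_one[of "t \<bullet> z + q"] by (intro mult_nonneg_nonneg) linarith+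
      show "F z * (1 + cos (t \<bullet> z + q)) \<le> 2"
        using F0[of z] cos_ge_minus_one[of "t \<bullet> z + q"] cos_le_one[of "t \<bullet> z + q"]
        by (intro order_trans[OF mult_mono[of "F z" 1 "1 + cos (t \<bullet> z + q)" 2]]) linarith+
    next
      fix r p
      \<comment> \<open>The product of two cosines splits into cosines at the frequencies
        \<open>t - r b\<close> and \<open>t + r b\<close>, so the hypothesis of \<open>U\<close> for
        the weight \<open>F (1 + cos)\<close> follows from the induction hypothesis at the new
        frequencies and phases.\<close>
      have "(F z * (1 + cos (t \<bullet> z + q))) * cos (r * (z \<bullet> b) + p) = F z * cos ((r *\<^sub>R b) \<bullet> z + p) +
          (F z * cos ((t - r *\<^sub>R b) \<bullet> z + (q - p)) / 2 + F z * cos ((t + r *\<^sub>R b) \<bullet> z + (q + p)) / 2)" for z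
      proof -
        have "(t - r *\<^sub>R b) \<bullet> z + (q - p) = (t \<bullet> z + q) - (r * (z \<bullet> b) + p)"
          "(t + r *\<^sub>R b) \<bullet> z + (q + p) = (t \<bullet> z + q) + (r * (z \<bullet> b) + p)"
          "(r *\<^sub>R b) \<bullet> z = r * (z \<bullet> b)"
          by (simp_all add: inner_diff_left inner_add_left inner_commute[of b z])
        then show ?thesis
          using cos_times_cos[of "t \<bullet> z + q" "r * (z \<bullet> b) + p"] by (simp only:) (simp add: field_simps)
      qed
      note e = this
      have "(\<integral>z. (F z * (1 + cos (t \<bullet> z + q))) * cos (r * (z \<bullet> b) + p) \<partial>L) = (\<integral>z. F z * cos ((r *\<^sub>R b) \<bullet> z + p) \<partial>L) +
          ((\<integral>z. F z * cos ((t - r *\<^sub>R b) \<bullet> z + (q - p)) \<partial>L) / 2 + (\<integral>z. F z * cos ((t + r *\<^sub>R b) \<bullet> z + (q + p)) \<partial>L) / 2)"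
        if "L = M \<or> L = N" for L
        unfolding e using I[OF that]
        by (simp only: Bochner_Integration.integral_add Bochner_Integration.integrable_add integrable_divide
            integral_divide_zero)
      then show "(\<integral>z. (F z * (1 + cos (t \<bullet> z + q))) * cos (r * (z \<bullet> b) + p) \<partial>M) =
          (\<integral>z. (F z * (1 + cos (t \<bullet> z + q))) * cos (r * (z \<bullet> b) + p) \<partial>N)"
        by (simp only: IH simp_thms)
    qed measurable
    moreover have "(F z * (1 + cos (t \<bullet> z + q))) * indicator (A b) (z \<bullet> b) =
        F z * indicator (A b) (z \<bullet> b) + F z * indicator (A b) (z \<bullet> b) * cos (t \<bullet> z + q)" for z
      by (simp add: algebra_simps)
    ultimately have "(\<integral>z. F z * indicator (A b) (z \<bullet> b) * cos (t \<bullet> z + q) \<partial>M) =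
        (\<integral>z. F z * indicator (A b) (z \<bullet> b) * cos (t \<bullet> z + q) \<partial>N)"
      using 0 J by simp
    moreover have "(\<Prod>c\<in>insert b S. indicator (A c) (z \<bullet> c)) = F z * indicator (A b) (z \<bullet> b)" for z
      using insert.hyps by (simp add: F_def mult.commute)
    ultimately show ?case by simp
  qed
  have box: "emeasure M (box l h) = emeasure N (box l h)" for l h
  proof -
    have e: "(\<Prod>b\<in>Basis. indicator {l \<bullet> b<..<h \<bullet> b} (z \<bullet> b)) = (indicator (box l h) z :: real)" for z
    proof (cases "z \<in> box l h")
      case False
      then obtain b where "b \<in> Basis" "z \<bullet> b \<notin> {l \<bullet> b<..<h \<bullet> b}" by (auto simp: mem_box)
      then show ?thesis using False by (subst prod_zero) (auto simp: indicator_def)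
    qed (auto simp: mem_box)
    have "measure M (box l h) = measure N (box l h)"
      using main[OF finite_Basis, of "\<lambda>b. {l \<bullet> b<..<h \<bullet> b}" 0 0] setsM setsN by (simp add: e)
    then show ?thesis
      by (simp add: finite_measure.emeasure_eq_measure prob_space.finite_measure M N)
  qed
  show ?thesis
  proof (rule measure_eqI_generator_eq)
    let ?E = "range (\<lambda>(a, b). box a b::'a set)"
    show "Int_stable ?E" by (auto simp: Int_stable_def box_Int_box)
    show "?E \<subseteq> Pow UNIV" "sets M = sigma_sets UNIV ?E" "sets N = sigma_sets UNIV ?E"
      by (simp_all add: borel_eq_box setsM setsN)
    let ?A = "\<lambda>n::nat. box (- (real n *\<^sub>R One)) (real n *\<^sub>R One) :: 'a set"
    show "range ?A \<subseteq> ?E" "(\<Union>i. ?A i) = UNIV"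
      unfolding UN_box_eq_UNIV by auto
    show "emeasure M (?A i) \<noteq> \<infinity>" for i
      by (simp add: finite_measure.emeasure_eq_measure prob_space.finite_measure M)
    show "X \<in> ?E \<Longrightarrow> emeasure M X = emeasure N X" for X using box by auto
  qed
qed

section \<open>Weak compactness of laws on the cube\<close>

text \<open>An even function of period 2 that is 0 on [0, 1/3] and 1 on [2/3, 1], as in Schoenberg's
  construction. Truncating a cosine, in place of the usual broken line, makes continuity and
  periodicity immediate; the offset 1/2 is the cosine of pi/3.\<close>

definition schoenberg_wave :: "real \<Rightarrow> real" where
  "schoenberg_wave x = max 0 (min 1 (1 / 2 - cos (pi * x)))"

lemma continuous_schoenberg_wave: "continuous_on A schoenberg_wave"
  unfolding schoenberg_wave_def by (intro continuous_intros)

lemma schoenberg_wave_bounds: "0 \<le> schoenberg_wave x" "schoenberg_wave x \<le> 1"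
  by (auto simp: schoenberg_wave_def)

lemma schoenberg_wave_even_shift: "schoenberg_wave (2 * of_int k + x) = schoenberg_wave x"
proof -
  have "cos (pi * (2 * of_int k + x)) = cos (2 * pi * of_int k + pi * x)"
    by (simp add: algebra_simps)
  also have "\<dots> = cos (pi * x)"
    unfolding cos_add by simp
  finally show ?thesis by (simp add: schoenberg_wave_def)
qed

lemma schoenberg_wave_eq_0:
  assumes "0 \<le> x" "x \<le> 1 / 3" shows "schoenberg_wave x = 0"
proof -
  have "cos (pi / 3) \<le> cos (pi * x)"
    using assms by (intro cos_monotone_0_pi_le) (auto simp: field_simps)
  then show ?thesis by (simp add: schoenberg_wave_def cos_60)
qed

lemma schoenberg_wave_eq_1:
  assumes "2 / 3 \<le> x" "x \<le> 1" shows "schoenberg_wave x = 1"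
proof -
  have "cos (pi * x) \<le> cos (pi - pi / 3)"
    using assms by (intro cos_monotone_0_pi_le) (auto simp: field_simps)
  also have "\<dots> = - (1 / 2)" by (simp only: cos_pi_minus cos_60)
  finally show ?thesis by (simp add: schoenberg_wave_def)
qed

lemma ternary_sums: "(\<lambda>n. 2 / 3 ^ (n + m + 1)) sums (1 / 3 ^ m :: real)"
  using sums_mult[OF geometric_sums[of "1 / 3 :: real"], of "2 / 3 ^ (m + 1)"]
  by (simp add: power_add field_simps power_one_over)

lemma summable_ternary:
  fixes e :: "nat \<Rightarrow> real"
  assumes "\<And>i. e i \<in> {0, 1}"
  shows "summable (\<lambda>i. 2 * e i / 3 ^ (i + 1))"
proof (rule summable_comparison_test')
  show "summable (\<lambda>n. 2 / 3 ^ (n + 0 + 1) :: real)" using ternary_sums by (rule sums_summable)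
  show "norm (2 * e n / 3 ^ (n + 1)) \<le> 2 / 3 ^ (n + 0 + 1)" if "n \<ge> 0" for n
    using assms[of n] by auto
qed

text \<open>Every ternary digit is 0 or 2, so multiplying by \<open>3 ^ m\<close> turns the first m
  digits into an even integer, which periodicity removes. What remains is \<open>2 * e m / 3\<close>
  plus a tail in [0, 1/3], and this lies on one of the two flat pieces of the wave.\<close>

lemma schoenberg_wave_ternary:
  fixes e :: "nat \<Rightarrow> real"
  assumes e: "\<And>i. e i \<in> {0, 1}"
  shows "schoenberg_wave (3 ^ m * (\<Sum>i. 2 * e i / 3 ^ (i + 1))) = e m"
proof -
  define f where "f i = 2 * e i / 3 ^ (i + 1)" for i
  define T where "T = (\<Sum>i. f (i + (m + 1)))"
  note sf = summable_ternary[of e, OF e, folded f_def]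
  have f: "suminf f = T + ((\<Sum>i<m. f i) + f m)"
    using suminf_split_initial_segment[OF sf, where k="m + 1"] by (simp add: T_def)
  have "(\<Sum>i<m. e i * 3 ^ (m - i - 1)) \<in> \<int>"
  proof (intro Ints_sum Ints_mult Ints_power)
    show "e i \<in> \<int>" for i using e[of i] by auto
  qed auto
  then obtain k :: int where k: "(\<Sum>i<m. e i * 3 ^ (m - i - 1)) = of_int k"
    by (elim Ints_cases)
  have "3 ^ m * f i = 2 * (e i * 3 ^ (m - i - 1))" if "i < m" for i
  proof -
    have "m = (m - i - 1) + (i + 1)" using that by simp
    then have "(3::real) ^ m = 3 ^ (m - i - 1) * 3 ^ (i + 1)" by (metis power_add)
    then show ?thesis by (simp add: f_def)
  qed
  then have head: "3 ^ m * (\<Sum>i<m. f i) = 2 * of_int k"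
    unfolding k[symmetric] by (simp add: sum_distrib_left)
  have sT: "summable (\<lambda>i. f (i + (m + 1)))" using sf by (subst summable_iff_shift)
  have fb: "0 \<le> f i" "f i \<le> 2 / 3 ^ (i + 1)" for i
    using e[of i] by (auto simp: f_def)
  have "T \<le> (\<Sum>n. 2 / 3 ^ (n + (m + 1) + 1))"
    unfolding T_def using fb(2) by (intro suminf_le sT sums_summable[OF ternary_sums])
  also have "\<dots> = 1 / 3 ^ (m + 1)" using ternary_sums[of "m + 1"] by (rule sums_unique[symmetric])
  finally have T: "0 \<le> 3 ^ m * T" "3 ^ m * T \<le> 1 / 3"
    using suminf_nonneg[OF sT] fb(1) by (auto simp: T_def field_simps)
  have "3 ^ m * suminf f = 2 * of_int k + (3 ^ m * T + 2 * e m / 3)"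
    unfolding f distrib_left head by (simp add: f_def)
  then have "schoenberg_wave (3 ^ m * suminf f) = schoenberg_wave (3 ^ m * T + 2 * e m / 3)"
    by (simp only: schoenberg_wave_even_shift)
  also have "\<dots> = e m"
    using e[of m] T by (auto intro!: schoenberg_wave_eq_0 schoenberg_wave_eq_1)
  finally show ?thesis unfolding f_def[abs_def] .
qed

text \<open>The digit of weight \<open>1 / 2 ^ (k + 1)\<close>. Differences of floors give 0 or 1
  for every real y, also outside [0, 1), which later bounds the parameter of the curve for all
  s.\<close>

definition binary_digit :: "nat \<Rightarrow> real \<Rightarrow> real" where
  "binary_digit k y = of_int (\<lfloor>2 ^ (k + 1) * y\<rfloor> - 2 * \<lfloor>2 ^ k * y\<rfloor>)"

lemma binary_digit_cases: "binary_digit k y \<in> {0, 1}"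
proof -
  have "\<lfloor>2 ^ (k + 1) * y\<rfloor> - 2 * \<lfloor>2 ^ k * y\<rfloor> \<in> {0, 1}"
    using floor_correct[of "2 ^ (k + 1) * y"] floor_correct[of "2 ^ k * y"] by simp linarith
  then show ?thesis unfolding binary_digit_def by auto
qed

lemma borel_measurable_binary_digit[measurable]: "binary_digit k \<in> borel_measurable borel"
  unfolding binary_digit_def by measurable

text \<open>The partial sums telescope to \<open>\<lfloor>2 ^ n * y\<rfloor> / 2 ^ n\<close>, which
  is y up to an error below \<open>1 / 2 ^ n\<close>.\<close>

lemma binary_digit_sums:
  assumes "0 \<le> y" "y < 1"
  shows "(\<lambda>k. binary_digit k y / 2 ^ (k + 1)) sums y"
proof -
  have "(\<Sum>k<n. binary_digit k y / 2 ^ (k + 1)) = \<lfloor>2 ^ n * y\<rfloor> / 2 ^ n" for n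
  proof (induction n)
    case 0
    then show ?case using assms by (simp add: floor_eq_iff)
  next
    case (Suc n)
    then show ?case by (simp add: binary_digit_def field_simps)
  qed
  moreover have "(\<lambda>n. \<lfloor>2 ^ n * y\<rfloor> / 2 ^ n) \<longlonglongrightarrow> y"
  proof (rule real_tendsto_sandwich)
    show "\<forall>\<^sub>F n in sequentially. y - 1 / 2 ^ n \<le> \<lfloor>2 ^ n * y\<rfloor> / 2 ^ n"
    proof (intro always_eventually allI)
      fix n show "y - 1 / 2 ^ n \<le> \<lfloor>2 ^ n * y\<rfloor> / 2 ^ n"
        using floor_correct[of "2 ^ n * y"] divide_right_mono[of "2 ^ n * y - 1" "\<lfloor>2 ^ n * y\<rfloor>" "2 ^ n"]
        by (simp add: diff_divide_distrib)
    qed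
    show "\<forall>\<^sub>F n in sequentially. \<lfloor>2 ^ n * y\<rfloor> / 2 ^ n \<le> y"
    proof (intro always_eventually allI)
      fix n show "\<lfloor>2 ^ n * y\<rfloor> / 2 ^ n \<le> y"
        using floor_correct[of "2 ^ n * y"] divide_right_mono[of "\<lfloor>2 ^ n * y\<rfloor>" "2 ^ n * y" "2 ^ n"]
        by simp
    qed
    have "(\<lambda>n. y - (1 / 2) ^ n) \<longlonglongrightarrow> y - 0"
      by (intro tendsto_intros LIMSEQ_power_zero) auto
    then show "(\<lambda>n. y - 1 / 2 ^ n) \<longlonglongrightarrow> y" by (simp add: power_one_over)
  qed auto
  ultimately show ?thesis by (simp add: sums_def)
qed

section \<open>A space-filling curve and limits of moment sequences\<close>

lemma borel_measurable_vec_nth[measurable (raw)]: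
  fixes f :: "'a \<Rightarrow> real ^ 'd"
  shows "f \<in> borel_measurable M \<Longrightarrow> (\<lambda>x. f x $ i) \<in> borel_measurable M"
  by (rule measurable_compose[OF _ borel_measurable_nth])

lemma borel_measurable_vec_lambda[measurable (raw)]:
  fixes f :: "'d::finite \<Rightarrow> 'a \<Rightarrow> real"
  assumes "\<And>i. f i \<in> borel_measurable M"
  shows "(\<lambda>x. \<chi> i. f i x) \<in> borel_measurable M"
proof (subst borel_measurable_euclidean_space, safe)
  fix k :: "real ^ 'd" assume "k \<in> Basis"
  then obtain i where "k = axis i 1" by (auto simp: Basis_vec_def)
  then show "(\<lambda>x. (\<chi> i. f i x) \<bullet> k) \<in> borel_measurable M"
    using assms by (simp add: inner_axis)
qed

text \<open>Schoenberg's space-filling curve: the ternary digits of the parameter hold the binary digits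
  of all the coordinates. The affine map onto \<open>[1/4, 3/4]\<close> keeps clear of the expansion of \<open>1\<close>.\<close>
lemma space_filling_curve:
  obtains g :: "real \<Rightarrow> real ^ 'd" and c :: "real ^ 'd \<Rightarrow> real"
  where "continuous_on UNIV g" "\<And>t i. \<bar>g t $ i\<bar> \<le> 1"
    and "c \<in> borel_measurable borel" "\<And>s. 0 \<le> c s" "\<And>s. c s \<le> 1"
    and "\<And>s. (\<And>i. \<bar>s $ i\<bar> \<le> 1) \<Longrightarrow> g (c s) = s"
proof -
  define A :: "('d \<times> nat) set" where "A = UNIV \<times> UNIV"
  have cA: "countable A" unfolding A_def by (rule countable_SIGMA) (rule countable_finite, simp, rule countableI_type)
  define code where "code = to_nat_on A"
  define decode where "decode = from_nat_into A"
  have decode: "decode (code p) = p" for p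
    unfolding decode_def code_def by (rule from_nat_into_to_nat_on[OF cA]) (simp add: A_def)
  define h :: "'d \<Rightarrow> real \<Rightarrow> real" where "h i t = (\<Sum>k. schoenberg_wave (3 ^ code (i, k) * t) / 2 ^ (k + 1))" for i t
  \<comment> \<open>\<open>4 * h - 2\<close> undoes the map \<open>(s + 2) / 4\<close> in
    \<open>e\<close>; the clamp keeps the curve in the cube also at parameters that come from no
    point of the cube.\<close>
  define g :: "real \<Rightarrow> real ^ 'd" where "g t = (\<chi> i. max (- 1) (min 1 (4 * h i t - 2)))" for t
  define e :: "real ^ 'd \<Rightarrow> nat \<Rightarrow> real" where
    "e s m = binary_digit (snd (decode m)) ((s $ fst (decode m) + 2) / 4)" for s m
  define c where "c s = (\<Sum>m. 2 * e s m / 3 ^ (m + 1))" for s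
  have e: "e s m \<in> {0, 1}" for s m unfolding e_def by (rule binary_digit_cases)
  have "continuous_on UNIV (h i)" for i
  proof -
    have "uniform_limit UNIV (\<lambda>n t. \<Sum>k<n. schoenberg_wave (3 ^ code (i, k) * t) / 2 ^ (k + 1)) (h i) sequentially"
      unfolding h_def
    proof (rule Weierstrass_m_test)
      show "norm (schoenberg_wave (3 ^ code (i, n) * t) / 2 ^ (n + 1)) \<le> (1 / 2) ^ (n + 1)" for n t
        using schoenberg_wave_bounds[of "3 ^ code (i, n) * t"] by (simp add: field_simps)
      show "summable (\<lambda>n. (1 / 2 :: real) ^ (n + 1))"
        using summable_geometric[of "1 / 2 :: real"] by (simp add: summable_mult)
    qed
    then show ?thesis
      by (rule uniform_limit_theorem[rotated])
         (auto intro!: always_eventually continuous_intros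
            continuous_on_compose2[OF continuous_schoenberg_wave[of UNIV]])
  qed
  then have "continuous_on UNIV g"
    unfolding g_def by (intro continuous_intros)
  moreover have "\<bar>g t $ i\<bar> \<le> 1" for t i
    by (simp add: g_def)
  moreover have "c \<in> borel_measurable borel"
    unfolding c_def e_def by measurable
  moreover have "0 \<le> c s" for s
    unfolding c_def
  proof (intro suminf_nonneg summable_ternary e)
    show "0 \<le> 2 * e s n / 3 ^ (n + 1)" for n using e[of s n] by auto
  qed
  moreover have "c s \<le> 1" for s
  proof -
    have "c s \<le> (\<Sum>m. 2 / 3 ^ (m + 0 + 1))"
      unfolding c_def
    proof (intro suminf_le summable_ternary e sums_summable[OF ternary_sums])
      show "2 * e s n / 3 ^ (n + 1) \<le> 2 / 3 ^ (n + 0 + 1)" for n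
        using e[of s n] by auto
    qed
    then show ?thesis using sums_unique[OF ternary_sums[of 0]] by simp
  qed
  moreover have "g (c s) = s" if s: "\<And>i. \<bar>s $ i\<bar> \<le> 1" for s
  proof -
    have hc: "h i (c s) = (s $ i + 2) / 4" for i
    proof -
      have "schoenberg_wave (3 ^ code (i, k) * c s) = binary_digit k ((s $ i + 2) / 4)" for k
        unfolding c_def schoenberg_wave_ternary[of "e s", OF e] by (simp add: e_def decode)
      moreover have "(\<lambda>k. binary_digit k ((s $ i + 2) / 4) / 2 ^ (k + 1)) sums ((s $ i + 2) / 4)"
        using s[of i] by (intro binary_digit_sums) (auto simp: abs_le_iff)
      ultimately show ?thesis by (simp add: h_def sums_iff)
    qed
    have "4 * h i (c s) - 2 = s $ i" for i
      unfolding hc by (simp add: field_simps)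
    then have "g (c s) $ i = max (- 1) (min 1 (s $ i))" for i
      by (simp add: g_def)
    then have "g (c s) $ i = s $ i" for i
      using s[of i] by (simp add: abs_le_iff max_def min_def)
    then show ?thesis by (simp add: vec_eq_iff)
  qed
  ultimately show thesis by (rule that)
qed

text \<open>The parameter \<open>c\<close> carries all the laws to [0, 1], where they are tight, so
  a subsequence converges weakly by Helly's theorem. The curve \<open>g\<close> carries the limit
  back. Since \<open>g\<close> is continuous, each moment is the integral of a bounded continuous
  function of the parameter and passes to the limit; \<open>c\<close> only has to be
  measurable.\<close>

lemma moment_sequence_limit:
  fixes \<nu> :: "nat \<Rightarrow> (real ^ 'd) measure"
  assumes cube: "\<And>k. cube_law (\<nu> k)"
    and lim: "\<And>n. (\<lambda>k. \<integral>s. (\<Prod>j\<in>UNIV. (s $ j) ^ (n $ j)) \<partial>\<nu> k) \<longlonglongrightarrow> \<rho> n"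
  shows "\<exists>\<nu>'. cube_law \<nu>' \<and> is_moment_sequence \<rho> \<nu>'"
proof -
  obtain g :: "real \<Rightarrow> real ^ 'd" and c :: "real ^ 'd \<Rightarrow> real" where
    g: "continuous_on UNIV g" "\<And>t i. \<bar>g t $ i\<bar> \<le> 1"
    and c[measurable]: "c \<in> borel_measurable borel" and c01: "\<And>s. 0 \<le> c s" "\<And>s. c s \<le> 1"
    and gc: "\<And>s. (\<And>i. \<bar>s $ i\<bar> \<le> 1) \<Longrightarrow> g (c s) = s"
    using space_filling_curve[where ?'d='d] by metis
  have g_meas[measurable]: "g \<in> borel_measurable borel"
    using g(1) by (rule borel_measurable_continuous_onI)
  have P: "prob_space (\<nu> k)" and S[measurable_cong]: "sets (\<nu> k) = sets borel"
    and AE: "AE s in \<nu> k. \<forall>j. s $ j \<in> {-1..1}" for k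
    using cube[of k] by (auto simp: cube_law_def)
  have Q: "real_distribution (distr (\<nu> k) borel c)" for k
  proof -
    interpret prob_space "\<nu> k" by (rule P)
    interpret D: prob_space "distr (\<nu> k) borel c" by (rule prob_space_distr) simp
    show ?thesis by unfold_locales simp
  qed
  have "tight (\<lambda>k. distr (\<nu> k) borel c)"
    unfolding tight_def
  proof (intro conjI allI impI Q)
    fix \<epsilon> :: real assume "\<epsilon> > 0"
    \<comment> \<open>Tightness is stated with intervals open on the left, and \<open>c\<close> may
      take the value 0, hence the endpoint -1.\<close>
    have "measure (distr (\<nu> k) borel c) {-1<..1} = 1" for k
    proof -
      interpret prob_space "\<nu> k" by (rule P)
      have "c -` {-1<..1} \<inter> space (\<nu> k) = space (\<nu> k)"
      proof -
        have "- 1 < c s" for s using c01(1)[of s] by linarith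
        then show ?thesis using c01(2) by auto
      qed
      then show ?thesis by (simp add: measure_distr prob_space)
    qed
    then show "\<exists>a b. a < b \<and> (\<forall>n. 1 - \<epsilon> < measure (distr (\<nu> n) borel c) {a<..b})"
      using \<open>\<epsilon> > 0\<close> by (intro exI[of _ "-1"] exI[of _ 1]) auto
  qed
  from tight_imp_convergent_subsubsequence[OF this strict_mono_id]
  obtain r M where r: "strict_mono r" and M: "real_distribution M"
    and conv: "weak_conv_m ((\<lambda>k. distr (\<nu> k) borel c) \<circ> id \<circ> r) M" by auto
  interpret M: real_distribution M by fact
  define \<nu>' where "\<nu>' = distr M borel g"
  have cube': "cube_law \<nu>'"
    using M.prob_space_distr[of g borel] g(2)
    by (auto simp: cube_law_def \<nu>'_def AE_distr_iff abs_le_iff minus_le_iff)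
  have "\<rho> n = (\<integral>s. (\<Prod>j\<in>UNIV. (s $ j) ^ (n $ j)) \<partial>\<nu>')" for n
  proof -
    define f where "f = (\<lambda>s :: real ^ 'd. \<Prod>j\<in>UNIV. (s $ j) ^ (n $ j))"
    have [measurable]: "f \<in> borel_measurable borel" unfolding f_def by measurable
    have "continuous_on UNIV (\<lambda>t. f (g t))"
      unfolding f_def by (intro continuous_intros g(1))
    then have "isCont (\<lambda>t. f (g t)) t" for t by (simp add: continuous_on_eq_continuous_at)
    moreover have "norm (f (g t)) \<le> 1" for t
      unfolding f_def real_norm_def abs_prod using g(2) by (intro prod_le_1) (auto simp: power_abs power_le_one)
    ultimately have "(\<lambda>k. integral\<^sup>L (((\<lambda>k. distr (\<nu> k) borel c) \<circ> id \<circ> r) k) (\<lambda>t. f (g t))) \<longlonglongrightarrow> integral\<^sup>L M (\<lambda>t. f (g t))"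
      by (intro weak_conv_imp_integral_bdd_continuous_conv[OF _ M conv]) (auto intro: Q)
    moreover have "integral\<^sup>L (distr (\<nu> k) borel c) (\<lambda>t. f (g t)) = integral\<^sup>L (\<nu> k) f" for k
    proof -
      have "integral\<^sup>L (distr (\<nu> k) borel c) (\<lambda>t. f (g t)) = (\<integral>s. f (g (c s)) \<partial>\<nu> k)"
        by (simp add: integral_distr)
      also have "\<dots> = integral\<^sup>L (\<nu> k) f"
        using AE[of k] by (intro integral_cong_AE) (auto elim!: eventually_mono intro!: arg_cong[of _ _ f] gc simp: abs_le_iff minus_le_iff)
      finally show ?thesis .
    qed
    ultimately have "(\<lambda>k. integral\<^sup>L (\<nu> (r k)) f) \<longlonglongrightarrow> integral\<^sup>L M (\<lambda>t. f (g t))" by simp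
    moreover have "(\<lambda>k. integral\<^sup>L (\<nu> (r k)) f) \<longlonglongrightarrow> \<rho> n"
      using LIMSEQ_subseq_LIMSEQ[OF lim[of n] r] by (simp add: f_def comp_def)
    ultimately have "\<rho> n = integral\<^sup>L M (\<lambda>t. f (g t))" by (rule LIMSEQ_unique[rotated])
    also have "\<dots> = integral\<^sup>L \<nu>' f" by (simp add: \<nu>'_def integral_distr)
    finally show ?thesis by (simp add: f_def)
  qed
  with cube' show ?thesis by (auto simp: is_moment_sequence_def)
qed

section \<open>Univariate Hermite polynomials\<close>

lemma fps_compose_exp_deriv:
  fixes g :: "real fps"
  assumes "fps_nth g 0 = 0"
  shows "fps_deriv (fps_compose (fps_exp 1) g) = fps_compose (fps_exp 1) g * fps_deriv g"
  using assms by (simp add: fps_compose_deriv)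

lemma hermite_0: "hermite 0 t x = 1"
  by (simp add: hermite_def)

text \<open>The generating function F satisfies \<open>F' = F (x - t z)\<close>, and the recursion
  compares coefficients. At n = 0 the factor n disposes of the truncated index
  \<open>n - 1\<close>.\<close>

lemma hermite_Suc: "hermite (Suc n) t x = x * hermite n t x - real n * t * hermite (n - 1) t x"
proof -
  define g :: "real fps" where "g = fps_const x * fps_X - fps_const (t / 2) * fps_X ^ 2"
  define F where "F = fps_compose (fps_exp 1) g"
  have "fps_deriv g = fps_const x - fps_const t * fps_X"
    unfolding g_def by (simp add: fps_deriv_power fps_eq_iff)
  moreover have "fps_nth g 0 = 0" by (simp add: g_def)
  ultimately have "fps_deriv F = F * (fps_const x - fps_const t * fps_X)"
    unfolding F_def using fps_compose_exp_deriv by metis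
  then have "fps_nth (fps_deriv F) n = fps_nth (F * (fps_const x - fps_const t * fps_X)) n" by simp
  then have *: "real (Suc n) * fps_nth F (Suc n) = x * fps_nth F n - t * (if n = 0 then 0 else fps_nth F (n - 1))"
    by (simp add: right_diff_distrib mult.assoc[symmetric] fps_mult_right_const_nth  del: of_nat_Suc)
  have "hermite (Suc n) t x = fact n * (real (Suc n) * fps_nth F (Suc n))"
    by (simp add: hermite_def F_def g_def algebra_simps)
  also have "\<dots> = x * (fact n * fps_nth F n) - real n * t * (fact (n - 1) * fps_nth F (n - 1))"
    unfolding * by (cases n) (simp_all add: algebra_simps)
  finally show ?thesis by (simp add: hermite_def F_def g_def)
qed

text \<open>Generating functions multiply: the difference D of the two sides satisfies a first-order
  linear equation with \<open>D(0) = 0\<close>, so its coefficients vanish one after the other. The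
  variances may have any sign: s + t = 0 will invert the Hermite expansion, and t = 0 gives a
  binomial shift.\<close>

lemma hermite_add:
  "hermite n (s + t) (x + y) = (\<Sum>k\<le>n. real (n choose k) * hermite k s x * hermite (n - k) t y)"
proof -
  define G where "G t x = fps_compose (fps_exp 1) (fps_const x * fps_X - fps_const (t / 2) * fps_X ^ 2)" for t x :: real
  have nth: "fps_nth (G t x) n = hermite n t x / fact n" for n t x
    by (simp add: hermite_def G_def)
  have "G (s + t) (x + y) = G s x * G t y"
  proof -
    define g where "g t x = fps_const x * fps_X - fps_const (t / 2) * fps_X ^ 2" for t x :: real
    have g0: "fps_nth (g t x) 0 = 0" for t x by (simp add: g_def)
    define D where "D = G (s + t) (x + y) - G s x * G t y"
    have gadd: "g (s + t) (x + y) = g s x + g t y"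
      by (simp add: g_def add_divide_distrib algebra_simps flip: fps_const_add)
    have dG: "fps_deriv (G t x) = G t x * fps_deriv (g t x)" for t x
      unfolding G_def g_def[symmetric] by (rule fps_compose_exp_deriv[OF g0])
    have dD: "fps_deriv D = D * fps_deriv (g (s + t) (x + y))"
      unfolding D_def by (simp add: dG gadd algebra_simps)
    have "fps_nth D n = 0" for n
    proof (induction n rule: less_induct)
      case (less n)
      show ?case
      proof (cases n)
        case 0
        then show ?thesis by (simp add: D_def nth hermite_0)
      next
        case (Suc m)
        have "fps_nth (fps_deriv D) m = (\<Sum>i=0..m. fps_nth D i * fps_nth (fps_deriv (g (s + t) (x + y))) (m - i))"
          unfolding dD fps_mult_nth ..
        also have "\<dots> = 0" using less Suc by (intro sum.neutral) auto
        finally show ?thesis using Suc by simp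
      qed
    qed
    then have "D = 0" by (simp add: fps_eq_iff)
    then show ?thesis by (simp add: D_def)
  qed
  then have "hermite n (s + t) (x + y) = fact n * fps_nth (G s x * G t y) n"
    using nth[of "s + t" "x + y" n] by simp
  also have "\<dots> = (\<Sum>k\<le>n. real (n choose k) * hermite k s x * hermite (n - k) t y)"
    unfolding fps_mult_nth sum_distrib_left atMost_atLeast0
    by (intro sum.cong) (auto simp: nth binomial_fact)
  finally show ?thesis .
qed

text \<open>In the recursion x has weight 1 and the variance weight 2.\<close>

lemma hermite_scale: "hermite n (c\<^sup>2 * t) (c * x) = c ^ n * hermite n t x"
proof (induction n rule: less_induct)
  case (less n)
  show ?case
  proof (cases n)
    case (Suc m)
    show ?thesis
      unfolding Suc hermite_Suc[of m] using less[of m] less[of "m - 1"] Suc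
      by (cases m) (simp_all add: algebra_simps power2_eq_square)
  qed (simp add: hermite_0)
qed

lemma hermite_var_0: "hermite n 0 x = x ^ n"
  by (induction n) (simp_all add: hermite_0 hermite_Suc)

lemma hermite_0_0: "hermite n 0 0 = (if n = 0 then 1 else 0)"
  by (simp add: hermite_var_0 power_0_left)

text \<open>For the limit in which the variance shrinks to 0, where Hermite polynomials become
  monomials.\<close>

lemma isCont_hermite_var: "isCont (\<lambda>t. hermite n t x) t0"
proof (induction n rule: less_induct)
  case (less n)
  show ?case
  proof (cases n)
    case (Suc m)
    then show ?thesis
      using less[of m] less[of "m - 1"] by (cases m) (auto simp: hermite_Suc hermite_0 intro!: continuous_intros)
  qed (simp add: hermite_0)
qed

text \<open>The recursion once more, now with values in \<open>poly\<close>, so that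
  \<open>pderiv\<close> and Stein's identity for polynomials become available.\<close>

fun hermite_poly :: "nat \<Rightarrow> real \<Rightarrow> real poly" where
  "hermite_poly 0 t = 1"
| "hermite_poly (Suc 0) t = [:0, 1:]"
| "hermite_poly (Suc (Suc n)) t = [:0, 1:] * hermite_poly (Suc n) t - smult (real (Suc n) * t) (hermite_poly n t)"

lemma poly_hermite_poly: "poly (hermite_poly n t) x = hermite n t x"
  by (induction n t rule: hermite_poly.induct) (simp_all add: hermite_0 hermite_Suc)

text \<open>The Appell property. Differentiating the recursion for index n + 2 leaves
  \<open>H (n + 1)\<close> plus n + 1 times the expression that the recursion equates with
  \<open>H (n + 1)\<close>.\<close>

lemma pderiv_hermite_poly: "pderiv (hermite_poly n t) = smult (real n) (hermite_poly (n - 1) t)"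
proof (induction n t rule: hermite_poly.induct)
  case (3 n t)
  have "hermite_poly (Suc n) t = [:0, 1:] * hermite_poly n t - smult (real n * t) (hermite_poly (n - 1) t)"
    by (cases n) simp_all
  moreover have "pderiv (hermite_poly (Suc (Suc n)) t) = hermite_poly (Suc n) t +
      smult (real (Suc n)) ([:0, 1:] * hermite_poly n t - smult (real n * t) (hermite_poly (n - 1) t))"
    using 3 by (simp add: pderiv_mult pderiv_diff pderiv_smult pderiv_pCons smult_diff_right mult_ac)
  ultimately have "pderiv (hermite_poly (Suc (Suc n)) t) = smult 1 (hermite_poly (Suc n) t)
      + smult (real (Suc n)) (hermite_poly (Suc n) t)"
    by simp
  then show ?case by (simp only: smult_add_left[symmetric]) (simp add: algebra_simps)
qed (simp_all add: pderiv_pCons)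

section \<open>Gaussian integrals\<close>

definition normal_measure :: "real \<Rightarrow> real measure" where
  "normal_measure t = density lborel (\<lambda>x. ennreal (normal_density 0 (sqrt t) x))"

lemma sets_normal_measure[simp, measurable_cong]: "sets (normal_measure t) = sets borel"
  and space_normal_measure[simp]: "space (normal_measure t) = UNIV"
  by (auto simp: normal_measure_def)

lemma prob_space_normal_measure: "t > 0 \<Longrightarrow> prob_space (normal_measure t)"
  unfolding normal_measure_def by (intro prob_space_normal_density) simp

lemma integral_normal_measure:
  fixes f :: "real \<Rightarrow> 'b::{banach, second_countable_topology}"
  assumes "f \<in> borel_measurable borel"
  shows "integral\<^sup>L (normal_measure t) f = (\<integral>x. normal_density 0 (sqrt t) x *\<^sub>R f x \<partial>lborel)"
    and "integrable (normal_measure t) f \<longleftrightarrow> integrable lborel (\<lambda>x. normal_density 0 (sqrt t) x *\<^sub>R f x)"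
  unfolding normal_measure_def using assms
  by (simp_all add: integral_density integrable_density)

lemma integrable_normal_measure_power: "t > 0 \<Longrightarrow> integrable (normal_measure t) (\<lambda>x. x ^ k)"
  using integrable_normal_moment[of "sqrt t" 0 k] by (simp add: integral_normal_measure)

text \<open>Stein's identity for monomials, read off from the closed forms of the Gaussian moments
  in the two parities. The factor k covers k = 0, where \<open>k - 1\<close> is truncated.\<close>

lemma normal_measure_moment_Suc:
  assumes t: "t > 0"
  shows "(\<integral>x. x ^ Suc k \<partial>normal_measure t) = real k * t * (\<integral>x. x ^ (k - 1) \<partial>normal_measure t)"
proof (cases "even k")
  case True
  then obtain m where m: "k = 2 * m" by auto
  have odd: "(\<integral>x. x ^ (2 * m + 1) \<partial>normal_measure t) = 0" for m
    using integral_normal_moment_odd[of "sqrt t" 0 m] t by (simp add: integral_normal_measure)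
  show ?thesis
  proof (cases m)
    case (Suc l)
    then show ?thesis using odd[of m] odd[of l] m by simp
  qed (use odd[of 0] m in simp)
next
  case False
  then obtain m where m: "k = 2 * m + 1" using oddE by blast
  have even: "(\<integral>x. x ^ (2 * m) \<partial>normal_measure t) = fact (2 * m) / ((2 / t) ^ m * fact m)" for m
    using integral_normal_moment_even[of "sqrt t" 0 m] t by (simp add: integral_normal_measure)
  have "Suc k = 2 * Suc m" "k - 1 = 2 * m" using m by auto
  moreover have "2 * x * y * F / ((2 / t) * x * A) = y * t * (F / A)" if "x \<noteq> 0" for x y F A
    using t that by (simp add: field_simps)
  from this[of "real (Suc m)" "real k" "fact (2 * m)" "(2 / t) ^ m * fact m"]
  have "fact (2 * Suc m) / ((2 / t) ^ Suc m * fact (Suc m)) = real k * t * (fact (2 * m) / ((2 / t) ^ m * fact m))"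
    by (simp add: m algebra_simps del: times_divide_eq_left times_divide_eq_right divide_divide_eq_left divide_divide_eq_right)
  ultimately show ?thesis by (simp only: even)
qed

lemma integrable_normal_measure_poly: "t > 0 \<Longrightarrow> integrable (normal_measure t) (poly p)"
  unfolding poly_altdef by (intro Bochner_Integration.integrable_sum integrable_mult_right integrable_normal_measure_power)

lemma integrable_normal_measure_polyI:
  assumes "t > 0" "\<And>x. f x = poly p x"
  shows "integrable (normal_measure t) f"
proof -
  have "f = poly p" using assms(2) by auto
  then show ?thesis using integrable_normal_measure_poly[OF assms(1)] by simp
qed

lemma stein_poly:
  assumes t: "t > 0"
  shows "(\<integral>x. x * poly p x \<partial>normal_measure t) = t * (\<integral>x. poly (pderiv p) x \<partial>normal_measure t)"
proof -
  have "(\<integral>x. x * poly p x \<partial>normal_measure t) = (\<integral>x. (\<Sum>i\<le>degree p. coeff p i * x ^ Suc i) \<partial>normal_measure t)"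
    by (simp add: poly_altdef sum_distrib_left algebra_simps)
  also have "\<dots> = (\<Sum>i\<le>degree p. coeff p i * (\<integral>x. x ^ Suc i \<partial>normal_measure t))"
    using integrable_normal_measure_power[OF t] by (subst Bochner_Integration.integral_sum) (auto simp del: power_Suc)
  also have "\<dots> = t * (\<Sum>i\<le>degree p. coeff p i * (real i * (\<integral>x. x ^ (i - 1) \<partial>normal_measure t)))"
    unfolding normal_measure_moment_Suc[OF t] by (simp add: sum_distrib_left algebra_simps)
  also have "(\<Sum>i\<le>degree p. coeff p i * (real i * (\<integral>x. x ^ (i - 1) \<partial>normal_measure t))) =
             (\<integral>x. (\<Sum>i\<le>degree p. coeff p i * (real i * x ^ (i - 1))) \<partial>normal_measure t)"
    using integrable_normal_measure_power[OF t] by (subst Bochner_Integration.integral_sum) auto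
  \<comment> \<open>Both functions are derivatives of \<open>poly p\<close>, and derivatives are
    unique.\<close>
  also have "(\<lambda>x. \<Sum>i\<le>degree p. coeff p i * (real i * x ^ (i - 1))) = poly (pderiv p)"
  proof
    fix x
    have "((\<lambda>x. \<Sum>i\<le>degree p. coeff p i * x ^ i) has_real_derivative (\<Sum>i\<le>degree p. coeff p i * (real i
        * x ^ (i - 1)))) (at x)"
      by (auto intro!: derivative_eq_intros simp: mult_ac)
    moreover have "((\<lambda>x. \<Sum>i\<le>degree p. coeff p i * x ^ i) has_real_derivative poly (pderiv p) x) (at x)"
      using poly_DERIV[of p x] by (simp add: poly_altdef)
    ultimately show "(\<Sum>i\<le>degree p. coeff p i * (real i * x ^ (i - 1))) = poly (pderiv p) x"
      by (rule DERIV_unique)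
  qed
  finally show ?thesis .
qed

lemma borel_measurable_hermite[measurable]: "hermite n t \<in> borel_measurable borel"
  unfolding poly_hermite_poly[symmetric, abs_def]
  by (intro borel_measurable_continuous_onI continuous_intros)

lemma integrable_hermite_mult: "t > 0 \<Longrightarrow> integrable (normal_measure t) (\<lambda>x. hermite m t x * hermite n t x)"
  by (rule integrable_normal_measure_polyI[where p="hermite_poly m t * hermite_poly n t"])
    (simp_all add: poly_hermite_poly)

lemma integrable_hermite: "t > 0 \<Longrightarrow> integrable (normal_measure t) (hermite n t)"
  using integrable_hermite_mult[of t n 0] by (simp add: hermite_0)

text \<open>The recursion produces x times a product, Stein's identity turns this into a derivative,
  and by the Appell property the terms with m - 1 cancel. What remains lowers both indices at once,
  so the induction ends at a constant.\<close>

lemma hermite_orthogonal: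
  assumes t: "t > 0"
  shows "(\<integral>x. hermite m t x * hermite n t x \<partial>normal_measure t) = (if m = n then fact n * t ^ n else 0)"
proof -
  interpret prob_space "normal_measure t" by (rule prob_space_normal_measure[OF t])
  have step: "(\<integral>x. hermite (Suc m) t x * hermite n t x \<partial>normal_measure t) =
     real n * t * (\<integral>x. hermite m t x * hermite (n - 1) t x \<partial>normal_measure t)" for m n
  proof -
    have i: "integrable (normal_measure t) (\<lambda>x. x * (hermite m t x * hermite n t x))"
      by (rule integrable_normal_measure_polyI[OF t, where p="[:0, 1:] * (hermite_poly m t * hermite_poly n t)"])
        (simp add: poly_hermite_poly)
    have "(\<integral>x. hermite (Suc m) t x * hermite n t x \<partial>normal_measure t) =
      (\<integral>x. x * (hermite m t x * hermite n t x) - real m * t * (hermite (m - 1) t x * hermite n t x) \<partial>normal_measure t)"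
      by (simp add: hermite_Suc algebra_simps)
    also have "\<dots> = (\<integral>x. x * (hermite m t x * hermite n t x) \<partial>normal_measure t)
      - real m * t * (\<integral>x. hermite (m - 1) t x * hermite n t x \<partial>normal_measure t)"
      using i integrable_hermite_mult[OF t] by (subst Bochner_Integration.integral_diff) auto
    also have "(\<integral>x. x * (hermite m t x * hermite n t x) \<partial>normal_measure t) =
      t * (\<integral>x. real m * (hermite (m - 1) t x * hermite n t x) + real n * (hermite m t x
          * hermite (n - 1) t x) \<partial>normal_measure t)"
      using stein_poly[OF t, of "hermite_poly m t * hermite_poly n t"]
      by (simp add: poly_hermite_poly pderiv_mult pderiv_hermite_poly algebra_simps)
    also have "\<dots> = real m * t * (\<integral>x. hermite (m - 1) t x * hermite n t x \<partial>normal_measure t) +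
       real n * t * (\<integral>x. hermite m t x * hermite (n - 1) t x \<partial>normal_measure t)"
      using integrable_hermite_mult[OF t] by (subst Bochner_Integration.integral_add) (auto simp: algebra_simps)
    finally show ?thesis by simp
  qed
  show ?thesis
  proof (induction m arbitrary: n)
    case 0
    show ?case
    proof (cases n)
      case 0
      then show ?thesis using prob_space by (simp add: hermite_0)
    next
      case (Suc k)
      then show ?thesis using step[of k 0] by (simp add: hermite_0 mult.commute)
    qed
  next
    case (Suc m)
    show ?case unfolding step Suc by (cases n) auto
  qed
qed

lemma hermite_mean: "t > 0 \<Longrightarrow> (\<integral>x. hermite n t x \<partial>normal_measure t) = (if n = 0 then 1 else 0)"
  using hermite_orthogonal[of t n 0] by (simp add: hermite_0)

text \<open>Mehler's formula in probabilistic form: both summands in \<open>hermite_add\<close> are rescaled by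
  \<open>hermite_scale\<close>, and only the term of full degree in \<open>x\<close> survives the integration.\<close>
lemma hermite_mehler:
  assumes t: "t > 0" and s: "\<bar>s\<bar> \<le> 1"
  shows "(\<integral>z. hermite n t (s * x + sqrt (1 - s\<^sup>2) * z) \<partial>normal_measure t) = s ^ n * hermite n t x"
proof -
  define c where "c = sqrt (1 - s\<^sup>2)"
  have "c\<^sup>2 = 1 - s\<^sup>2" using s by (simp add: c_def abs_square_le_1)
  then have t_eq: "s\<^sup>2 * t + c\<^sup>2 * t = t" by (simp add: distrib_right[symmetric])
  have "hermite n t (s * x + c * z) = (\<Sum>k\<le>n. real (n choose k) * (s ^ k * hermite k t x) * (c ^ (n - k)
      * hermite (n - k) t z))" for z
    using hermite_add[of n "s\<^sup>2 * t" "c\<^sup>2 * t" "s * x" "c * z"] unfolding t_eq hermite_scale .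
  then have "(\<integral>z. hermite n t (s * x + c * z) \<partial>normal_measure t) =
     (\<Sum>k\<le>n. real (n choose k) * (s ^ k * hermite k t x) * (c ^ (n - k) * (\<integral>z. hermite (n - k) t z \<partial>normal_measure t)))"
    using integrable_hermite[OF t] by (simp add: Bochner_Integration.integral_sum)
  also have "\<dots> = (\<Sum>k\<le>n. if k = n then s ^ n * hermite n t x else 0)"
    by (intro sum.cong) (auto simp: hermite_mean[OF t])
  finally show ?thesis by (simp add: c_def)
qed

lemma integrable_hermite_mehler:
  assumes "t > 0"
  shows "integrable (normal_measure t) (\<lambda>z. hermite n t (u + c * z))"
  by (rule integrable_normal_measure_polyI[OF assms, where p="pcompose (hermite_poly n t) [:u, c:]"])
    (simp add: poly_pcompose poly_hermite_poly mult.commute)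

lemma char_normal_measure:
  assumes t: "t > 0"
  shows "(CLINT x|normal_measure t. iexp (r * x)) = exp (- (t * r\<^sup>2 / 2))"
proof -
  have "(CLINT x|normal_measure t. iexp (r * x)) = (CLINT x|lborel. normal_density 0 (sqrt t) x *\<^sub>R iexp (r * x))"
    by (rule integral_normal_measure) measurable
  also have "\<dots> = \<bar>sqrt t\<bar> *\<^sub>R (CLINT x|lborel. normal_density 0 (sqrt t) (0 + sqrt t * x) *\<^sub>R iexp (r * (0 + sqrt t * x)))"
    using t by (intro lborel_integral_real_affine) simp
  also have "\<dots> = (CLINT x|lborel. std_normal_density x *\<^sub>R iexp ((sqrt t * r) * x))"
    using t by (subst integral_scaleR_right[symmetric])
      (auto intro!: Bochner_Integration.integral_cong simp: normal_density_def real_sqrt_mult power_mult_distrib field_simps)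
  also have "\<dots> = char std_normal_distribution (sqrt t * r)"
    unfolding char_def by (subst integral_density) auto
  also have "\<dots> = exp (- (t * r\<^sup>2 / 2))"
    using t by (simp add: char_std_normal_distribution power_mult_distrib)
  finally show ?thesis .
qed

text \<open>Completing the square: an exponential factor shifts the mean by \<open>t * r\<close> and
  leaves the variance alone.\<close>

lemma exp_tilt_normal_density:
  assumes t: "t > 0"
  shows "normal_density 0 (sqrt t) x * exp (r * x) = exp (t * r\<^sup>2 / 2) * normal_density (t * r) (sqrt t) x"
proof -
  have "- (x\<^sup>2 / (2 * t)) + r * x = t * r\<^sup>2 / 2 - (x - t * r)\<^sup>2 / (2 * t)"
    using t by (simp add: field_simps power2_eq_square)
  then have "exp (- (x\<^sup>2 / (2 * t))) * exp (r * x) = exp (t * r\<^sup>2 / 2) * exp (- ((x - t * r)\<^sup>2 / (2 * t)))"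
    by (metis exp_add add_uminus_conv_diff)
  then show ?thesis using t by (simp add: normal_density_def)
qed

lemma exp_tilt_poly:
  assumes t: "t > 0"
  shows "integrable (normal_measure t) (\<lambda>x. exp (r * x) * poly p x)"
    and "(\<integral>x. exp (r * x) * poly p x \<partial>normal_measure t) =
      exp (t * r\<^sup>2 / 2) * (\<integral>x. poly p (x + t * r) \<partial>normal_measure t)"
proof -
  define q where "q = pcompose p [:t * r, 1:]"
  have q: "poly q x = poly p (x + t * r)" for x by (simp add: q_def poly_pcompose add.commute)
  have eq: "normal_density 0 (sqrt t) x * (exp (r * x) * poly p x) =
      exp (t * r\<^sup>2 / 2) * (normal_density (t * r) (sqrt t) x * poly p x)" for x
    using exp_tilt_normal_density[OF t, of x r] by (simp only: mult.assoc[symmetric])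
  have sh: "normal_density (t * r) (sqrt t) (t * r + 1 * x) * poly p (t * r + 1 * x)
      = normal_density 0 (sqrt t) x * poly q x" for x
    by (simp add: normal_density_def q add.commute)
  have pm[measurable]: "poly w \<in> borel_measurable borel" for w :: "real poly"
    by (intro borel_measurable_continuous_onI continuous_intros)
  have "integrable lborel (\<lambda>x. normal_density 0 (sqrt t) x * poly q x)"
    using integrable_normal_measure_poly[OF t, of q] integral_normal_measure(2)[OF pm, of t q] by simp
  then have "integrable lborel (\<lambda>x. normal_density (t * r) (sqrt t) (t * r + 1 * x) * poly p (t * r + 1 * x))"
    unfolding sh .
  then have "integrable lborel (\<lambda>x. normal_density (t * r) (sqrt t) x * poly p x)"
    using lborel_integrable_real_affine_iff[of 1 "\<lambda>x. normal_density (t * r) (sqrt t) x * poly p x" "t * r"] by simp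
  then have "integrable lborel (\<lambda>x. normal_density 0 (sqrt t) x * (exp (r * x) * poly p x))"
    unfolding eq by (rule integrable_mult_right)
  then show "integrable (normal_measure t) (\<lambda>x. exp (r * x) * poly p x)"
    by (subst integral_normal_measure(2)) simp_all
  have "(\<integral>x. exp (r * x) * poly p x \<partial>normal_measure t) = (\<integral>x. normal_density 0 (sqrt t) x * (exp (r * x)
      * poly p x) \<partial>lborel)"
    by (subst integral_normal_measure(1)) simp_all
  also have "\<dots> = exp (t * r\<^sup>2 / 2) * (\<integral>x. normal_density (t * r) (sqrt t) x * poly p x \<partial>lborel)"
    unfolding eq by simp
  also have "(\<integral>x. normal_density (t * r) (sqrt t) x * poly p x \<partial>lborel) =
      \<bar>1\<bar> *\<^sub>R (\<integral>x. normal_density (t * r) (sqrt t) (t * r + 1 * x) * poly p (t * r + 1 * x) \<partial>lborel)"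
    by (rule lborel_integral_real_affine) simp
  also have "\<dots> = (\<integral>x. poly q x \<partial>normal_measure t)"
    unfolding sh by (subst integral_normal_measure(1)) simp_all
  finally show "(\<integral>x. exp (r * x) * poly p x \<partial>normal_measure t) =
      exp (t * r\<^sup>2 / 2) * (\<integral>x. poly p (x + t * r) \<partial>normal_measure t)" by (simp only: q)
qed

lemma integrable_exp_hermite: "t > 0 \<Longrightarrow> integrable (normal_measure t) (\<lambda>x. exp (r * x) * hermite n t x)"
  using exp_tilt_poly(1)[of t r "hermite_poly n t"] by (simp add: poly_hermite_poly)

text \<open>After the shift of the mean, \<open>hermite_add\<close> with variance 0 in the second
  summand expands in powers of \<open>t * r\<close>, and all Hermite polynomials of positive degree
  have mean 0.\<close>

lemma exp_hermite_integral:
  assumes t: "t > 0"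
  shows "(\<integral>x. exp (r * x) * hermite n t x \<partial>normal_measure t) = exp (t * r\<^sup>2 / 2) * (t * r) ^ n"
proof -
  have "hermite n t (x + t * r) = (\<Sum>k\<le>n. real (n choose k) * (t * r) ^ (n - k) * hermite k t x)" for x
    using hermite_add[of n t 0 x "t * r"] by (simp add: hermite_var_0 algebra_simps)
  then have "(\<integral>x. hermite n t (x + t * r) \<partial>normal_measure t) = (\<Sum>k\<le>n. real (n choose k) * (t * r) ^ (n - k)
      * (\<integral>x. hermite k t x \<partial>normal_measure t))"
    using integrable_hermite[OF t] by (simp add: Bochner_Integration.integral_sum)
  also have "\<dots> = (\<Sum>k\<le>n. if k = 0 then (t * r) ^ n else 0)"
    by (intro sum.cong) (auto simp: hermite_mean[OF t])
  finally show ?thesis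
    using exp_tilt_poly(2)[OF t, of r "hermite_poly n t"] by (simp add: poly_hermite_poly)
qed

section \<open>Products of centred normal laws\<close>

lemma sets_normal_product[simp, measurable_cong]: "sets (normal_product b) = sets borel"
  and space_normal_product[simp]: "space (normal_product b) = UNIV"
  by (auto simp: normal_product_def)

lemma borel_measurable_normal_product_density[measurable]: "normal_product_density b \<in> borel_measurable borel"
  unfolding normal_product_density_def[abs_def] by measurable

lemma prod_Basis_vec:
  "(\<Prod>k\<in>(Basis :: (real ^ 'd) set). g k) = (\<Prod>i\<in>UNIV. g (axis i 1))"
proof -
  have *: "(Basis :: (real ^ 'd) set) = range (\<lambda>i. axis i 1)" by (auto simp: Basis_vec_def)
  show ?thesis by (subst *, subst prod.reindex) (auto simp: inj_on_def axis_eq_axis)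
qed

lemma nn_integral_lborel_vec_prod:
  fixes f :: "'d::finite \<Rightarrow> real \<Rightarrow> ennreal"
  assumes "\<And>i. f i \<in> borel_measurable borel"
  shows "(\<integral>\<^sup>+x. (\<Prod>i\<in>UNIV. f i (x $ i)) \<partial>(lborel :: (real ^ 'd) measure)) = (\<Prod>i\<in>UNIV. \<integral>\<^sup>+x. f i x \<partial>lborel)"
proof -
  \<comment> \<open>The product formula indexes its factors by unit vectors, from which
    \<open>THE\<close> recovers the label.\<close>
  define g where "g k = f (THE i. k = axis i 1)" for k :: "real ^ 'd"
  have g: "g (axis i 1) = f i" for i
    by (simp add: g_def axis_eq_axis)
  have "(\<integral>\<^sup>+x. (\<Prod>k\<in>Basis. g k (x \<bullet> k)) \<partial>(lborel :: (real ^ 'd) measure)) = (\<Prod>k\<in>Basis. \<integral>\<^sup>+x. g k x \<partial>lborel)"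
    using assms by (intro nn_integral_lborel_prod) (auto simp: g_def)
  then show ?thesis
    by (simp add: prod_Basis_vec g inner_axis)
qed

lemma sets_PiM_normal_measure[measurable_cong]:
  "sets (\<Pi>\<^sub>M i\<in>I. normal_measure (f i)) = sets (\<Pi>\<^sub>M i\<in>I. borel)"
  by (intro sets_PiM_cong) auto

lemma measurable_vec_nth_PiM[measurable]:
  "(\<lambda>x :: real ^ 'd. ($) x) \<in> borel \<rightarrow>\<^sub>M (\<Pi>\<^sub>M i\<in>(UNIV :: 'd set). borel)"
proof (rule measurable_PiM_single')
  show "(\<lambda>x :: real ^ 'd. x $ i) \<in> borel \<rightarrow>\<^sub>M borel" for i by measurable
qed auto

context
  fixes b :: "real ^ 'd"
  assumes b_pos: "\<And>i. b $ i > 0"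
begin

interpretation N1: prob_space "normal_measure (b $ i)" for i
  by (rule prob_space_normal_measure[OF b_pos])

interpretation N: product_sigma_finite "\<lambda>i. normal_measure (b $ i)"
  by standard

text \<open>Factorwise integration and the marginals of single coordinates are facts about
  \<open>PiM\<close>; this transfers them to the density on Euclidean space.\<close>

lemma normal_product_eq_PiM:
  "normal_product b = distr (\<Pi>\<^sub>M i\<in>UNIV. normal_measure (b $ i)) borel (\<lambda>f. \<chi> i. f i)"
proof -
  let ?B = "\<Pi>\<^sub>M i\<in>(UNIV :: 'd set). normal_measure (b $ i)"
  have "distr (normal_product b) ?B (\<lambda>x. ($) x) = ?B"
  proof (rule N.PiM_eqI)
    fix A assume A: "\<And>i :: 'd. i \<in> UNIV \<Longrightarrow> A i \<in> sets (normal_measure (b $ i))"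
    then have [measurable]: "A i \<in> sets borel" for i by simp
    have "Pi\<^sub>E UNIV A \<in> sets ?B" using A by (intro sets_PiM_I_finite) auto
    then have "emeasure (distr (normal_product b) ?B (\<lambda>x. ($) x)) (Pi\<^sub>E UNIV A) =
        emeasure (normal_product b) {x. \<forall>i. x $ i \<in> A i}"
      by (subst emeasure_distr) (auto intro!: arg_cong[of _ _ "emeasure _"])
    also have "\<dots> = (\<integral>\<^sup>+x. ennreal (normal_product_density b x) * indicator {x. \<forall>i. x $ i \<in> A i} x \<partial>lborel)"
      unfolding normal_product_def by (rule emeasure_density) measurable
    also have "\<dots> = (\<integral>\<^sup>+x. (\<Prod>i\<in>UNIV. ennreal (normal_density 0 (sqrt (b $ i)) (x $ i) * indicator (A i) (x $ i))) \<partial>lborel)"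
    proof (intro nn_integral_cong)
      fix x :: "real ^ 'd"
      have "(\<Prod>i\<in>UNIV. indicator (A i) (x $ i)) = (indicator {x. \<forall>i. x $ i \<in> A i} x :: real)"
        by (auto simp: indicator_def)
      then show "ennreal (normal_product_density b x) * indicator {x. \<forall>i. x $ i \<in> A i} x = 
         (\<Prod>i\<in>UNIV. ennreal (normal_density 0 (sqrt (b $ i)) (x $ i) * indicator (A i) (x $ i)))"
        by (simp add: prod_ennreal prod.distrib normal_product_density_def indicator_def)
    qed
    also have "\<dots> = (\<Prod>i\<in>UNIV. \<integral>\<^sup>+x. normal_density 0 (sqrt (b $ i)) x * indicator (A i) x \<partial>lborel)"
      by (rule nn_integral_lborel_vec_prod) auto
    also have "\<dots> = (\<Prod>i\<in>UNIV. emeasure (normal_measure (b $ i)) (A i))"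
      unfolding normal_measure_def
      by (intro prod.cong refl, subst emeasure_density) (auto intro!: nn_integral_cong split: split_indicator)
    finally show "emeasure (distr (normal_product b) ?B (\<lambda>x. ($) x)) (Pi\<^sub>E UNIV A) =
      (\<Prod>i\<in>UNIV. emeasure (normal_measure (b $ i)) (A i))" .
  qed auto
  then have "distr ?B borel (\<lambda>f. \<chi> i. f i) = distr (distr (normal_product b) ?B (\<lambda>x. ($) x)) borel (\<lambda>f. \<chi> i. f i)"
    by simp
  also have "\<dots> = distr (normal_product b) (normal_product b) (\<lambda>x. x)"
    by (subst distr_distr) (auto simp: comp_def distr_id2)
  finally show ?thesis by simp
qed

lemma prob_space_normal_product: "prob_space (normal_product b)"
proof -
  interpret P: prob_space "\<Pi>\<^sub>M i\<in>(UNIV :: 'd set). normal_measure (b $ i)"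
    by (intro prob_space_PiM N1.prob_space_axioms)
  show ?thesis unfolding normal_product_eq_PiM by (rule P.prob_space_distr) measurable
qed

lemma
  fixes f :: "'d \<Rightarrow> real \<Rightarrow> 'c::{real_normed_field, banach, second_countable_topology}"
  assumes [measurable]: "\<And>i. f i \<in> borel_measurable borel"
    and i: "\<And>i. integrable (normal_measure (b $ i)) (f i)"
  shows integrable_normal_product_prod: "integrable (normal_product b) (\<lambda>x. \<Prod>i\<in>UNIV. f i (x $ i))"
    and integral_normal_product_prod: "(\<integral>x. (\<Prod>i\<in>UNIV. f i (x $ i)) \<partial>normal_product b)
        = (\<Prod>i\<in>UNIV. \<integral>x. f i x \<partial>normal_measure (b $ i))"
proof -
  show "integrable (normal_product b) (\<lambda>x. \<Prod>i\<in>UNIV. f i (x $ i))"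
    unfolding normal_product_eq_PiM using N.product_integrable_prod[OF finite i]
    by (subst integrable_distr_eq) auto
  show "(\<integral>x. (\<Prod>i\<in>UNIV. f i (x $ i)) \<partial>normal_product b) = (\<Prod>i\<in>UNIV. \<integral>x. f i x \<partial>normal_measure (b $ i))"
    unfolding normal_product_eq_PiM using N.product_integral_prod[OF finite i]
    by (subst integral_distr) auto
qed

lemma indep_normal_product:
  "prob_space.indep_vars (normal_product b) (\<lambda>_. borel) (\<lambda>i x. x $ i) UNIV"
proof -
  interpret P: prob_space "normal_product b" by (rule prob_space_normal_product)
  have marg: "distr (normal_product b) borel (\<lambda>x. x $ i) = normal_measure (b $ i)" for i
  proof -
    have "distr (normal_product b) borel (\<lambda>x. x $ i)
        = distr (\<Pi>\<^sub>M i\<in>UNIV. normal_measure (b $ i)) (normal_measure (b $ i)) (\<lambda>f. f i)"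
      unfolding normal_product_eq_PiM by (subst distr_distr) (auto simp: comp_def intro!: distr_cong)
    also have "\<dots> = normal_measure (b $ i)"
      by (rule distr_PiM_component) (auto intro: N1.prob_space_axioms)
    finally show ?thesis .
  qed
  have r: "(\<lambda>x :: 'd \<Rightarrow> real. restrict (($) (vec_lambda x)) UNIV) = (\<lambda>x. x)"
    by (simp add: fun_eq_iff)
  have "distr (normal_product b) (\<Pi>\<^sub>M i\<in>UNIV. borel) (\<lambda>x. \<lambda>i\<in>UNIV. x $ i) =
      distr (\<Pi>\<^sub>M i\<in>(UNIV :: 'd set). normal_measure (b $ i)) (\<Pi>\<^sub>M i\<in>(UNIV :: 'd set). normal_measure (b $ i)) (\<lambda>x. x)"
    unfolding normal_product_eq_PiM by (subst distr_distr) (auto simp: comp_def r intro!: distr_id2 sets_PiM_cong)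
  then show ?thesis
    by (subst P.indep_vars_iff_distr_eq_PiM) (auto simp: marg)
qed

lemma char_normal_product:
  "(CLINT x|normal_product b. iexp (t \<bullet> x)) = exp (- ((\<Sum>i\<in>UNIV. b $ i * (t $ i)\<^sup>2) / 2))"
proof -
  have "integrable (normal_measure (b $ i)) (\<lambda>x. iexp (t $ i * x))" for i
    by (rule N1.integrable_const_bound[where B=1]) (auto simp: norm_exp_i_times[of "t $ i * x" for x, simplified])
  moreover have "iexp (t \<bullet> x) = (\<Prod>i\<in>UNIV. iexp (t $ i * x $ i))" for x
    by (simp add: inner_vec_def sum_distrib_left exp_sum)
  ultimately have "(CLINT x|normal_product b. iexp (t \<bullet> x)) = (\<Prod>i\<in>UNIV. CLINT x|normal_measure (b $ i). iexp (t $ i * x))"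
    by (simp only:) (rule integral_normal_product_prod; measurable)
  also have "\<dots> = (\<Prod>i\<in>UNIV. complex_of_real (exp (- (b $ i * (t $ i)\<^sup>2 / 2))))"
    by (simp only: char_normal_measure[OF b_pos])
  also have "\<dots> = exp (- ((\<Sum>i\<in>UNIV. b $ i * (t $ i)\<^sup>2) / 2))"
    by (simp add: exp_sum[symmetric] sum_negf sum_divide_distrib flip: exp_of_real of_real_prod)
  finally show ?thesis .
qed

end

text \<open>\<open>multi_hermite\<close> in the coordinates of \<open>hat\<close>, with
  \<open>b\<close> for the variances \<open>total \<tau> * a j\<close>; the link is
  \<open>multi_hermite_eq_herm\<close>.\<close>

definition herm :: "real ^ 'd \<Rightarrow> nat ^ 'd \<Rightarrow> real ^ 'd \<Rightarrow> real" where
  "herm b n x = (\<Prod>j\<in>UNIV. hermite (n $ j) (b $ j) (x $ j))"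

definition herm_norm :: "real ^ 'd \<Rightarrow> nat ^ 'd \<Rightarrow> real" where
  "herm_norm b n = (\<Prod>j\<in>UNIV. fact (n $ j) * b $ j ^ (n $ j))"

lemma borel_measurable_herm[measurable]: "herm b n \<in> borel_measurable borel"
  unfolding herm_def[abs_def] by measurable

lemma herm_0: "herm b 0 = (\<lambda>x. 1)"
  by (simp add: herm_def hermite_0 fun_eq_iff)

context
  fixes b :: "real ^ 'd"
  assumes b_pos: "\<And>i. b $ i > 0"
begin

lemma herm_norm_pos: "herm_norm b n > 0"
  unfolding herm_norm_def using b_pos by (intro prod_pos) simp

lemma integrable_herm_mult: "integrable (normal_product b) (\<lambda>x. herm b m x * herm b n x)"
  unfolding herm_def prod.distrib[symmetric]
  by (rule integrable_normal_product_prod[OF b_pos]) (auto intro!: integrable_hermite_mult b_pos)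

lemma herm_orthogonal:
  "(\<integral>x. herm b m x * herm b n x \<partial>normal_product b) = (if m = n then herm_norm b n else 0)"
proof -
  have "(\<integral>x. herm b m x * herm b n x \<partial>normal_product b) =
      (\<Prod>j\<in>UNIV. \<integral>x. hermite (m $ j) (b $ j) x * hermite (n $ j) (b $ j) x \<partial>normal_measure (b $ j))"
    unfolding herm_def prod.distrib[symmetric]
    by (rule integral_normal_product_prod[OF b_pos]) (auto intro!: integrable_hermite_mult b_pos)
  also have "\<dots> = (\<Prod>j\<in>UNIV. if m $ j = n $ j then fact (n $ j) * b $ j ^ (n $ j) else 0)"
    by (simp add: hermite_orthogonal b_pos)
  also have "\<dots> = (if m = n then herm_norm b n else 0)"
    by (auto simp: herm_norm_def vec_eq_iff)
  finally show ?thesis .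
qed

lemma
  shows integrable_exp_herm: "integrable (normal_product b) (\<lambda>x. exp (t \<bullet> x) * herm b n x)"
    and integral_exp_herm: "(\<integral>x. exp (t \<bullet> x) * herm b n x \<partial>normal_product b) =
      exp ((\<Sum>i\<in>UNIV. b $ i * (t $ i)\<^sup>2) / 2) * (\<Prod>i\<in>UNIV. (b $ i * t $ i) ^ (n $ i))"
proof -
  have eq: "exp (t \<bullet> x) * herm b n x = (\<Prod>i\<in>UNIV. exp (t $ i * x $ i) * hermite (n $ i) (b $ i) (x $ i))" for x
    by (simp add: inner_vec_def herm_def prod.distrib exp_sum)
  show "integrable (normal_product b) (\<lambda>x. exp (t \<bullet> x) * herm b n x)"
    unfolding eq by (rule integrable_normal_product_prod[OF b_pos]) (auto intro!: integrable_exp_hermite b_pos)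
  have "(\<integral>x. exp (t \<bullet> x) * herm b n x \<partial>normal_product b) =
      (\<Prod>i\<in>UNIV. \<integral>x. exp (t $ i * x) * hermite (n $ i) (b $ i) x \<partial>normal_measure (b $ i))"
    unfolding eq by (rule integral_normal_product_prod[OF b_pos]) (auto intro!: integrable_exp_hermite b_pos)
  also have "\<dots> = exp ((\<Sum>i\<in>UNIV. b $ i * (t $ i)\<^sup>2) / 2) * (\<Prod>i\<in>UNIV. (b $ i * t $ i) ^ (n $ i))"
    by (simp add: exp_hermite_integral b_pos prod.distrib exp_sum sum_divide_distrib)
  finally show "(\<integral>x. exp (t \<bullet> x) * herm b n x \<partial>normal_product b) =
      exp ((\<Sum>i\<in>UNIV. b $ i * (t $ i)\<^sup>2) / 2) * (\<Prod>i\<in>UNIV. (b $ i * t $ i) ^ (n $ i))" .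
qed

lemma integrable_exp_normal_product: "integrable (normal_product b) (\<lambda>x. exp (t \<bullet> x))"
  using integrable_exp_herm[of t 0] by (simp add: herm_0)

end

section \<open>Polynomials as combinations of Hermite polynomials\<close>

text \<open>Finite linear combinations, as an inductive predicate so that statements linear in the
  polynomial can be proved by induction on the rules.\<close>

inductive herm_span :: "real ^ 'd \<Rightarrow> (real ^ 'd \<Rightarrow> real) \<Rightarrow> bool" for b where
  herm: "herm_span b (herm b n)"
| add: "herm_span b f \<Longrightarrow> herm_span b g \<Longrightarrow> herm_span b (\<lambda>x. f x + g x)"
| scale: "herm_span b f \<Longrightarrow> herm_span b (\<lambda>x. c * f x)"

text \<open>The three-term recursion read backwards in coordinate j:
  \<open>x H_n = H_(n+1) + n b H_(n-1)\<close>.\<close>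

lemma herm_span_mult_component: "herm_span b f \<Longrightarrow> herm_span b (\<lambda>x. x $ j * f x)"
proof (induction rule: herm_span.induct)
  case (herm n)
  define up where "up = (\<chi> i. if i = j then Suc (n $ i) else n $ i)"
  \<comment> \<open>Truncated if \<open>n $ j = 0\<close>, but then its coefficient
    \<open>n $ j * b $ j\<close> vanishes.\<close>
  define dn where "dn = (\<chi> i. if i = j then n $ i - 1 else n $ i)"
  have rem: "herm b m x = hermite (m $ j) (b $ j) (x $ j) * (\<Prod>i\<in>UNIV - {j}. hermite (m $ i) (b $ i) (x $ i))" for m x
    unfolding herm_def by (rule prod.remove) auto
  have "x $ j * herm b n x = herm b up x + (real (n $ j) * b $ j) * herm b dn x" for x
  proof -
    have "(\<Prod>i\<in>UNIV - {j}. hermite (up $ i) (b $ i) (x $ i)) = (\<Prod>i\<in>UNIV - {j}. hermite (n $ i) (b $ i) (x $ i))"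
      "(\<Prod>i\<in>UNIV - {j}. hermite (dn $ i) (b $ i) (x $ i)) = (\<Prod>i\<in>UNIV - {j}. hermite (n $ i) (b $ i) (x $ i))"
      by (auto intro!: prod.cong simp: up_def dn_def)
    moreover have "up $ j = Suc (n $ j)" "dn $ j = n $ j - 1" by (auto simp: up_def dn_def)
    ultimately show ?thesis
      by (simp add: rem[of up] rem[of dn] rem[of n] hermite_Suc algebra_simps)
  qed
  then show ?case by (simp only:) (intro herm_span.intros)
next
  case (add f g)
  then show ?case using herm_span.add[OF add.IH] by (simp add: distrib_left)
next
  case (scale f c)
  then show ?case using herm_span.scale[OF scale.IH, of c] by (simp add: mult_ac)
qed

lemma herm_span_sum:
  assumes "finite I" "\<And>i. i \<in> I \<Longrightarrow> herm_span b (f i)"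
  shows "herm_span b (\<lambda>x. \<Sum>i\<in>I. f i x)"
  using assms
proof (induction rule: finite_induct)
  case empty
  show ?case using herm_span.scale[OF herm_span.herm, of b 0 0] by simp
next
  case (insert i I)
  then show ?case using herm_span.add[of b "f i" "\<lambda>x. \<Sum>i\<in>I. f i x"] by simp
qed

lemma herm_span_mult_linear:
  assumes h: "bounded_linear h" and f: "herm_span b f"
  shows "herm_span b (\<lambda>x. h x * f x)"
proof -
  have h_eq: "h x = (\<Sum>i\<in>UNIV. h (axis i 1) * x $ i)" for x
  proof -
    interpret bounded_linear h by fact
    have "h x = h (\<Sum>i\<in>UNIV. x $ i *\<^sub>R axis i 1)"
      by (rule arg_cong[of _ _ h]) (simp add: vec_eq_iff axis_def if_distrib[of "\<lambda>x. _ * x"] cong: if_cong)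
    then show ?thesis by (simp add: sum scale mult.commute)
  qed
  have "h x * f x = (\<Sum>i\<in>UNIV. h (axis i 1) * (x $ i * f x))" for x
    by (subst h_eq) (simp add: sum_distrib_right mult.assoc)
  then show ?thesis
    by (simp only:) (intro herm_span_sum herm_span.scale herm_span_mult_component f, simp)
qed

lemma real_polynomial_function_herm_span:
  assumes "real_polynomial_function p" shows "herm_span b p"
proof -
  \<comment> \<open>Stronger than \<open>herm_span b p\<close> in order that products go through:
    multiplication by \<open>p * q\<close> is multiplication by q and then by p.\<close>
  have "herm_span b (\<lambda>x. p x * f x)" if "herm_span b f" for f
    using assms that
  proof (induction arbitrary: f rule: real_polynomial_function.induct)
    case (linear h)
    then show ?case by (intro herm_span_mult_linear)
  next
    case (const c)
    then show ?case by (intro herm_span.scale)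
  next
    case (add p q)
    then show ?case using herm_span.add[of b "\<lambda>x. p x * f x" "\<lambda>x. q x * f x"] by (simp add: distrib_right)
  next
    case (mult p q)
    then show ?case by (simp add: mult.assoc)
  qed
  from this[OF herm_span.herm[of b 0]] show ?thesis by (simp add: herm_0)
qed

lemma real_polynomial_function_hermite:
  assumes "real_polynomial_function p"
  shows "real_polynomial_function (\<lambda>x. hermite n t (p x))"
proof (induction n rule: less_induct)
  case (less n)
  show ?case
  proof (cases n)
    case 0
    then show ?thesis by (simp add: hermite_0 real_polynomial_function.intros(2))
  next
    case (Suc m)
    have "real_polynomial_function (\<lambda>x. p x * hermite m t (p x) - (real m * t) * hermite (m - 1) t (p x))"
      using less[of m] less[of "m - 1"] Suc assms
      by (intro real_polynomial_function_diff real_polynomial_function.intros(4) real_polynomial_function.intros(2)) auto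
    then show ?thesis by (simp add: Suc hermite_Suc)
  qed
qed

lemma real_polynomial_function_component: "real_polynomial_function (\<lambda>x :: real ^ 'd. x $ i)"
  by (intro real_polynomial_function.intros(1) bounded_linear_vec_nth)

lemma real_polynomial_function_herm: "real_polynomial_function (herm b n)"
  unfolding herm_def[abs_def]
  by (intro real_polynomial_function_prod real_polynomial_function_hermite real_polynomial_function_component) auto

text \<open>Reduces an identity linear in a polynomial to the Hermite polynomials. That f and g are
  again polynomials provides the integrability that linearity of the integral asks for.\<close>

lemma real_polynomial_function_herm_induct[consumes 1, case_names herm add scale]:
  assumes p: "real_polynomial_function p"
    and herm: "\<And>n. Q (herm b n)"
    and add: "\<And>f g. real_polynomial_function f \<Longrightarrow> real_polynomial_function g \<Longrightarrow> Q f \<Longrightarrow> Q g \<Longrightarrow> Q (\<lambda>x. f x + g x)"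
    and scale: "\<And>f c. real_polynomial_function f \<Longrightarrow> Q f \<Longrightarrow> Q (\<lambda>x. c * f x)"
  shows "Q p"
proof -
  have "real_polynomial_function f \<and> Q f" if "herm_span b f" for f
    using that
  proof (induction rule: herm_span.induct)
    case (herm n)
    show ?case using assms(2) by (simp add: real_polynomial_function_herm)
  next
    case (add f g)
    then show ?case using assms(3) by (simp add: real_polynomial_function.intros(3))
  next
    case (scale f c)
    then show ?case using assms(4) by (simp add: real_polynomial_function.intros(4) real_polynomial_function.intros(2))
  qed
  then show ?thesis using real_polynomial_function_herm_span[OF p] by blast
qed

lemma borel_measurable_real_polynomial_function:
  "real_polynomial_function p \<Longrightarrow> p \<in> borel_measurable borel"
  by (intro borel_measurable_continuous_onI continuous_on_polymonial_function)
    (simp add: real_polynomial_function_eq)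

lemma integrable_real_polynomial_function:
  assumes b_pos: "\<And>i. b $ i > 0" and p: "real_polynomial_function p"
  shows "integrable (normal_product b) p"
  using p
proof (induction rule: real_polynomial_function_herm_induct[where b=b])
  case (herm n)
  then show ?case using integrable_herm_mult[OF b_pos, of n 0] by (simp add: herm_0)
qed auto

section \<open>Bivariate laws that are diagonal in Hermite polynomials\<close>

text \<open>\<open>lancaster_law\<close> in the coordinates of \<open>hat\<close>;
  \<open>herm_norm b n\<close> stands for \<open>1 / hermite_h\<close>.\<close>

definition hermite_diagonal :: "real ^ 'd \<Rightarrow> (nat ^ 'd \<Rightarrow> real) \<Rightarrow> ((real ^ 'd) \<times> (real ^ 'd)) measure \<Rightarrow> bool" where
  "hermite_diagonal b \<rho> \<mu> \<longleftrightarrow>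
     prob_space \<mu> \<and> sets \<mu> = sets borel \<and>
     distr \<mu> borel fst = normal_product b \<and> distr \<mu> borel snd = normal_product b \<and>
     (\<forall>m n. (\<integral>z. herm b m (fst z) * herm b n (snd z) \<partial>\<mu>) = (if m = n then \<rho> n * herm_norm b n else 0))"

lemma abs_mult_le_sum_squares:
  fixes x y :: real
  shows "\<bar>x * y\<bar> \<le> x\<^sup>2 + y\<^sup>2"
proof -
  have "0 \<le> (\<bar>x\<bar> - \<bar>y\<bar>)\<^sup>2" by simp
  then have "2 * \<bar>x * y\<bar> \<le> x\<^sup>2 + y\<^sup>2" by (simp add: power2_diff abs_mult)
  then show ?thesis by simp
qed

text \<open>A coupling is known only through its marginals, so a mixed product is dominated by a sum
  of squares that involve one marginal each.\<close>

lemma integrable_coupling_mult: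
  fixes f g :: "'a::euclidean_space \<Rightarrow> real" and \<mu> :: "('a \<times> 'a) measure"
  assumes [measurable_cong]: "sets \<mu> = sets (borel \<Otimes>\<^sub>M borel)"
    and fst: "distr \<mu> borel fst = N" and snd: "distr \<mu> borel snd = N"
    and [measurable]: "f \<in> borel_measurable borel" "g \<in> borel_measurable borel"
    and f: "integrable N (\<lambda>x. (f x)\<^sup>2)" and g: "integrable N (\<lambda>x. (g x)\<^sup>2)"
  shows "integrable \<mu> (\<lambda>z. f (fst z) * g (snd z))"
proof (rule Bochner_Integration.integrable_bound)
  have "integrable \<mu> (\<lambda>z. (f (fst z))\<^sup>2)"
    using f unfolding fst[symmetric] by (subst (asm) integrable_distr_eq) auto
  moreover have "integrable \<mu> (\<lambda>z. (g (snd z))\<^sup>2)"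
    using g unfolding snd[symmetric] by (subst (asm) integrable_distr_eq) auto
  ultimately show "integrable \<mu> (\<lambda>z. (f (fst z))\<^sup>2 + (g (snd z))\<^sup>2)" by simp
  show "AE z in \<mu>. norm (f (fst z) * g (snd z)) \<le> norm ((f (fst z))\<^sup>2 + (g (snd z))\<^sup>2)"
    by (simp add: abs_mult_le_sum_squares)
qed measurable

text \<open>A majorant independent of n, for dominated convergence along the exponential
  series.\<close>

lemma exp_partial_sum_bound:
  fixes w :: "'a::{real_normed_field, banach}"
  shows "norm (\<Sum>k<n. w ^ k /\<^sub>R fact k) \<le> exp (norm w)"
proof -
  have "norm (\<Sum>k<n. w ^ k /\<^sub>R fact k) \<le> (\<Sum>k<n. norm w ^ k /\<^sub>R fact k)"
    by (intro order_trans[OF norm_sum] sum_mono) (simp add: norm_power)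
  also have "\<dots> \<le> exp (norm w)"
    unfolding exp_def using summable_exp_generic[of "norm w"] by (intro sum_le_suminf) auto
  finally show ?thesis .
qed

lemma exp_partial_sum_tendsto:
  fixes w :: "'a::{real_normed_field, banach}"
  shows "(\<lambda>n. \<Sum>k<n. w ^ k /\<^sub>R fact k) \<longlonglongrightarrow> exp w"
  unfolding exp_def using summable_LIMSEQ[OF summable_exp_generic[of w]] by simp

context
  fixes b :: "real ^ 'd"
  assumes b_pos: "\<And>i. b $ i > 0"
begin

interpretation N: prob_space "normal_product b"
  by (rule prob_space_normal_product[OF b_pos])

text \<open>Squares, because the exponential will be paired with a function of the other marginal;
  \<open>exp (2 \<bar>y\<bar>)\<close> is at most \<open>exp (2 y) + exp (- 2 y)\<close>.\<close>

lemma square_integrable_exp_abs: "integrable (normal_product b) (\<lambda>x. (exp \<bar>t \<bullet> x\<bar>)\<^sup>2)"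
proof (rule Bochner_Integration.integrable_bound)
  show "integrable (normal_product b) (\<lambda>x. exp ((2 *\<^sub>R t) \<bullet> x) + exp ((- 2 *\<^sub>R t) \<bullet> x))"
    by (intro Bochner_Integration.integrable_add integrable_exp_normal_product b_pos)
  have "(exp \<bar>t \<bullet> x\<bar>)\<^sup>2 \<le> exp ((2 *\<^sub>R t) \<bullet> x) + exp ((- 2 *\<^sub>R t) \<bullet> x)" for x
    by (cases "t \<bullet> x \<ge> 0") (simp_all add: exp_double[symmetric])
  then show "AE x in normal_product b. norm ((exp \<bar>t \<bullet> x\<bar>)\<^sup>2) \<le> norm (exp ((2 *\<^sub>R t) \<bullet> x) + exp ((- 2 *\<^sub>R t) \<bullet> x))"
    by (intro always_eventually allI) (smt (verit) norm_power norm_ge_zero real_norm_def exp_ge_zero zero_le_power)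
qed measurable

lemma square_integrable_real_polynomial_function:
  "real_polynomial_function p \<Longrightarrow> integrable (normal_product b) (\<lambda>x. (p x)\<^sup>2)"
  using integrable_real_polynomial_function[OF b_pos real_polynomial_function.intros(4), of p p]
  by (simp add: power2_eq_square)

context
  fixes \<rho> :: "nat ^ 'd \<Rightarrow> real" and \<mu> :: "((real ^ 'd) \<times> (real ^ 'd)) measure"
  assumes diag: "hermite_diagonal b \<rho> \<mu>"
begin

interpretation M: prob_space \<mu>
  using diag by (simp add: hermite_diagonal_def)

lemma sets_diagonal: "sets \<mu> = sets (borel \<Otimes>\<^sub>M borel)"
  and fst_diagonal: "distr \<mu> borel fst = normal_product b"
  and snd_diagonal: "distr \<mu> borel snd = normal_product b"
  and integral_herm_diagonal: "(\<integral>z. herm b m (fst z) * herm b n (snd z) \<partial>\<mu>) = (if m = n then \<rho> n * herm_norm b n else 0)"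
  using diag by (simp_all only: hermite_diagonal_def borel_prod)

lemma integrable_diagonal_mult:
  fixes f g :: "real ^ 'd \<Rightarrow> real"
  assumes "f \<in> borel_measurable borel" "g \<in> borel_measurable borel"
    and "integrable (normal_product b) (\<lambda>x. (f x)\<^sup>2)" "integrable (normal_product b) (\<lambda>x. (g x)\<^sup>2)"
  shows "integrable \<mu> (\<lambda>z. f (fst z) * g (snd z))"
  using integrable_coupling_mult[OF sets_diagonal fst_diagonal snd_diagonal assms] .

lemma integrable_diagonal_poly:
  "real_polynomial_function p \<Longrightarrow> real_polynomial_function q \<Longrightarrow> integrable \<mu> (\<lambda>z. p (fst z) * q (snd z))"
  by (intro integrable_diagonal_mult borel_measurable_real_polynomial_function square_integrable_real_polynomial_function)

text \<open>In probabilistic terms the regression of \<open>H_n(Y)\<close> on X is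
  \<open>\<rho> n\<close> times \<open>H_n(X)\<close>, tested here against polynomials: both sides
  are linear in p and agree on Hermite polynomials.\<close>

lemma integral_poly_herm_diagonal:
  assumes "real_polynomial_function p"
  shows "(\<integral>z. p (fst z) * herm b n (snd z) \<partial>\<mu>) = \<rho> n * (\<integral>x. p x * herm b n x \<partial>normal_product b)"
  using assms
proof (induction rule: real_polynomial_function_herm_induct[where b=b])
  case (herm m)
  then show ?case by (simp add: integral_herm_diagonal herm_orthogonal[OF b_pos])
next
  case (add f g)
  note poly = add.hyps real_polynomial_function_herm[of b n]
  have "integrable (normal_product b) (\<lambda>x. h x * herm b n x)" if "real_polynomial_function h" for h
    using that real_polynomial_function_herm
        by (intro integrable_real_polynomial_function b_pos real_polynomial_function.intros(4))
  then show ?case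
    using add integrable_diagonal_poly[OF _ poly(3)] poly by (simp add: distrib_right distrib_left)
next
  case (scale f c)
  then show ?case by (simp add: mult.assoc)
qed

text \<open>The polynomial case passes to the limit along the Taylor polynomials of the exponential,
  on both sides with a majorant of the form
  \<open>exp \<bar>t \<bullet> x\<bar> * \<bar>herm b n y\<bar>\<close>.\<close>

lemma integral_exp_herm_diagonal:
  shows "(\<integral>z. exp (t \<bullet> fst z) * herm b n (snd z) \<partial>\<mu>) =
    \<rho> n * (exp ((\<Sum>i\<in>UNIV. b $ i * (t $ i)\<^sup>2) / 2) * (\<Prod>i\<in>UNIV. (b $ i * t $ i) ^ (n $ i)))"
proof -
  note [measurable_cong] = sets_diagonal
  define p where "p K x = (\<Sum>k<K. (t \<bullet> x) ^ k /\<^sub>R fact k)" for K :: nat and x :: "real ^ 'd"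
  have p: "real_polynomial_function (p K)" for K
    unfolding p_def[abs_def] divide_inverse[symmetric] scaleR_conv_of_real
    by (intro real_polynomial_function_sum real_polynomial_function.intros(4) real_polynomial_function.intros(2)
          real_polynomial_function_power real_polynomial_function.intros(1) bounded_linear_inner_right) auto
  have [measurable]: "p K \<in> borel_measurable borel" for K
    by (rule borel_measurable_real_polynomial_function[OF p])
  have bd: "\<bar>p K x * herm b n y\<bar> \<le> \<bar>exp \<bar>t \<bullet> x\<bar> * herm b n y\<bar>" for K x y
    using exp_partial_sum_bound[of "t \<bullet> x" K] by (simp add: abs_mult p_def mult_right_mono)
  have lim: "(\<lambda>K. p K x * herm b n y) \<longlonglongrightarrow> exp (t \<bullet> x) * herm b n y" for x y
    unfolding p_def by (intro tendsto_intros exp_partial_sum_tendsto)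
  have "(\<lambda>K. \<integral>z. p K (fst z) * herm b n (snd z) \<partial>\<mu>) \<longlonglongrightarrow> (\<integral>z. exp (t \<bullet> fst z) * herm b n (snd z) \<partial>\<mu>)"
  proof (rule integral_dominated_convergence)
    show "integrable \<mu> (\<lambda>z. \<bar>exp \<bar>t \<bullet> fst z\<bar> * herm b n (snd z)\<bar>)"
      by (intro integrable_abs integrable_diagonal_mult square_integrable_exp_abs
          square_integrable_real_polynomial_function real_polynomial_function_herm) measurable
  qed (auto simp: bd lim)
  moreover have "(\<lambda>K. \<integral>x. p K x * herm b n x \<partial>normal_product b) \<longlonglongrightarrow> (\<integral>x. exp (t \<bullet> x) * herm b n x \<partial>normal_product b)"
  proof (rule integral_dominated_convergence)
    have "integrable (normal_product b) (\<lambda>x. (exp \<bar>t \<bullet> x\<bar>)\<^sup>2 + (herm b n x)\<^sup>2)"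
      by (intro Bochner_Integration.integrable_add square_integrable_exp_abs
          square_integrable_real_polynomial_function real_polynomial_function_herm)
    then show "integrable (normal_product b) (\<lambda>x. \<bar>exp \<bar>t \<bullet> x\<bar> * herm b n x\<bar>)"
    proof (rule Bochner_Integration.integrable_bound)
      show "AE x in normal_product b. norm \<bar>exp \<bar>t \<bullet> x\<bar> * herm b n x\<bar> \<le> norm ((exp \<bar>t \<bullet> x\<bar>)\<^sup>2 + (herm b n x)\<^sup>2)"
        by (intro always_eventually allI) (simp only: real_norm_def abs_idempotent, rule order_trans[OF abs_mult_le_sum_squares abs_ge_self])
    qed measurable
  qed (auto simp: bd lim)
  ultimately have "(\<integral>z. exp (t \<bullet> fst z) * herm b n (snd z) \<partial>\<mu>) = \<rho> n * (\<integral>x. exp (t \<bullet> x) * herm b n x \<partial>normal_product b)"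
    unfolding integral_poly_herm_diagonal[OF p]
    by (intro LIMSEQ_unique[OF _ tendsto_mult_left])
  then show ?thesis by (simp add: integral_exp_herm[OF b_pos])
qed

text \<open>The majorant \<open>exp \<bar>s \<bullet> X\<bar> * exp \<bar>t \<bullet>
  Y\<bar>\<close> is integrable for all s and t because both marginals have Gaussian tails, so
  series and integral may be interchanged without a bound on s and t.\<close>

lemma char_diagonal_series:
  "(\<lambda>n. \<Sum>k<n. \<i> ^ k * complex_of_real (\<integral>z. (s \<bullet> fst z + t \<bullet> snd z) ^ k \<partial>\<mu>) /\<^sub>R fact k)
     \<longlonglongrightarrow> (CLINT z|\<mu>. iexp (s \<bullet> fst z + t \<bullet> snd z))"
proof -
  note [measurable_cong] = sets_diagonal
  let ?w = "\<lambda>z. s \<bullet> fst z + t \<bullet> snd z"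
  have int: "integrable \<mu> (\<lambda>z. ?w z ^ k)" for k
  proof -
    have "integrable \<mu> (\<lambda>z. \<Sum>j\<le>k. real (k choose j) * ((s \<bullet> fst z) ^ j * (t \<bullet> snd z) ^ (k - j)))"
      by (intro Bochner_Integration.integrable_sum integrable_mult_right integrable_diagonal_poly
          real_polynomial_function_power real_polynomial_function.intros(1) bounded_linear_inner_right)
    then show ?thesis by (simp add: binomial_ring mult.assoc)
  qed
  have "(\<lambda>n. CLINT z|\<mu>. (\<Sum>k<n. (\<i> * ?w z) ^ k /\<^sub>R fact k)) \<longlonglongrightarrow> (CLINT z|\<mu>. iexp (?w z))"
  proof (rule integral_dominated_convergence)
    show "integrable \<mu> (\<lambda>z. exp \<bar>s \<bullet> fst z\<bar> * exp \<bar>t \<bullet> snd z\<bar>)"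
      by (intro integrable_diagonal_mult square_integrable_exp_abs) measurable
    show "AE z in \<mu>. (\<lambda>n. \<Sum>k<n. (\<i> * ?w z) ^ k /\<^sub>R fact k) \<longlonglongrightarrow> iexp (?w z)"
      by (intro always_eventually allI exp_partial_sum_tendsto)
    have "norm (\<Sum>k<n. (\<i> * ?w z) ^ k /\<^sub>R fact k) \<le> exp \<bar>s \<bullet> fst z\<bar> * exp \<bar>t \<bullet> snd z\<bar>" for n z
    proof -
      have "norm (\<i> * complex_of_real (?w z)) = \<bar>?w z\<bar>" by (simp only: norm_mult norm_of_real norm_ii mult_1)
      then have "norm (\<Sum>k<n. (\<i> * ?w z) ^ k /\<^sub>R fact k) \<le> exp \<bar>?w z\<bar>"
        using exp_partial_sum_bound[of "\<i> * complex_of_real (?w z)" n] by (simp only:)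
      also have "\<dots> \<le> exp (\<bar>s \<bullet> fst z\<bar> + \<bar>t \<bullet> snd z\<bar>)" by simp
      finally show ?thesis by (simp only: exp_add)
    qed
    then show "AE z in \<mu>. norm (\<Sum>k<n. (\<i> * ?w z) ^ k /\<^sub>R fact k) \<le> exp \<bar>s \<bullet> fst z\<bar> * exp \<bar>t \<bullet> snd z\<bar>" for n
      by (intro always_eventually allI)
  qed measurable
  moreover have "(CLINT z|\<mu>. (\<Sum>k<n. (\<i> * ?w z) ^ k /\<^sub>R fact k)) =
      (\<Sum>k<n. \<i> ^ k * complex_of_real (\<integral>z. ?w z ^ k \<partial>\<mu>) /\<^sub>R fact k)" for n
  proof -
    have i: "integrable \<mu> (\<lambda>z. complex_of_real (?w z ^ k))" for k
      using int[of k] by (rule integrable_of_real)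
    have "(CLINT z|\<mu>. (\<Sum>k<n. (\<i> * ?w z) ^ k /\<^sub>R fact k)) =
       (CLINT z|\<mu>. (\<Sum>k<n. (\<i> ^ k /\<^sub>R fact k) * complex_of_real (?w z ^ k)))"
      by (simp only: power_mult_distrib of_real_power mult_scaleR_left)
    also have "\<dots> = (\<Sum>k<n. (\<i> ^ k /\<^sub>R fact k) * (CLINT z|\<mu>. complex_of_real (?w z ^ k)))"
      by (subst Bochner_Integration.integral_sum) (use i in \<open>auto simp del: of_real_power of_real_add\<close>)
    also have "\<dots> = (\<Sum>k<n. \<i> ^ k * complex_of_real (\<integral>z. ?w z ^ k \<partial>\<mu>) /\<^sub>R fact k)"
      by (simp only: integral_complex_of_real mult_scaleR_left)
    finally show ?thesis .
  qed
  ultimately show ?thesis by (simp only:)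
qed

end

lemma hermite_diagonal_poly_unique:
  assumes \<mu>: "hermite_diagonal b \<rho> \<mu>" and \<mu>': "hermite_diagonal b \<rho> \<mu>'"
    and p: "real_polynomial_function p" and q: "real_polynomial_function q"
  shows "(\<integral>z. p (fst z) * q (snd z) \<partial>\<mu>) = (\<integral>z. p (fst z) * q (snd z) \<partial>\<mu>')"
  using q
proof (induction rule: real_polynomial_function_herm_induct[where b=b])
  case (herm n)
  show ?case by (simp add: integral_poly_herm_diagonal[OF \<mu> p] integral_poly_herm_diagonal[OF \<mu>' p])
next
  case (add f g)
  then show ?case
    using integrable_diagonal_poly[OF \<mu> p] integrable_diagonal_poly[OF \<mu>' p] by (simp add: distrib_left)
next
  case (scale f c)
  then show ?case by (simp add: mult.left_commute)
qed

text \<open>Gaussian marginals make the moment problem determinate: the characteristic function is the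
  sum of its Taylor series at every point.\<close>
lemma hermite_diagonal_unique:
  assumes \<mu>: "hermite_diagonal b \<rho> \<mu>" and \<mu>': "hermite_diagonal b \<rho> \<mu>'"
  shows "\<mu> = \<mu>'"
proof (rule char_functional_uniqueness)
  show "prob_space \<mu>" "prob_space \<mu>'" "sets \<mu> = sets borel" "sets \<mu>' = sets borel"
    using \<mu> \<mu>' by (auto simp: hermite_diagonal_def)
  fix t :: "(real ^ 'd) \<times> (real ^ 'd)"
  have mom: "(\<integral>z. (fst t \<bullet> fst z + snd t \<bullet> snd z) ^ k \<partial>\<mu>) = (\<integral>z. (fst t \<bullet> fst z + snd t \<bullet> snd z) ^ k \<partial>\<mu>')" for k
  proof -
    have poly: "real_polynomial_function (\<lambda>x. (s \<bullet> x) ^ j)" for s :: "real ^ 'd" and j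
      by (intro real_polynomial_function_power real_polynomial_function.intros(1) bounded_linear_inner_right)
    have "(\<integral>z. (fst t \<bullet> fst z + snd t \<bullet> snd z) ^ k \<partial>L) =
       (\<Sum>j\<le>k. real (k choose j) * (\<integral>z. (fst t \<bullet> fst z) ^ j * (snd t \<bullet> snd z) ^ (k - j) \<partial>L))"
      if "hermite_diagonal b \<rho> L" for L
      using integrable_diagonal_poly[OF that poly poly]
      by (simp add: binomial_ring mult.assoc Bochner_Integration.integral_sum)
    then show ?thesis using \<mu> \<mu>' by (simp add: hermite_diagonal_poly_unique[OF \<mu> \<mu>' poly poly])
  qed
  have "(CLINT z|\<mu>. iexp (fst t \<bullet> fst z + snd t \<bullet> snd z)) = (CLINT z|\<mu>'. iexp (fst t \<bullet> fst z + snd t \<bullet> snd z))"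
    using char_diagonal_series[OF \<mu>, of "fst t" "snd t"] char_diagonal_series[OF \<mu>', of "fst t" "snd t"]
    unfolding mom by (rule LIMSEQ_unique)
  then show "(CLINT z|\<mu>. iexp (t \<bullet> z)) = (CLINT z|\<mu>'. iexp (t \<bullet> z))"
    by (simp only: inner_prod_def)
qed

end

section \<open>The correlation sequence is a moment sequence\<close>

definition clamp1 :: "real \<Rightarrow> real" where
  "clamp1 x = max (- 1) (min 1 x)"

lemma clamp1_bounds: "\<bar>clamp1 x\<bar> \<le> 1"
  by (auto simp: clamp1_def)

lemma borel_measurable_clamp1[measurable]: "clamp1 \<in> borel_measurable borel"
  unfolding clamp1_def[abs_def] by measurable

lemma clamp1_factor: "x = clamp1 x * max 1 \<bar>x\<bar>"
proof -
  consider "x > 1" | "x < - 1" | "\<bar>x\<bar> \<le> 1" by linarith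
  then show ?thesis
  proof cases
    case 3
    then have "clamp1 x = x" by (auto simp: clamp1_def)
    then show ?thesis using 3 by (simp add: max_absorb1)
  qed (auto simp: clamp1_def)
qed

text \<open>Let t be the maximum of 1 and all \<open>\<bar>s $ j\<bar>\<close>. Splitting each
  factor by \<open>clamp1_factor\<close> bounds the error by \<open>t ^ N - 1\<close>, and
  Bernoulli's inequality bounds K times this by \<open>t ^ (2 * N * K)\<close>. Truncation thus
  costs high moments divided by K; the factor 2 makes the exponent even and all terms
  nonnegative.\<close>

lemma prod_clamp1_diff_bound:
  fixes s :: "real ^ 'd" and n :: "nat ^ 'd"
  assumes K: "K > 0" and N: "N = (\<Sum>j\<in>UNIV. n $ j)"
  shows "\<bar>(\<Prod>j\<in>UNIV. (s $ j) ^ (n $ j)) - (\<Prod>j\<in>UNIV. (clamp1 (s $ j)) ^ (n $ j))\<bar>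
    \<le> (\<Sum>j\<in>UNIV. (s $ j) ^ (2 * N * K)) / K"
proof -
  define t where "t = Max (range (\<lambda>j. max 1 \<bar>s $ j\<bar>))"
  have fin: "finite (range (\<lambda>j. max 1 \<bar>s $ j\<bar>))" by simp
  have t: "max 1 \<bar>s $ j\<bar> \<le> t" for j
    unfolding t_def by (rule Max_ge[OF fin]) simp
  have t1: "1 \<le> t" using t[of undefined] by simp
  have "t \<in> range (\<lambda>j. max 1 \<bar>s $ j\<bar>)"
    unfolding t_def by (rule Max_in) auto
  then obtain j0 where j0: "t = max 1 \<bar>s $ j0\<bar>" by auto
  have nonneg: "0 \<le> (\<Sum>j\<in>UNIV. (s $ j) ^ (2 * N * K)) / K"
    by (intro divide_nonneg_nonneg sum_nonneg) (simp_all add: mult.assoc)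
  define C where "C = (\<Prod>j\<in>UNIV. (clamp1 (s $ j)) ^ (n $ j))"
  define D where "D = (\<Prod>j\<in>UNIV. (max 1 \<bar>s $ j\<bar>) ^ (n $ j))"
  have "(\<Prod>j\<in>UNIV. (s $ j) ^ (n $ j)) = C * D"
    unfolding C_def D_def prod.distrib[symmetric] power_mult_distrib[symmetric]
    using clamp1_factor by (intro prod.cong) auto
  moreover have "\<bar>C\<bar> \<le> 1"
    unfolding C_def abs_prod by (intro prod_le_1) (auto simp: power_abs clamp1_bounds power_le_one)
  moreover have D1: "1 \<le> D" unfolding D_def by (intro prod_ge_1) (auto intro: one_le_power)
  ultimately have "\<bar>(\<Prod>j\<in>UNIV. (s $ j) ^ (n $ j)) - C\<bar> \<le> D - 1"
  proof -
    have "\<bar>C * (D - 1)\<bar> \<le> 1 * (D - 1)"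
      unfolding abs_mult using \<open>\<bar>C\<bar> \<le> 1\<close> D1 by (intro mult_mono) auto
    then show ?thesis using \<open>(\<Prod>j\<in>UNIV. (s $ j) ^ (n $ j)) = C * D\<close> by (simp add: algebra_simps)
  qed
  also have "D \<le> (\<Prod>j\<in>UNIV. t ^ (n $ j))"
    unfolding D_def using t by (intro prod_mono conjI power_mono) auto
  also have "\<dots> = t ^ N" by (simp add: N power_sum)
  finally have 1: "\<bar>(\<Prod>j\<in>UNIV. (s $ j) ^ (n $ j)) - C\<bar> \<le> t ^ N - 1" by simp
  show ?thesis
  \<comment> \<open>Here s lies in the cube and truncation changes nothing; otherwise t is attained
    at an entry of s, whose power is one term of the sum.\<close>
  proof (cases "t = 1")
    case True
    then show ?thesis using 1 nonneg by (simp add: C_def)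
  next
    case False
    then have ts: "t = \<bar>s $ j0\<bar>" using j0 by (auto simp: max_def split: if_splits)
    have "t ^ N \<le> t ^ (2 * N)" using t1 by (intro power_increasing) auto
    moreover have "1 + real K * (t ^ (2 * N) - 1) \<le> (1 + (t ^ (2 * N) - 1)) ^ K"
      using t1 by (intro Bernoulli_inequality) (auto intro: order_trans[of _ 0] simp: one_le_power)
    moreover have "real K * (x - 1) \<le> q ^ K" if "x \<le> q" "1 + real K * (q - 1) \<le> (1 + (q - 1)) ^ K" for x q :: real
      using mult_left_mono[of x q "real K"] that by (simp add: algebra_simps)
    ultimately have "real K * (t ^ N - 1) \<le> t ^ (2 * N * K)"
      unfolding power_mult[of t "2 * N" K] by blast
    also have "\<dots> = (s $ j0) ^ (2 * N * K)"
      unfolding ts by (simp add: power_even_abs mult.assoc)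
    also have "\<dots> \<le> (\<Sum>j\<in>UNIV. (s $ j) ^ (2 * N * K))"
      by (intro member_le_sum) (auto simp: mult.assoc)
    finally have "t ^ N - 1 \<le> (\<Sum>j\<in>UNIV. (s $ j) ^ (2 * N * K)) / K"
      using K by (simp add: field_simps)
    with 1 show ?thesis by (simp add: C_def)
  qed
qed

text \<open>Adding the variances t and -t gives variance 0, where the Hermite polynomial is a
  monomial: the inverse Hermite expansion.\<close>

lemma power_hermite_expansion:
  "x ^ n = (\<Sum>k\<le>n. real (n choose k) * hermite (n - k) (- t) 0 * hermite k t x)"
  using hermite_add[of n t "- t" x 0] by (simp add: hermite_var_0 mult_ac)

context
  fixes b :: "real ^ 'd" and \<rho> :: "nat ^ 'd \<Rightarrow> real" and \<mu> :: "((real ^ 'd) \<times> (real ^ 'd)) measure"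
  assumes b_pos: "\<And>i. b $ i > 0" and diag: "hermite_diagonal b \<rho> \<mu>"
begin

interpretation M: prob_space \<mu>
  using diag by (simp add: hermite_diagonal_def)

declare sets_diagonal[OF b_pos diag, measurable_cong]

lemma correlation_0: "\<rho> 0 = 1"
  using integral_herm_diagonal[OF b_pos diag, of 0 0] M.prob_space
  by (simp add: herm_0 herm_norm_def)

text \<open>The mean square of \<open>H_n(X) - H_n(Y)\<close> is nonnegative. Through this bound the
  even moments of the tilted laws are at most 1 in the limit.\<close>

lemma correlation_le_1: "\<rho> n \<le> 1"
proof -
  note p = real_polynomial_function_herm[of b n]
  have [measurable]: "herm b n \<in> borel_measurable borel" by measurable
  have i1: "integrable \<mu> (\<lambda>z. (herm b n (fst z))\<^sup>2)" "(\<integral>z. (herm b n (fst z))\<^sup>2 \<partial>\<mu>) = herm_norm b n"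
    using square_integrable_real_polynomial_function[OF b_pos p] herm_orthogonal[OF b_pos, of n n]
    unfolding fst_diagonal[OF b_pos diag, symmetric]
    by (auto simp: integrable_distr_eq integral_distr power2_eq_square)
  have i2: "integrable \<mu> (\<lambda>z. (herm b n (snd z))\<^sup>2)" "(\<integral>z. (herm b n (snd z))\<^sup>2 \<partial>\<mu>) = herm_norm b n"
    using square_integrable_real_polynomial_function[OF b_pos p] herm_orthogonal[OF b_pos, of n n]
    unfolding snd_diagonal[OF b_pos diag, symmetric]
    by (auto simp: integrable_distr_eq integral_distr power2_eq_square)
  have "\<rho> n * herm_norm b n = (\<integral>z. herm b n (fst z) * herm b n (snd z) \<partial>\<mu>)"
    by (simp add: integral_herm_diagonal[OF b_pos diag])
  also have "\<dots> \<le> (\<integral>z. ((herm b n (fst z))\<^sup>2 + (herm b n (snd z))\<^sup>2) / 2 \<partial>\<mu>)"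
  proof (rule integral_mono)
    show "integrable \<mu> (\<lambda>z. herm b n (fst z) * herm b n (snd z))"
      by (rule integrable_diagonal_poly[OF b_pos diag p p])
    show "integrable \<mu> (\<lambda>z. ((herm b n (fst z))\<^sup>2 + (herm b n (snd z))\<^sup>2) / 2)"
      using i1 i2 by simp
    show "x * y \<le> (x\<^sup>2 + y\<^sup>2) / 2" for x y :: real
      using zero_le_power2[of "x - y"] by (simp add: power2_diff)
  qed
  also have "\<dots> = herm_norm b n" using i1 i2 by simp
  finally show ?thesis using herm_norm_pos[OF b_pos, of n] by simp
qed

text \<open>The exponent is \<open>\<theta> = r / b\<close> in each coordinate, so
  \<open>b \<theta> = r\<close>, the new mean, is the same in all of them. The subtracted constant
  is the logarithm of the Gaussian moment generating function at \<theta>.\<close>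

definition tilt :: "real \<Rightarrow> real ^ 'd \<Rightarrow> real" where
  "tilt r x = exp ((\<chi> i. r / b $ i) \<bullet> x - (\<Sum>i\<in>UNIV. r\<^sup>2 / b $ i) / 2)"

lemma borel_measurable_tilt[measurable]: "tilt r \<in> borel_measurable borel"
  unfolding tilt_def[abs_def] by measurable

lemma tilt_nonneg: "0 \<le> tilt r x"
  by (simp add: tilt_def)

lemma integrable_tilt_poly:
  assumes "real_polynomial_function p"
  shows "integrable \<mu> (\<lambda>z. tilt r (fst z) * p (snd z))"
proof -
  define t :: "real ^ 'd" where "t = (\<chi> i. r / b $ i)"
  have "integrable \<mu> (\<lambda>z. exp (t \<bullet> fst z) * p (snd z))"
  proof (rule integrable_diagonal_mult[OF b_pos diag])
    show "integrable (normal_product b) (\<lambda>x. (exp (t \<bullet> x))\<^sup>2)"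
      using integrable_exp_normal_product[OF b_pos, of "2 *\<^sub>R t"] by (simp add: exp_double)
  qed (use assms in \<open>auto intro!: borel_measurable_real_polynomial_function square_integrable_real_polynomial_function b_pos\<close>)
  then show ?thesis by (simp add: tilt_def t_def exp_diff)
qed

lemma integral_tilt_herm:
  "(\<integral>z. tilt r (fst z) * herm b n (snd z) \<partial>\<mu>) = \<rho> n * r ^ (\<Sum>j\<in>UNIV. n $ j)"
proof -
  define t :: "real ^ 'd" where "t = (\<chi> i. r / b $ i)"
  define c where "c = exp ((\<Sum>i\<in>UNIV. r\<^sup>2 / b $ i) / 2)"
  have bi: "b $ i \<noteq> 0" for i using b_pos[of i] by simp
  have c: "exp ((\<Sum>i\<in>UNIV. b $ i * (t $ i)\<^sup>2) / 2) = c"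
    unfolding c_def t_def using bi by (simp add: power2_eq_square)
  have "(\<integral>z. tilt r (fst z) * herm b n (snd z) \<partial>\<mu>) = (\<integral>z. exp (t \<bullet> fst z) * herm b n (snd z) \<partial>\<mu>) / c"
    by (simp add: tilt_def t_def c_def exp_diff)
  also have "\<dots> = \<rho> n * (\<Prod>i\<in>UNIV. (b $ i * t $ i) ^ (n $ i))"
    unfolding integral_exp_herm_diagonal[OF b_pos diag] c by (simp add: c_def)
  also have "(\<Prod>i\<in>UNIV. (b $ i * t $ i) ^ (n $ i)) = r ^ (\<Sum>j\<in>UNIV. n $ j)"
    using bi by (simp add: t_def power_sum)
  finally show ?thesis .
qed

text \<open>The coefficients of the inverse Hermite expansion of a monomial, with variances
  \<open>b / r\<^sup>2\<close>. The lower index is a function rather than a vector, to fit the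
  expansion of a product of sums by \<open>prod_sum_PiE\<close>.\<close>

definition hermite_coeff :: "nat ^ 'd \<Rightarrow> real \<Rightarrow> ('d \<Rightarrow> nat) \<Rightarrow> real" where
  "hermite_coeff n r g = (\<Prod>j\<in>UNIV. real (n $ j choose g j) * hermite (n $ j - g j) (- (b $ j / r\<^sup>2)) 0)"

definition tilted_moment :: "nat ^ 'd \<Rightarrow> real \<Rightarrow> real" where
  "tilted_moment n r = (\<integral>z. tilt r (fst z) * (\<Prod>j\<in>UNIV. (snd z $ j / r) ^ (n $ j)) \<partial>\<mu>)"

lemma real_polynomial_function_scaled_monomial:
  "real_polynomial_function (\<lambda>y :: real ^ 'd. \<Prod>j\<in>UNIV. (y $ j / r) ^ (n $ j))"
  by (intro real_polynomial_function_prod real_polynomial_function_power real_polynomial_function_divide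
      real_polynomial_function_component) auto

text \<open>Under the tilted law the rescaled Hermite polynomial of \<open>Y / r\<close> with variance \<open>b / r\<^sup>2\<close> has
  mean \<open>\<rho> n\<close> exactly, and it tends to a monomial as the variance tends to \<open>0\<close>.\<close>
lemma tilted_moment_eq:
  assumes r: "r > 0"
  shows "tilted_moment n r = (\<Sum>g\<in>Pi\<^sub>E UNIV (\<lambda>j. {..n $ j}).
     hermite_coeff n r g * \<rho> (\<chi> j. g j))"
proof -
  have sc: "hermite k (b $ j / r\<^sup>2) (y $ j / r) = hermite k (b $ j) (y $ j) / r ^ k" for k j and y :: "real ^ 'd"
    using hermite_scale[of k "1 / r" "b $ j" "y $ j"] by (simp add: power_divide)
  have eq: "(\<Prod>j\<in>UNIV. (y $ j / r) ^ (n $ j)) = (\<Sum>g\<in>Pi\<^sub>E UNIV (\<lambda>j. {..n $ j}).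
     hermite_coeff n r g / r ^ (\<Sum>j\<in>UNIV. g j) * herm b (\<chi> j. g j) y)" for y
  proof -
    have "(\<Prod>j\<in>UNIV. (y $ j / r) ^ (n $ j)) = (\<Prod>j\<in>UNIV. \<Sum>k\<le>n $ j. real (n $ j choose k)
        * hermite (n $ j - k) (- (b $ j / r\<^sup>2)) 0 * hermite k (b $ j / r\<^sup>2) (y $ j / r))"
      by (intro prod.cong refl power_hermite_expansion)
    also have "\<dots> = (\<Sum>g\<in>Pi\<^sub>E UNIV (\<lambda>j. {..n $ j}). \<Prod>j\<in>UNIV. real (n $ j choose g j)
        * hermite (n $ j - g j) (- (b $ j / r\<^sup>2)) 0 * hermite (g j) (b $ j / r\<^sup>2) (y $ j / r))"
      by (rule prod_sum_PiE) auto
    also have "\<dots> = (\<Sum>g\<in>Pi\<^sub>E UNIV (\<lambda>j. {..n $ j}).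
     hermite_coeff n r g / r ^ (\<Sum>j\<in>UNIV. g j) * herm b (\<chi> j. g j) y)"
      unfolding sc herm_def hermite_coeff_def by (intro sum.cong refl) (simp add: prod.distrib prod_dividef power_sum)
    finally show ?thesis .
  qed
  have "tilted_moment n r = (\<integral>z. (\<Sum>g\<in>Pi\<^sub>E UNIV (\<lambda>j. {..n $ j}).
     hermite_coeff n r g / r ^ (\<Sum>j\<in>UNIV. g j) *
     (tilt r (fst z) * herm b (\<chi> j. g j) (snd z))) \<partial>\<mu>)"
    unfolding tilted_moment_def eq sum_distrib_left by (simp only: mult_ac)
  also have "\<dots> = (\<Sum>g\<in>Pi\<^sub>E UNIV (\<lambda>j. {..n $ j}).
     hermite_coeff n r g / r ^ (\<Sum>j\<in>UNIV. g j) *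
     (\<integral>z. tilt r (fst z) * herm b (\<chi> j. g j) (snd z) \<partial>\<mu>))"
    by (subst Bochner_Integration.integral_sum)
      (auto intro!: integrable_mult_right integrable_tilt_poly real_polynomial_function_herm)
  \<comment> \<open>The powers of r from the rescaling and from \<open>integral_tilt_herm\<close>
    cancel, so only \<open>hermite_coeff\<close> depends on r.\<close>
  also have "\<dots> = (\<Sum>g\<in>Pi\<^sub>E UNIV (\<lambda>j. {..n $ j}).
     hermite_coeff n r g * \<rho> (\<chi> j. g j))"
    unfolding integral_tilt_herm using r by (intro sum.cong refl) simp
  finally show ?thesis .
qed

text \<open>As the variances \<open>b / r\<^sup>2\<close> tend to 0, the coefficient of g tends to a
  product with factors \<open>hermite (n $ j - g j) 0 0\<close>, which vanishes unless g is n.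
  \<open>Suc k\<close> keeps r positive.\<close>

lemma tilted_moment_tendsto: "(\<lambda>k. tilted_moment n (real (Suc k))) \<longlonglongrightarrow> \<rho> n"
proof -
  have h: "(\<lambda>k. hermite m (- (b $ j / (real (Suc k))\<^sup>2)) 0) \<longlonglongrightarrow> hermite m 0 0" for m j
  proof (rule isCont_tendsto_compose[OF isCont_hermite_var])
    have "(\<lambda>k. inverse (real (Suc k))) \<longlonglongrightarrow> 0" by (rule LIMSEQ_inverse_real_of_nat)
    then have "(\<lambda>k. - (b $ j * (inverse (real (Suc k)))\<^sup>2)) \<longlonglongrightarrow> - (b $ j * 0\<^sup>2)"
      by (intro tendsto_intros)
    then show "(\<lambda>k. - (b $ j / (real (Suc k))\<^sup>2)) \<longlonglongrightarrow> 0"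
      by (simp add: field_simps power2_eq_square)
  qed
  have "(\<lambda>k. tilted_moment n (real (Suc k))) \<longlonglongrightarrow> (\<Sum>g\<in>Pi\<^sub>E UNIV (\<lambda>j. {..n $ j}).
     (\<Prod>j\<in>UNIV. real (n $ j choose g j) * hermite (n $ j - g j) 0 0) * \<rho> (\<chi> j. g j))"
    by (subst tilted_moment_eq) (auto simp: hermite_coeff_def intro!: tendsto_intros h simp del: of_nat_Suc)
  also have "(\<Sum>g\<in>Pi\<^sub>E UNIV (\<lambda>j. {..n $ j}).
     (\<Prod>j\<in>UNIV. real (n $ j choose g j) * hermite (n $ j - g j) 0 0) * \<rho> (\<chi> j. g j)) =
     (\<Sum>g\<in>Pi\<^sub>E UNIV (\<lambda>j. {..n $ j}). if g = (\<lambda>j. n $ j) then \<rho> n else 0)"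
  proof (intro sum.cong refl)
    fix g assume g: "g \<in> Pi\<^sub>E UNIV (\<lambda>j. {..n $ j})"
    show "(\<Prod>j\<in>UNIV. real (n $ j choose g j) * hermite (n $ j - g j) 0 0) * \<rho> (\<chi> j. g j) = (if g
        = (\<lambda>j. n $ j) then \<rho> n else 0)"
    proof (cases "g = (\<lambda>j. n $ j)")
      case True
      then show ?thesis by (simp add: hermite_0)
    next
      case False
      then obtain j where j: "g j \<noteq> n $ j" by auto
      have "g j \<le> n $ j" using g by (auto simp: PiE_iff)
      with j have "hermite (n $ j - g j) 0 0 = 0" by (simp add: hermite_0_0)
      then have "(\<Prod>j\<in>UNIV. real (n $ j choose g j) * hermite (n $ j - g j) 0 0) = 0"
        by (intro prod_zero bexI[of _ j]) auto
      with False show ?thesis by simp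
    qed
  qed
  also have "\<dots> = \<rho> n"
    by (subst sum.delta) (auto simp: PiE_iff intro!: finite_PiE)
  finally show ?thesis .
qed

text \<open>\<open>Y / r\<close> concentrates on the cube only in the limit; clamping makes the law
  a \<open>cube_law\<close> for every r.\<close>

definition tilted_law :: "real \<Rightarrow> (real ^ 'd) measure" where
  "tilted_law r = distr (density \<mu> (\<lambda>z. ennreal (tilt r (fst z)))) borel (\<lambda>z. \<chi> j. clamp1 (snd z $ j / r))"

lemma cube_law_tilted: "cube_law (tilted_law r)"
proof -
  have "(\<integral>\<^sup>+z. ennreal (tilt r (fst z)) \<partial>\<mu>) = ennreal (\<integral>z. tilt r (fst z) \<partial>\<mu>)"
    using integrable_tilt_poly[of "\<lambda>_. 1" r]
        by (intro nn_integral_eq_integral) (auto simp: tilt_def real_polynomial_function.intros(2))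
  also have "(\<integral>z. tilt r (fst z) \<partial>\<mu>) = 1"
    using integral_tilt_herm[of r 0] by (simp add: herm_0 correlation_0)
  finally have "emeasure (density \<mu> (\<lambda>z. ennreal (tilt r (fst z)))) (space \<mu>) = 1"
    by (subst emeasure_density) (auto cong: nn_integral_cong)
  then interpret P: prob_space "density \<mu> (\<lambda>z. ennreal (tilt r (fst z)))"
    by (intro prob_spaceI) simp
  have "prob_space (tilted_law r)"
    unfolding tilted_law_def by (rule P.prob_space_distr) measurable
  moreover have "AE s in tilted_law r. \<forall>j. s $ j \<in> {-1..1}"
    unfolding tilted_law_def using clamp1_bounds
    by (subst AE_distr_iff) (auto simp: abs_le_iff minus_le_iff)
  moreover have "sets (tilted_law r) = sets borel" by (simp add: tilted_law_def)
  ultimately show ?thesis by (simp add: cube_law_def)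
qed

lemma integral_tilted_law:
  "(\<integral>s. (\<Prod>j\<in>UNIV. (s $ j) ^ (n $ j)) \<partial>tilted_law r) =
   (\<integral>z. tilt r (fst z) * (\<Prod>j\<in>UNIV. (clamp1 (snd z $ j / r)) ^ (n $ j)) \<partial>\<mu>)"
  unfolding tilted_law_def by (subst integral_distr, simp, simp, subst integral_density) (auto simp: tilt_def)

text \<open>Clamping changes a moment by at most 1 / K times the sum of the tilted moments of order
  \<open>2 * N * K\<close> in the single coordinates. Their limits are correlations, hence at most 1
  each, so the error is asymptotically at most d / K, and K is arbitrary.\<close>

lemma tilted_law_moments_tendsto:
  "(\<lambda>k. \<integral>s. (\<Prod>j\<in>UNIV. (s $ j) ^ (n $ j)) \<partial>tilted_law (real (Suc k))) \<longlonglongrightarrow> \<rho> n"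
proof -
  define N where "N = (\<Sum>j\<in>UNIV. n $ j)"
  define T where "T r = (\<integral>s. (\<Prod>j\<in>UNIV. (s $ j) ^ (n $ j)) \<partial>tilted_law r)" for r
  have diff: "\<bar>tilted_moment n r - T r\<bar> \<le> (\<Sum>i\<in>UNIV. tilted_moment (\<chi> j. if j = i then 2 * N * K else 0) r) / K"
    if K: "K > 0" and r: "r > 0" for K :: nat and r
  proof -
    have mono: "(\<Prod>j\<in>UNIV. (y $ j / r) ^ ((\<chi> j. if j = i then 2 * N * K else 0) $ j)) = (y $ i / r) ^ (2 * N * K)" for y i
    proof -
      have "(\<Prod>j\<in>UNIV. (y $ j / r) ^ ((\<chi> j. if j = i then 2 * N * K else 0) $ j)) = (\<Prod>j\<in>UNIV. if j
          = i then (y $ i / r) ^ (2 * N * K) else 1)"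
        by (intro prod.cong) auto
      then show ?thesis by simp
    qed
    have i1: "integrable \<mu> (\<lambda>z. tilt r (fst z) * (\<Prod>j\<in>UNIV. (snd z $ j / r) ^ (n $ j)))" for n
      by (intro integrable_tilt_poly real_polynomial_function_scaled_monomial)
    have i0: "integrable \<mu> (\<lambda>z. tilt r (fst z))"
      using integrable_tilt_poly[of "\<lambda>_. 1" r] by (simp add: real_polynomial_function.intros(2))
    have i2: "integrable \<mu> (\<lambda>z. tilt r (fst z) * (\<Prod>j\<in>UNIV. (clamp1 (snd z $ j / r)) ^ (n $ j)))"
    proof (rule Bochner_Integration.integrable_bound[OF i0])
      have "\<bar>\<Prod>j\<in>UNIV. (clamp1 (snd z $ j / r)) ^ (n $ j)\<bar> \<le> 1" for z :: "(real ^ 'd) \<times> (real ^ 'd)"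
        unfolding abs_prod by (intro prod_le_1) (auto simp: power_abs clamp1_bounds power_le_one)
      then show "AE z in \<mu>. norm (tilt r (fst z) * (\<Prod>j\<in>UNIV. (clamp1 (snd z $ j / r)) ^ (n $ j))) \<le> norm (tilt r (fst z))"
        by (auto simp: abs_mult intro!: mult_left_le)
    qed measurable
    have i3: "integrable \<mu> (\<lambda>z. tilt r (fst z) * (snd z $ i / r) ^ (2 * N * K))" for i
      using i1[of "\<chi> j. if j = i then 2 * N * K else 0"] unfolding mono .
    have "tilted_moment n r - T r = (\<integral>z. tilt r (fst z)
        * ((\<Prod>j\<in>UNIV. (snd z $ j / r) ^ (n $ j)) - (\<Prod>j\<in>UNIV. (clamp1 (snd z $ j / r)) ^ (n $ j))) \<partial>\<mu>)"
      unfolding tilted_moment_def T_def integral_tilted_law right_diff_distrib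
      using i1 i2 by (subst Bochner_Integration.integral_diff) auto
    also have "\<bar>\<dots>\<bar> \<le> (\<integral>z. tilt r (fst z) * ((\<Sum>i\<in>UNIV. (snd z $ i / r) ^ (2 * N * K)) / K) \<partial>\<mu>)"
    proof (rule integral_abs_bound_integral)
      show "integrable \<mu> (\<lambda>z. tilt r (fst z)
          * ((\<Prod>j\<in>UNIV. (snd z $ j / r) ^ (n $ j)) - (\<Prod>j\<in>UNIV. (clamp1 (snd z $ j / r)) ^ (n $ j))))"
        unfolding right_diff_distrib using i1 i2 by (intro Bochner_Integration.integrable_diff)
      show "integrable \<mu> (\<lambda>z. tilt r (fst z) * ((\<Sum>i\<in>UNIV. (snd z $ i / r) ^ (2 * N * K)) / K))"
        unfolding sum_divide_distrib sum_distrib_left times_divide_eq_right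
        by (intro Bochner_Integration.integrable_sum integrable_divide i3)
      fix z :: "(real ^ 'd) \<times> (real ^ 'd)"
      show "\<bar>tilt r (fst z)
          * ((\<Prod>j\<in>UNIV. (snd z $ j / r) ^ (n $ j)) - (\<Prod>j\<in>UNIV. (clamp1 (snd z $ j / r)) ^ (n $ j)))\<bar>
              \<le> tilt r (fst z) * ((\<Sum>i\<in>UNIV. (snd z $ i / r) ^ (2 * N * K)) / K)"
        using mult_left_mono[OF prod_clamp1_diff_bound[OF K N_def, of "\<chi> j. snd z $ j / r"] tilt_nonneg[of r "fst z"]]
        by (simp add: abs_mult tilt_nonneg)
    qed
    also have "\<dots> = (\<Sum>i\<in>UNIV. tilted_moment (\<chi> j. if j = i then 2 * N * K else 0) r) / K"
      unfolding sum_divide_distrib sum_distrib_left times_divide_eq_right tilted_moment_def mono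
      using i3 by (subst Bochner_Integration.integral_sum) auto
    finally show ?thesis .
  qed
  have "(\<lambda>k. tilted_moment n (real (Suc k)) - T (real (Suc k))) \<longlonglongrightarrow> 0"
  proof (rule LIMSEQ_I)
    fix \<epsilon> :: real assume \<epsilon>: "\<epsilon> > 0"
    \<comment> \<open>The limits sum to at most \<open>CARD('d)\<close>; the added 1 leaves room for
      a strict inequality along the sequence.\<close>
    obtain K :: nat where K: "K > 0" "(real CARD('d) + 1) / K < \<epsilon>"
    proof -
      obtain K :: nat where "(real CARD('d) + 1) / \<epsilon> < K" using reals_Archimedean2 by blast
      moreover have "0 < (real CARD('d) + 1) / \<epsilon>" using \<epsilon> by (simp add: add_nonneg_pos)
      ultimately have "0 < real K" by linarith
      then have "K > 0" by simp
      moreover have "(real CARD('d) + 1) / K < \<epsilon>"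
        using \<open>(real CARD('d) + 1) / \<epsilon> < K\<close> \<epsilon> \<open>0 < real K\<close> by (simp add: pos_divide_less_eq mult.commute)
      ultimately show thesis by (rule that)
    qed
    let ?e = "\<lambda>i. \<chi> j. if j = i then 2 * N * K else 0"
    have "(\<lambda>k. \<Sum>i\<in>UNIV. tilted_moment (?e i) (real (Suc k))) \<longlonglongrightarrow> (\<Sum>i\<in>UNIV. \<rho> (?e i))"
      by (intro tendsto_sum tilted_moment_tendsto)
    moreover have "(\<Sum>i\<in>UNIV. \<rho> (?e i)) < real CARD('d) + 1"
      using sum_mono[of UNIV "\<lambda>i. \<rho> (?e i)" "\<lambda>_. 1"] correlation_le_1 by simp
    ultimately have "\<forall>\<^sub>F k in sequentially. (\<Sum>i\<in>UNIV. tilted_moment (?e i) (real (Suc k))) < real CARD('d) + 1"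
      by (rule order_tendstoD)
    then obtain k0 where k0: "\<And>k. k \<ge> k0 \<Longrightarrow> (\<Sum>i\<in>UNIV. tilted_moment (?e i) (real (Suc k))) < real CARD('d) + 1"
      unfolding eventually_sequentially by blast
    have "norm (tilted_moment n (real (Suc k)) - T (real (Suc k)) - 0) < \<epsilon>" if "k \<ge> k0" for k
    proof -
      have "\<bar>tilted_moment n (real (Suc k)) - T (real (Suc k))\<bar> \<le> (\<Sum>i\<in>UNIV. tilted_moment (?e i) (real (Suc k))) / K"
        by (rule diff[OF K(1)]) simp
      also have "\<dots> \<le> (real CARD('d) + 1) / K"
        using k0[OF that] K(1) by (intro divide_right_mono) auto
      also note K(2)
      finally show ?thesis by simp
    qed
    then show "\<exists>k0. \<forall>k\<ge>k0. norm (tilted_moment n (real (Suc k)) - T (real (Suc k)) - 0) < \<epsilon>" by blast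
  qed
  then have "(\<lambda>k. tilted_moment n (real (Suc k)) - (tilted_moment n (real (Suc k)) - T (real (Suc k)))) \<longlonglongrightarrow> \<rho> n - 0"
    by (intro tendsto_diff tilted_moment_tendsto)
  then show ?thesis by (simp add: T_def)
qed

theorem hermite_diagonal_moment_sequence: "\<exists>\<nu>. cube_law \<nu> \<and> is_moment_sequence \<rho> \<nu>"
  by (rule moment_sequence_limit[OF cube_law_tilted tilted_law_moments_tendsto])

end

section \<open>Gaussian mixtures\<close>

text \<open>\<open>sqrt\<close> of a negative number is again a real number, so the map is defined
  and measurable for every s. The resulting laws form a kernel on the whole space, with normal
  marginals for s in the cube.\<close>

definition mehler_map :: "real ^ 'd \<Rightarrow> (real ^ 'd) \<times> (real ^ 'd) \<Rightarrow> (real ^ 'd) \<times> (real ^ 'd)" where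
  "mehler_map s wz = (fst wz, \<chi> j. s $ j * fst wz $ j + sqrt (1 - (s $ j)\<^sup>2) * snd wz $ j)"

lemma fst_mehler_map[simp]: "fst (mehler_map s wz) = fst wz"
  by (simp add: mehler_map_def)

lemma measurable_mehler_map_joint[measurable]:
  "(\<lambda>x. mehler_map (fst x) (snd x)) \<in> borel \<Otimes>\<^sub>M (borel \<Otimes>\<^sub>M borel) \<rightarrow>\<^sub>M borel"
  unfolding mehler_map_def by measurable

lemma measurable_mehler_map[measurable]: "mehler_map s \<in> borel \<Otimes>\<^sub>M borel \<rightarrow>\<^sub>M borel"
  unfolding mehler_map_def[abs_def] by measurable

abbreviation normal_square :: "real ^ 'd \<Rightarrow> ((real ^ 'd) \<times> (real ^ 'd)) measure" where
  "normal_square b \<equiv> normal_product b \<Otimes>\<^sub>M normal_product b"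

definition mehler_law :: "real ^ 'd \<Rightarrow> real ^ 'd \<Rightarrow> ((real ^ 'd) \<times> (real ^ 'd)) measure" where
  "mehler_law b s = distr (normal_square b) borel (mehler_map s)"

text \<open>The mixture is the image of a single product measure, so that Fubini's theorem serves in
  place of integration against a kernel.\<close>

definition mehler_mixture :: "real ^ 'd \<Rightarrow> (real ^ 'd) measure \<Rightarrow> ((real ^ 'd) \<times> (real ^ 'd)) measure" where
  "mehler_mixture b \<nu> = distr (\<nu> \<Otimes>\<^sub>M normal_square b) borel (\<lambda>x. mehler_map (fst x) (snd x))"

lemma measurable_mehler_map_normal[measurable]:
  "mehler_map s \<in> normal_square b \<rightarrow>\<^sub>M borel"
  using measurable_mehler_map
  by (subst measurable_cong_sets[OF sets_pair_measure_cong[OF sets_normal_product sets_normal_product] refl])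

lemma measurable_mehler_map_joint_normal:
  "sets \<nu> = sets borel \<Longrightarrow>
    (\<lambda>x. mehler_map (fst x) (snd x)) \<in> \<nu> \<Otimes>\<^sub>M normal_square b \<rightarrow>\<^sub>M borel"
  using measurable_mehler_map_joint
  by (subst measurable_cong_sets[OF sets_pair_measure_cong[OF _ sets_pair_measure_cong[OF sets_normal_product sets_normal_product]] refl])

lemma sets_mehler_law[simp]: "sets (mehler_law b s) = sets borel"
  by (simp add: mehler_law_def)

lemma sets_mehler_mixture[simp]: "sets (mehler_mixture b \<nu>) = sets borel"
  by (simp add: mehler_mixture_def)

lemma sets_mehler_law_pair: "sets (mehler_law b s) = sets (borel \<Otimes>\<^sub>M borel)"
  by (simp only: sets_mehler_law borel_prod)

lemma sets_mehler_mixture_pair: "sets (mehler_mixture b s) = sets (borel \<Otimes>\<^sub>M borel)"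
  by (simp only: sets_mehler_mixture borel_prod)

lemma borel_measurable_fst_pair: "fst \<in> (borel :: ('a::second_countable_topology \<times> 'b::second_countable_topology) measure) \<rightarrow>\<^sub>M borel"
  and borel_measurable_snd_pair: "snd \<in> (borel :: ('a::second_countable_topology \<times> 'b::second_countable_topology) measure) \<rightarrow>\<^sub>M borel"
  unfolding borel_prod[symmetric] by measurable

lemma borel_measurable_coupling_mult:
  fixes f :: "'a::second_countable_topology \<Rightarrow> real" and g :: "'b::second_countable_topology \<Rightarrow> real"
  assumes "f \<in> borel_measurable borel" "g \<in> borel_measurable borel"
  shows "(\<lambda>z. f (fst z) * g (snd z)) \<in> borel_measurable borel"
  by (intro borel_measurable_times measurable_compose[OF borel_measurable_fst_pair assms(1)]
      measurable_compose[OF borel_measurable_snd_pair assms(2)])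

lemma sets_cube_law: "cube_law \<nu> \<Longrightarrow> sets \<nu> = sets borel"
  by (simp add: cube_law_def)

lemma AE_cube_law: "cube_law \<nu> \<Longrightarrow> AE s in \<nu>. \<forall>j. \<bar>s $ j\<bar> \<le> 1"
  by (auto simp: cube_law_def abs_le_iff minus_le_iff elim!: eventually_mono)

context
  fixes b :: "real ^ 'd"
  assumes b_pos: "\<And>i. b $ i > 0"
begin

interpretation N: prob_space "normal_product b"
  by (rule prob_space_normal_product[OF b_pos])

interpretation NN: pair_prob_space "normal_product b" "normal_product b" ..

lemma prob_space_normal_pair_measure: "prob_space (normal_square b)"
  by (rule NN.prob_space_axioms)

lemma prob_space_mehler_law: "prob_space (mehler_law b s)"
  unfolding mehler_law_def by (rule NN.prob_space_distr) measurable

lemma integral_mehler_law: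
  fixes f :: "_ \<Rightarrow> 'c::{banach, second_countable_topology}"
  assumes [measurable]: "f \<in> borel_measurable borel" and i: "integrable (mehler_law b s) f"
  shows "integral\<^sup>L (mehler_law b s) f = (\<integral>w. (\<integral>z. f (mehler_map s (w, z)) \<partial>normal_product b) \<partial>normal_product b)"
proof -
  have "integrable (normal_square b) (\<lambda>x. f (mehler_map s x))"
    using i unfolding mehler_law_def by (subst (asm) integrable_distr_eq) auto
  then have "(\<integral>w. (\<integral>z. f (mehler_map s (w, z)) \<partial>normal_product b) \<partial>normal_product b) =
    (\<integral>x. f (mehler_map s x) \<partial>normal_square b)"
    by (rule NN.integral_fst')
  then show ?thesis unfolding mehler_law_def by (subst integral_distr) auto
qed

text \<open>The coordinates are independent pairs with variances \<open>b $ j\<close> and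
  correlation \<open>s $ j\<close>. The quadratic form collapses because the square of the factor
  \<open>sqrt (1 - s\<^sup>2)\<close> adds to \<open>s\<^sup>2\<close> to give 1, as \<bar>s\<bar>
  \<le> 1.\<close>

lemma char_mehler_law:
  assumes s: "\<And>j. \<bar>s $ j\<bar> \<le> 1"
  shows "(CLINT z|mehler_law b s. iexp (t \<bullet> z)) =
    exp (- ((\<Sum>j\<in>UNIV. b $ j * ((fst t $ j)\<^sup>2 + (snd t $ j)\<^sup>2 + 2 * s $ j * fst t $ j * snd t $ j)) / 2))"
proof -
  interpret K: prob_space "mehler_law b s" by (rule prob_space_mehler_law)
  define \<alpha> :: "real ^ 'd" where "\<alpha> = (\<chi> j. fst t $ j + s $ j * snd t $ j)"
  define \<beta> :: "real ^ 'd" where "\<beta> = (\<chi> j. sqrt (1 - (s $ j)\<^sup>2) * snd t $ j)"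
  have "t \<bullet> mehler_map s (w, z) = \<alpha> \<bullet> w + \<beta> \<bullet> z" for w z
    by (simp add: inner_prod_def mehler_map_def inner_vec_def \<alpha>_def \<beta>_def sum.distrib[symmetric] algebra_simps)
  then have e: "iexp (t \<bullet> mehler_map s (w, z)) = iexp (\<alpha> \<bullet> w) * iexp (\<beta> \<bullet> z)" for w z
    by (simp add: exp_add[symmetric] distrib_left)
  have "(CLINT z|mehler_law b s. iexp (t \<bullet> z))
      = (CLINT w|normal_product b. (CLINT z|normal_product b. iexp (t \<bullet> mehler_map s (w, z))))"
  proof (rule integral_mehler_law)
    show "integrable (mehler_law b s) (\<lambda>z. iexp (t \<bullet> z))"
      by (rule K.integrable_const_bound[where B=1]) (auto simp: mehler_law_def)
  qed measurable
  also have "\<dots> = complex_of_real (exp (- ((\<Sum>j\<in>UNIV. b $ j * (\<alpha> $ j)\<^sup>2) / 2)))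
      * complex_of_real (exp (- ((\<Sum>j\<in>UNIV. b $ j * (\<beta> $ j)\<^sup>2) / 2)))"
    unfolding e by (simp only: integral_mult_right_zero integral_mult_left_zero char_normal_product[OF b_pos])
  also have "\<dots> = complex_of_real (exp (- ((\<Sum>j\<in>UNIV. b $ j * (\<alpha> $ j)\<^sup>2) / 2) + - ((\<Sum>j\<in>UNIV. b $ j * (\<beta> $ j)\<^sup>2) / 2)))"
    by (simp only: exp_add of_real_mult)
  also have "- ((\<Sum>j\<in>UNIV. b $ j * (\<alpha> $ j)\<^sup>2) / 2) + - ((\<Sum>j\<in>UNIV. b $ j * (\<beta> $ j)\<^sup>2) / 2) =
     - ((\<Sum>j\<in>UNIV. b $ j * (\<alpha> $ j)\<^sup>2 + b $ j * (\<beta> $ j)\<^sup>2) / 2)"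
    by (simp add: sum.distrib add_divide_distrib)
  also have "(\<Sum>j\<in>UNIV. b $ j * (\<alpha> $ j)\<^sup>2 + b $ j * (\<beta> $ j)\<^sup>2) =
     (\<Sum>j\<in>UNIV. b $ j * ((fst t $ j)\<^sup>2 + (snd t $ j)\<^sup>2 + 2 * s $ j * fst t $ j * snd t $ j))"
  proof (intro sum.cong refl)
    fix j
    have bq: "(\<beta> $ j)\<^sup>2 = (1 - (s $ j)\<^sup>2) * (snd t $ j)\<^sup>2"
      using s[of j] by (simp add: \<beta>_def power_mult_distrib abs_square_le_1)
    show "b $ j * (\<alpha> $ j)\<^sup>2 + b $ j * (\<beta> $ j)\<^sup>2 = b $ j * ((fst t $ j)\<^sup>2 + (snd t $ j)\<^sup>2 + 2 * s $ j
        * fst t $ j * snd t $ j)"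
      unfolding bq by (simp add: \<alpha>_def power2_eq_square algebra_simps)
  qed
  finally show ?thesis .
qed

lemma
  assumes s: "\<And>j. \<bar>s $ j\<bar> \<le> 1"
  shows fst_mehler_law: "distr (mehler_law b s) borel fst = normal_product b"
    and snd_mehler_law: "distr (mehler_law b s) borel snd = normal_product b"
proof -
  interpret K: prob_space "mehler_law b s" by (rule prob_space_mehler_law)
  have [measurable]: "fst \<in> mehler_law b s \<rightarrow>\<^sub>M borel" "snd \<in> mehler_law b s \<rightarrow>\<^sub>M borel"
    by (simp_all add: measurable_cong_sets[OF sets_mehler_law refl] borel_measurable_fst_pair borel_measurable_snd_pair)
  show "distr (mehler_law b s) borel fst = normal_product b"
  proof (rule char_functional_uniqueness)
    fix t :: "real ^ 'd"
    have "(CLINT x|distr (mehler_law b s) borel fst. iexp (t \<bullet> x)) = (CLINT z|mehler_law b s. iexp ((t, 0) \<bullet> z))"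
      by (subst integral_distr) (auto simp: inner_prod_def)
    then show "(CLINT x|distr (mehler_law b s) borel fst. iexp (t \<bullet> x)) = (CLINT x|normal_product b. iexp (t \<bullet> x))"
      by (simp only: char_mehler_law[OF s] char_normal_product[OF b_pos]) simp
  qed (auto intro!: K.prob_space_distr N.prob_space_axioms)
  show "distr (mehler_law b s) borel snd = normal_product b"
  proof (rule char_functional_uniqueness)
    fix t :: "real ^ 'd"
    have "(CLINT x|distr (mehler_law b s) borel snd. iexp (t \<bullet> x)) = (CLINT z|mehler_law b s. iexp ((0, t) \<bullet> z))"
      by (subst integral_distr) (auto simp: inner_prod_def)
    then show "(CLINT x|distr (mehler_law b s) borel snd. iexp (t \<bullet> x)) = (CLINT x|normal_product b. iexp (t \<bullet> x))"
      by (simp only: char_mehler_law[OF s] char_normal_product[OF b_pos]) simp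
  qed (auto intro!: K.prob_space_distr N.prob_space_axioms)
qed

text \<open>Integrating out the noise for fixed w applies Mehler's formula in each coordinate;
  orthogonality in w does the rest.\<close>

lemma integral_mehler_law_herm:
  assumes s: "\<And>j. \<bar>s $ j\<bar> \<le> 1"
  shows "(\<integral>z. herm b m (fst z) * herm b n (snd z) \<partial>mehler_law b s) =
    (if m = n then (\<Prod>j\<in>UNIV. (s $ j) ^ (n $ j)) * herm_norm b n else 0)"
proof -
  have inner: "(\<integral>z. herm b n (snd (mehler_map s (w, z))) \<partial>normal_product b) = (\<Prod>j\<in>UNIV. (s $ j) ^ (n $ j))
      * herm b n w" for w
  proof -
    have "(\<integral>z. herm b n (snd (mehler_map s (w, z))) \<partial>normal_product b) =
       (\<integral>z. (\<Prod>j\<in>UNIV. hermite (n $ j) (b $ j) (s $ j * w $ j + sqrt (1 - (s $ j)\<^sup>2) * z $ j)) \<partial>normal_product b)"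
      by (simp add: herm_def mehler_map_def)
    also have "\<dots> = (\<Prod>j\<in>UNIV. \<integral>z. hermite (n $ j) (b $ j) (s $ j * w $ j + sqrt (1 - (s $ j)\<^sup>2) * z) \<partial>normal_measure (b $ j))"
      by (rule integral_normal_product_prod[OF b_pos, where f="\<lambda>j z. hermite (n $ j) (b $ j) (s $ j * w $ j
          + sqrt (1 - (s $ j)\<^sup>2) * z)"])
        (auto intro!: integrable_hermite_mehler b_pos)
    also have "\<dots> = (\<Prod>j\<in>UNIV. (s $ j) ^ (n $ j) * hermite (n $ j) (b $ j) (w $ j))"
      by (simp only: hermite_mehler[OF b_pos s])
    finally show ?thesis by (simp add: prod.distrib herm_def)
  qed
  have "(\<integral>z. herm b m (fst z) * herm b n (snd z) \<partial>mehler_law b s) =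
    (\<integral>w. (\<integral>z. herm b m (fst (mehler_map s (w, z)))
        * herm b n (snd (mehler_map s (w, z))) \<partial>normal_product b) \<partial>normal_product b)"
  proof (rule integral_mehler_law)
    show "integrable (mehler_law b s) (\<lambda>z. herm b m (fst z) * herm b n (snd z))"
      by (rule integrable_coupling_mult[OF sets_mehler_law_pair fst_mehler_law[OF s] snd_mehler_law[OF s]])
        (auto intro!: square_integrable_real_polynomial_function real_polynomial_function_herm b_pos)
  qed (intro borel_measurable_coupling_mult borel_measurable_herm)
  also have "\<dots> = (\<integral>w. (\<Prod>j\<in>UNIV. (s $ j) ^ (n $ j)) * (herm b m w * herm b n w) \<partial>normal_product b)"
    by (simp add: inner mult_ac)
  also have "\<dots> = (\<Prod>j\<in>UNIV. (s $ j) ^ (n $ j)) * (if m = n then herm_norm b n else 0)"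
    by (simp add: herm_orthogonal[OF b_pos])
  finally show ?thesis by simp
qed

lemma measurable_mehler_law: "mehler_law b \<in> borel \<rightarrow>\<^sub>M prob_algebra borel"
proof (rule measurable_prob_algebraI)
  show "prob_space (mehler_law b s)" for s by (rule prob_space_mehler_law)
  show "mehler_law b \<in> borel \<rightarrow>\<^sub>M subprob_algebra borel"
    unfolding mehler_law_def[abs_def]
  proof (rule measurable_distr2)
    show "(\<lambda>(x, y). mehler_map x y) \<in> borel \<Otimes>\<^sub>M normal_square b \<rightarrow>\<^sub>M borel"
      unfolding split_beta' by (rule measurable_mehler_map_joint_normal[OF refl])
    show "(\<lambda>x. normal_square b) \<in> borel \<rightarrow>\<^sub>M subprob_algebra (normal_square b)"
      by (intro measurable_const) (simp add: space_subprob_algebra prob_space_imp_subprob_space NN.prob_space_axioms)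
  qed
qed

context
  fixes \<nu> :: "(real ^ 'd) measure"
  assumes cube: "cube_law \<nu>"
begin

interpretation nu: prob_space \<nu>
  using cube by (simp add: cube_law_def)

declare sets_cube_law[OF cube, measurable_cong]

lemmas measurable_mehler_map_joint_cube[measurable] = measurable_mehler_map_joint_normal[OF sets_cube_law[OF cube], of b]

interpretation P: pair_prob_space \<nu> "normal_square b" ..

lemma prob_space_mehler_mixture: "prob_space (mehler_mixture b \<nu>)"
  unfolding mehler_mixture_def by (rule P.prob_space_distr) measurable

text \<open>Sets A for the mixing variable make this the disintegration that
  \<open>conditional_law\<close> asks for; \<open>A = UNIV\<close> gives the mixture itself.\<close>

lemma emeasure_mehler_joint:
  assumes [measurable]: "A \<in> sets borel" "B \<in> sets borel"
  shows "emeasure (\<nu> \<Otimes>\<^sub>M normal_square b)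
     {x \<in> space (\<nu> \<Otimes>\<^sub>M normal_square b). fst x \<in> A \<and> mehler_map (fst x) (snd x) \<in> B} =
     (\<integral>\<^sup>+s. emeasure (mehler_law b s) B * indicator A s \<partial>\<nu>)"
proof -
  let ?S = "{x \<in> space (\<nu> \<Otimes>\<^sub>M normal_square b). fst x \<in> A \<and> mehler_map (fst x) (snd x) \<in> B}"
  have "emeasure (\<nu> \<Otimes>\<^sub>M normal_square b) ?S =
      (\<integral>\<^sup>+s. emeasure (normal_square b) (Pair s -` ?S) \<partial>\<nu>)"
  proof (rule NN.emeasure_pair_measure_alt)
    have "fst \<in> \<nu> \<Otimes>\<^sub>M normal_square b \<rightarrow>\<^sub>M borel"
      using measurable_fst[of \<nu>] by (simp add: measurable_cong_sets[OF refl sets_cube_law[OF cube]])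
    from measurable_sets[OF this assms(1)] measurable_sets[OF measurable_mehler_map_joint_cube assms(2)]
    have *: "(fst -` A \<inter> space (\<nu> \<Otimes>\<^sub>M normal_square b)) \<inter>
        ((\<lambda>x. mehler_map (fst x) (snd x)) -` B \<inter> space (\<nu> \<Otimes>\<^sub>M normal_square b))
        \<in> sets (\<nu> \<Otimes>\<^sub>M normal_square b)" by (rule sets.Int)
    show "?S \<in> sets (\<nu> \<Otimes>\<^sub>M normal_square b)"
      by (rule back_subst[of "\<lambda>S. S \<in> sets (\<nu> \<Otimes>\<^sub>M normal_square b)", OF *]) auto
  qed
  also have "\<dots> = (\<integral>\<^sup>+s. emeasure (mehler_law b s) B * indicator A s \<partial>\<nu>)"
  proof (intro nn_integral_cong)
    fix s assume s: "s \<in> space \<nu>"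
    show "emeasure (normal_square b) (Pair s -` ?S) = emeasure (mehler_law b s) B * indicator A s"
    proof (cases "s \<in> A")
      case True
      then have "Pair s -` ?S = mehler_map s -` B \<inter> space (normal_square b)"
        using s by (auto simp: space_pair_measure)
      then show ?thesis using True by (simp add: mehler_law_def emeasure_distr)
    next
      case False
      then have "Pair s -` ?S = {}" by auto
      then show ?thesis using False by simp
    qed
  qed
  finally show ?thesis .
qed

lemma emeasure_mehler_mixture:
  assumes [measurable]: "B \<in> sets borel"
  shows "emeasure (mehler_mixture b \<nu>) B = (\<integral>\<^sup>+s. emeasure (mehler_law b s) B \<partial>\<nu>)"
proof -
  have "emeasure (mehler_mixture b \<nu>) B = emeasure (\<nu> \<Otimes>\<^sub>M normal_square b)
     {x \<in> space (\<nu> \<Otimes>\<^sub>M normal_square b). fst x \<in> UNIV \<and> mehler_map (fst x) (snd x) \<in> B}"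
    unfolding mehler_mixture_def by (subst emeasure_distr) (auto intro!: arg_cong[of _ _ "emeasure _"])
  then show ?thesis using emeasure_mehler_joint[of UNIV B] by simp
qed

lemma distr_mehler_mixture:
  assumes [measurable]: "f \<in> borel \<rightarrow>\<^sub>M borel"
    and f: "\<And>s. (\<And>j. \<bar>s $ j\<bar> \<le> 1) \<Longrightarrow> distr (mehler_law b s) borel f = normal_product b"
  shows "distr (mehler_mixture b \<nu>) borel f = normal_product b"
proof (rule measure_eqI)
  fix B assume "B \<in> sets (distr (mehler_mixture b \<nu>) borel f)"
  then have [measurable]: "B \<in> sets borel" by simp
  have sp: "space (mehler_law b s) = UNIV" "space (mehler_mixture b \<nu>) = UNIV" for s
    by (simp_all add: mehler_law_def mehler_mixture_def)
  have fB: "f -` B \<in> sets borel" using measurable_sets[of f borel borel B] by simp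
  have "emeasure (distr (mehler_mixture b \<nu>) borel f) B = (\<integral>\<^sup>+s. emeasure (mehler_law b s) (f -` B) \<partial>\<nu>)"
    using emeasure_mehler_mixture[OF fB]
        by (subst emeasure_distr) (auto simp: sp measurable_cong_sets[OF sets_mehler_mixture refl])
  also have "\<dots> = (\<integral>\<^sup>+s. emeasure (normal_product b) B \<partial>\<nu>)"
  proof (rule nn_integral_cong_AE)
    show "AE s in \<nu>. emeasure (mehler_law b s) (f -` B) = emeasure (normal_product b) B"
      using AE_cube_law[OF cube]
    proof eventually_elim
      case (elim s)
      then have "emeasure (normal_product b) B = emeasure (distr (mehler_law b s) borel f) B" using f by simp
      then show ?case by (subst (asm) emeasure_distr) (auto simp: sp measurable_cong_sets[OF sets_mehler_law refl])
    qed
  qed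
  also have "\<dots> = emeasure (normal_product b) B" by (simp add: nu.emeasure_space_1)
  finally show "emeasure (distr (mehler_mixture b \<nu>) borel f) B = emeasure (normal_product b) B" .
qed simp

lemma fst_mehler_mixture: "distr (mehler_mixture b \<nu>) borel fst = normal_product b"
  by (rule distr_mehler_mixture) (auto intro: fst_mehler_law borel_measurable_fst_pair)

lemma snd_mehler_mixture: "distr (mehler_mixture b \<nu>) borel snd = normal_product b"
  by (rule distr_mehler_mixture) (auto intro: snd_mehler_law borel_measurable_snd_pair)

lemma integral_mehler_mixture:
  fixes f :: "_ \<Rightarrow> real"
  assumes [measurable]: "f \<in> borel_measurable borel" and i: "integrable (mehler_mixture b \<nu>) f"
  shows "integral\<^sup>L (mehler_mixture b \<nu>) f = (\<integral>s. integral\<^sup>L (mehler_law b s) f \<partial>\<nu>)"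
proof -
  have "integrable (\<nu> \<Otimes>\<^sub>M normal_square b) (\<lambda>x. f (mehler_map (fst x) (snd x)))"
    using i unfolding mehler_mixture_def by (subst (asm) integrable_distr_eq) auto
  then have "(\<integral>s. (\<integral>y. f (mehler_map (fst (s, y)) (snd (s, y))) \<partial>normal_square b) \<partial>\<nu>) =
    (\<integral>x. f (mehler_map (fst x) (snd x)) \<partial>(\<nu> \<Otimes>\<^sub>M normal_square b))"
    by (rule P.integral_fst')
  moreover have "integral\<^sup>L (mehler_law b s) f = (\<integral>y. f (mehler_map s y) \<partial>normal_square b)" for s
    unfolding mehler_law_def by (subst integral_distr) auto
  moreover have "integral\<^sup>L (mehler_mixture b \<nu>) f = (\<integral>x. f (mehler_map (fst x) (snd x)) \<partial>(\<nu> \<Otimes>\<^sub>M normal_square b))"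
    unfolding mehler_mixture_def by (subst integral_distr) auto
  ultimately show ?thesis by simp
qed

lemma hermite_diagonal_mehler_mixture:
  assumes \<rho>: "is_moment_sequence \<rho> \<nu>"
  shows "hermite_diagonal b \<rho> (mehler_mixture b \<nu>)"
proof -
  have "(\<integral>z. herm b m (fst z) * herm b n (snd z) \<partial>mehler_mixture b \<nu>) = (if m = n then \<rho> n * herm_norm b n else 0)" for m n
  proof -
    have "(\<integral>z. herm b m (fst z) * herm b n (snd z) \<partial>mehler_mixture b \<nu>) =
      (\<integral>s. (\<integral>z. herm b m (fst z) * herm b n (snd z) \<partial>mehler_law b s) \<partial>\<nu>)"
    proof (rule integral_mehler_mixture)
      show "integrable (mehler_mixture b \<nu>) (\<lambda>z. herm b m (fst z) * herm b n (snd z))"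
        by (rule integrable_coupling_mult[OF sets_mehler_mixture_pair fst_mehler_mixture snd_mehler_mixture])
          (auto intro!: square_integrable_real_polynomial_function real_polynomial_function_herm b_pos)
    qed (intro borel_measurable_coupling_mult borel_measurable_herm)
    also have "\<dots> = (\<integral>s. (if m = n then (\<Prod>j\<in>UNIV. (s $ j) ^ (n $ j)) * herm_norm b n else 0) \<partial>\<nu>)"
    proof (rule Bochner_Integration.integral_cong_AE)
      show "(\<lambda>s. \<integral>z. herm b m (fst z) * herm b n (snd z) \<partial>mehler_law b s) \<in> borel_measurable \<nu>"
        using measurable_compose[OF measurable_prob_algebraD[OF measurable_mehler_law] integral_measurable_subprob_algebra[of "\<lambda>z. herm b m (fst z) * herm b n (snd z)" borel]]
        by (simp add: measurable_cong_sets[OF sets_cube_law[OF cube] refl] borel_measurable_coupling_mult)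
      show "AE s in \<nu>. (\<integral>z. herm b m (fst z) * herm b n (snd z) \<partial>mehler_law b s) = (if m
          = n then (\<Prod>j\<in>UNIV. (s $ j) ^ (n $ j)) * herm_norm b n else 0)"
        using AE_cube_law[OF cube] by eventually_elim (simp add: integral_mehler_law_herm)
    qed measurable
    also have "\<dots> = (if m = n then \<rho> n * herm_norm b n else 0)"
      using \<rho> by (simp add: is_moment_sequence_def)
    finally show ?thesis .
  qed
  then show ?thesis
    by (simp add: hermite_diagonal_def prob_space_mehler_mixture fst_mehler_mixture snd_mehler_mixture)
qed

end

end

section \<open>Jointly normal laws\<close>

lemma
  assumes v: "v \<ge> 0"
  shows real_distribution_normal_law: "real_distribution (normal_law m v)"
    and integrable_normal_law: "integrable (normal_law m v) (\<lambda>x. x)"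
    and mean_normal_law: "(\<integral>x. x \<partial>normal_law m v) = m"
    and square_integrable_normal_law: "integrable (normal_law m v) (\<lambda>x. x\<^sup>2)"
proof -
  have *: "real_distribution (normal_law m v) \<and> integrable (normal_law m v) (\<lambda>x. x) \<and>
    (\<integral>x. x \<partial>normal_law m v) = m \<and> integrable (normal_law m v) (\<lambda>x. x\<^sup>2)"
  proof (cases "v = 0")
    case True
    interpret prob_space "return borel m :: real measure" by (rule prob_space_return) simp
    have "real_distribution (return borel m :: real measure)" by unfold_locales simp
    moreover have "integrable (return borel m) (\<lambda>x. x :: real)"
      by (rule integrable_const_bound[where B="\<bar>m\<bar>"]) (auto simp: AE_return)
    moreover have "integrable (return borel m) (\<lambda>x. x\<^sup>2 :: real)"
      by (rule integrable_const_bound[where B="m\<^sup>2"]) (auto simp: AE_return)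
    moreover have "(\<integral>x. x \<partial>return borel m) = m" by (rule integral_return) auto
    moreover have "normal_law m v = return borel m" using True by (simp add: normal_law_def)
    ultimately show ?thesis by (simp only: simp_thms)
  next
    case False
    then have s: "sqrt v > 0" using v by simp
    define f where "f = normal_density m (sqrt v)"
    have law: "normal_law m v = density lborel (\<lambda>x. ennreal (f x))" using False by (simp add: normal_law_def f_def)
    interpret prob_space "density lborel (\<lambda>x. ennreal (f x))"
      unfolding f_def using s by (rule prob_space_normal_density)
    have [measurable]: "f \<in> borel_measurable borel" and f0: "\<And>x. 0 \<le> f x" by (auto simp: f_def)
    have 1: "integrable lborel (\<lambda>x. f x * x)" "(\<integral>x. f x * x \<partial>lborel) = m"
      using integrable_normal_moment_nz_1[OF s] integral_normal_moment_nz_1[OF s] by (auto simp: f_def)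
    have "integrable lborel (\<lambda>x. f x * (x - m) ^ 2 + (2 * m) * (f x * x) - m\<^sup>2 * f x)"
      using 1 integrable_normal_moment[OF s, of m 2] integrable_normal_density[OF s, of m] unfolding f_def
      by (intro Bochner_Integration.integrable_add Bochner_Integration.integrable_diff integrable_mult_right) auto
    moreover have "f x * (x - m) ^ 2 + (2 * m) * (f x * x) - m\<^sup>2 * f x = f x * x\<^sup>2" for x
      by (simp add: power2_eq_square algebra_simps)
    ultimately have 2: "integrable lborel (\<lambda>x. f x * x\<^sup>2)" by simp
    have "real_distribution (density lborel (\<lambda>x. ennreal (f x)))" by unfold_locales simp
    then show ?thesis using 1 2 f0 unfolding law by (simp add: integrable_density integral_density)
  qed
  then show "real_distribution (normal_law m v)" "integrable (normal_law m v) (\<lambda>x. x)"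
    "(\<integral>x. x \<partial>normal_law m v) = m" "integrable (normal_law m v) (\<lambda>x. x\<^sup>2)" by auto
qed

lemma normal_law_0: "v > 0 \<Longrightarrow> normal_law 0 v = normal_measure v"
  by (simp add: normal_law_def normal_measure_def)

lemma variance_normal_law: "v \<ge> 0 \<Longrightarrow> (\<integral>x. x\<^sup>2 \<partial>normal_law 0 v) = v"
proof (cases "v = 0")
  case True
  then show ?thesis by (simp add: normal_law_def integral_return)
next
  case False
  assume "v \<ge> 0"
  with False have v: "v > 0" by simp
  interpret prob_space "normal_measure v" by (rule prob_space_normal_measure[OF v])
  show ?thesis
    using normal_measure_moment_Suc[OF v, of 1] prob_space by (simp add: normal_law_0 v numeral_2_eq_2)
qed

lemma char_normal_law: "v \<ge> 0 \<Longrightarrow> char (normal_law 0 v) r = exp (- (v * r\<^sup>2 / 2))"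
proof (cases "v = 0")
  case True
  then show ?thesis by (simp add: char_def normal_law_def integral_return)
next
  case False
  assume "v \<ge> 0"
  with False have v: "v > 0" by simp
  show ?thesis unfolding char_def normal_law_0[OF v] by (rule char_normal_measure[OF v])
qed

lemma
  fixes N :: "'a::euclidean_space measure"
  assumes N: "jointly_normal N"
  shows integrable_jointly_normal: "integrable N (\<lambda>z. z \<bullet> t)"
    and square_integrable_jointly_normal: "integrable N (\<lambda>z. (z \<bullet> t)\<^sup>2)"
    and char_jointly_normal: "(\<integral>z. z \<bullet> t \<partial>N) = 0 \<Longrightarrow> (CLINT z|N. iexp (t \<bullet> z)) = exp (- ((\<integral>z. (z \<bullet> t)\<^sup>2 \<partial>N) / 2))"
proof -
  have [measurable_cong]: "sets N = sets borel" using N by (simp add: jointly_normal_def)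
  obtain m v where v: "v \<ge> 0" and law: "distr N borel (\<lambda>z. z \<bullet> t) = normal_law m v"
    using N unfolding jointly_normal_def by blast
  show "integrable N (\<lambda>z. z \<bullet> t)"
    using integrable_normal_law[OF v, of m] unfolding law[symmetric] by (subst (asm) integrable_distr_eq) auto
  show "integrable N (\<lambda>z. (z \<bullet> t)\<^sup>2)"
    using square_integrable_normal_law[OF v, of m] unfolding law[symmetric] by (subst (asm) integrable_distr_eq) auto
  assume "(\<integral>z. z \<bullet> t \<partial>N) = 0"
  then have m: "m = 0"
    using mean_normal_law[OF v, of m] unfolding law[symmetric] by (subst (asm) integral_distr) auto
  have "(\<integral>z. (z \<bullet> t)\<^sup>2 \<partial>N) = (\<integral>x. x\<^sup>2 \<partial>distr N borel (\<lambda>z. z \<bullet> t))"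
    by (subst integral_distr) auto
  also have "\<dots> = v" by (simp add: law m variance_normal_law[OF v])
  finally have "(\<integral>z. (z \<bullet> t)\<^sup>2 \<partial>N) = v" .
  moreover have "(CLINT z|N. iexp (t \<bullet> z)) = char (distr N borel (\<lambda>z. z \<bullet> t)) 1"
    unfolding char_def by (subst integral_distr) (auto simp: inner_commute)
  ultimately show "(CLINT z|N. iexp (t \<bullet> z)) = exp (- ((\<integral>z. (z \<bullet> t)\<^sup>2 \<partial>N) / 2))"
    by (simp add: law m char_normal_law[OF v])
qed

lemma integrable_jointly_normal_mult:
  fixes N :: "'a::euclidean_space measure"
  assumes N: "jointly_normal N"
  shows "integrable N (\<lambda>z. (z \<bullet> s) * (z \<bullet> t))"
proof (rule Bochner_Integration.integrable_bound)
  have [measurable_cong]: "sets N = sets borel" using N by (simp add: jointly_normal_def)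
  show "integrable N (\<lambda>z. (z \<bullet> s)\<^sup>2 + (z \<bullet> t)\<^sup>2)"
    by (intro Bochner_Integration.integrable_add square_integrable_jointly_normal N)
  show "(\<lambda>z. (z \<bullet> s) * (z \<bullet> t)) \<in> borel_measurable N" by measurable
  show "AE z in N. norm ((z \<bullet> s) * (z \<bullet> t)) \<le> norm ((z \<bullet> s)\<^sup>2 + (z \<bullet> t)\<^sup>2)"
    by (simp add: abs_mult_le_sum_squares)
qed

text \<open>The characteristic function of a centred normal functional is fixed by its second
  moment, and the second moment of \<open>z \<bullet> t\<close> is a quadratic form in the entries
  of the covariance.\<close>

lemma jointly_normal_eqI:
  fixes N N' :: "'a::euclidean_space measure"
  assumes N: "jointly_normal N" and N': "jointly_normal N'"
    and mean: "\<And>k. k \<in> Basis \<Longrightarrow> (\<integral>z. z \<bullet> k \<partial>N) = 0" "\<And>k. k \<in> Basis \<Longrightarrow> (\<integral>z. z \<bullet> k \<partial>N') = 0"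
    and cov: "\<And>k l. k \<in> Basis \<Longrightarrow> l \<in> Basis \<Longrightarrow> (\<integral>z. (z \<bullet> k) * (z \<bullet> l) \<partial>N) = (\<integral>z. (z \<bullet> k) * (z \<bullet> l) \<partial>N')"
  shows "N = N'"
proof (rule char_functional_uniqueness)
  show "prob_space N" "prob_space N'" "sets N = sets borel" "sets N' = sets borel"
    using N N' by (auto simp: jointly_normal_def)
  fix t :: 'a
  have e: "z \<bullet> t = (\<Sum>k\<in>Basis. (t \<bullet> k) * (z \<bullet> k))" for z
    by (subst euclidean_inner) (simp add: mult.commute)
  have m: "(\<integral>z. z \<bullet> t \<partial>L) = (\<Sum>k\<in>Basis. (t \<bullet> k) * (\<integral>z. z \<bullet> k \<partial>L))" if "jointly_normal L" for L
    unfolding e[of "_"] using integrable_jointly_normal[OF that] by (subst Bochner_Integration.integral_sum) auto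
  have e2: "(z \<bullet> t)\<^sup>2 = (\<Sum>k\<in>Basis. \<Sum>l\<in>Basis. ((t \<bullet> k) * (t \<bullet> l)) * ((z \<bullet> k) * (z \<bullet> l)))" for z
    unfolding power2_eq_square e[of z] sum_product by (simp only: mult_ac)
  have q: "(\<integral>z. (z \<bullet> t)\<^sup>2 \<partial>L) = (\<Sum>k\<in>Basis. \<Sum>l\<in>Basis. ((t \<bullet> k) * (t \<bullet> l)) * (\<integral>z. (z \<bullet> k)
      * (z \<bullet> l) \<partial>L))" if "jointly_normal L" for L
    unfolding e2 using integrable_jointly_normal_mult[OF that]
    by (subst Bochner_Integration.integral_sum, intro Bochner_Integration.integrable_sum integrable_mult_right, simp)
       (intro sum.cong refl, subst Bochner_Integration.integral_sum, auto)
  have "(\<integral>z. (z \<bullet> t)\<^sup>2 \<partial>N) = (\<integral>z. (z \<bullet> t)\<^sup>2 \<partial>N')"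
    unfolding q[OF N] q[OF N'] using cov by (intro sum.cong refl) simp
  moreover have "(\<integral>z. z \<bullet> t \<partial>N) = 0" "(\<integral>z. z \<bullet> t \<partial>N') = 0"
    using mean by (simp_all add: m[OF N] m[OF N'])
  ultimately show "(CLINT z|N. iexp (t \<bullet> z)) = (CLINT z|N'. iexp (t \<bullet> z))"
    by (simp only: char_jointly_normal[OF N] char_jointly_normal[OF N'])
qed

text \<open>The scaling rule makes v quadratic along lines, so each functional
  \<open>z \<bullet> t\<close> has the characteristic function of \<open>normal_law 0 (v t)\<close>;
  the mixed second moments come from v by polarization.\<close>

lemma
  fixes N :: "'a::euclidean_space measure"
  assumes N: "prob_space N" "sets N = sets borel"
    and char: "\<And>t. (CLINT z|N. iexp (t \<bullet> z)) = complex_of_real (exp (- (v t / 2)))"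
    and v: "\<And>t. v t \<ge> 0" "\<And>r t. v (r *\<^sub>R t) = r\<^sup>2 * v t"
  shows jointly_normal_charI: "jointly_normal N"
    and mean_of_char: "(\<integral>z. z \<bullet> t \<partial>N) = 0"
    and covariance_of_char: "(\<integral>z. (z \<bullet> s) * (z \<bullet> t) \<partial>N) = (v (s + t) - v s - v t) / 2"
proof -
  interpret prob_space N by fact
  have [measurable_cong]: "sets N = sets borel" by fact
  have law: "distr N borel (\<lambda>z. z \<bullet> t) = normal_law 0 (v t)" for t
  proof (rule Levy_uniqueness)
    interpret D: prob_space "distr N borel (\<lambda>z. z \<bullet> t)" by (rule prob_space_distr) measurable
    show "real_distribution (distr N borel (\<lambda>z. z \<bullet> t))" by unfold_locales simp
    show "real_distribution (normal_law 0 (v t))" by (rule real_distribution_normal_law[OF v(1)])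
    show "char (distr N borel (\<lambda>z. z \<bullet> t)) = char (normal_law 0 (v t))"
    proof
      fix r
      have "char (distr N borel (\<lambda>z. z \<bullet> t)) r = (CLINT z|N. iexp ((r *\<^sub>R t) \<bullet> z))"
        unfolding char_def by (subst integral_distr) (auto simp: inner_commute)
      also have "\<dots> = char (normal_law 0 (v t)) r"
        by (simp only: char v(2) char_normal_law[OF v(1)] mult.commute[of "r\<^sup>2"])
      finally show "char (distr N borel (\<lambda>z. z \<bullet> t)) r = char (normal_law 0 (v t)) r" .
    qed
  qed
  show jn: "jointly_normal N"
    unfolding jointly_normal_def using N law v(1) by blast
  show "(\<integral>z. z \<bullet> t \<partial>N) = 0" for t
    using mean_normal_law[OF v(1), of 0 t] unfolding law[symmetric] by (subst (asm) integral_distr) auto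
  have sq: "(\<integral>z. (z \<bullet> t)\<^sup>2 \<partial>N) = v t" for t
    using variance_normal_law[OF v(1), of t] unfolding law[symmetric] by (subst (asm) integral_distr) auto
  have "(z \<bullet> (s + t))\<^sup>2 = (z \<bullet> s)\<^sup>2 + (z \<bullet> t)\<^sup>2 + 2 * ((z \<bullet> s) * (z \<bullet> t))" for z
    by (simp add: inner_add_right power2_sum)
  then have "v (s + t) = v s + v t + 2 * (\<integral>z. (z \<bullet> s) * (z \<bullet> t) \<partial>N)"
    unfolding sq[symmetric] using square_integrable_jointly_normal[OF jn] integrable_jointly_normal_mult[OF jn] by simp
  then show "(\<integral>z. (z \<bullet> s) * (z \<bullet> t) \<partial>N) = (v (s + t) - v s - v t) / 2" by simp
qed

lemma Basis_vec_pair_cases: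
  assumes "k \<in> (Basis :: ((real ^ 'd) \<times> (real ^ 'd)) set)"
  obtains i where "k = (axis i 1, 0)" | i where "k = (0, axis i 1)"
  using assms by (auto simp: Basis_prod_def Basis_vec_def)

lemma inner_axis_pair:
  "z \<bullet> (axis i 1, 0) = fst z $ i" "z \<bullet> (0, axis i 1) = snd z $ i" for z :: "(real ^ 'd) \<times> (real ^ 'd)"
  by (simp_all add: inner_prod_def inner_axis)

text \<open>Independence within vectors supplies the off-diagonal covariances of each vector, which
  \<open>normal_pair\<close> does not list; with these all second moments are fixed.\<close>

lemma normal_pair_moments:
  assumes N: "normal_pair \<tau> V N"
  shows "(\<integral>z. fst z $ i \<partial>N) = 0" "(\<integral>z. snd z $ i \<partial>N) = 0"
    and "(\<integral>z. fst z $ i * fst z $ j \<partial>N) = (if i = j then \<tau> $ i else 0)"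
    and "(\<integral>z. snd z $ i * snd z $ j \<partial>N) = (if i = j then \<tau> $ i else 0)"
    and "(\<integral>z. fst z $ i * snd z $ j \<partial>N) = V $ i $ j"
proof -
  interpret prob_space N using N by (simp add: normal_pair_def jointly_normal_def)
  show m: "(\<integral>z. fst z $ i \<partial>N) = 0" "(\<integral>z. snd z $ i \<partial>N) = 0" for i
    using N by (auto simp: normal_pair_def)
  have i: "integrable N (\<lambda>z. fst z $ i)" "integrable N (\<lambda>z. snd z $ i)" for i
    using N integrable_jointly_normal[of N "(axis i 1, 0)"] integrable_jointly_normal[of N "(0, axis i 1)"]
    by (auto simp: inner_axis_pair normal_pair_def)
  have cov: "covariance N f g = (\<integral>z. f z * g z \<partial>N)" if "integral\<^sup>L N f = 0" "integral\<^sup>L N g = 0" for f g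
    using that by (simp add: covariance_def)
  show "(\<integral>z. fst z $ i * snd z $ j \<partial>N) = V $ i $ j"
    using N cov[OF m(1)[of i] m(2)[of j]] by (simp add: normal_pair_def)
  have indep: "(\<integral>z. f i z * f j z \<partial>N) = (\<integral>z. f i z \<partial>N) * (\<integral>z. f j z \<partial>N)"
    if "i \<noteq> j" "indep_vars (\<lambda>_. borel) f UNIV" "\<And>i. integrable N (f i)" for f :: "'a \<Rightarrow> _ \<Rightarrow> real" and i j
    using indep_vars_lebesgue_integral[of "{i, j}" f] indep_vars_subset[OF that(2), of "{i, j}"] that by simp
  show "(\<integral>z. fst z $ i * fst z $ j \<partial>N) = (if i = j then \<tau> $ i else 0)"
  proof (cases "i = j")
    case True
    then show ?thesis using N cov[OF m(1)[of i] m(1)[of i]] by (simp add: normal_pair_def)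
  next
    case False
    then show ?thesis using indep[of i j "\<lambda>i z. fst z $ i"] N i m by (simp add: normal_pair_def)
  qed
  show "(\<integral>z. snd z $ i * snd z $ j \<partial>N) = (if i = j then \<tau> $ i else 0)"
  proof (cases "i = j")
    case True
    then show ?thesis using N cov[OF m(2)[of i] m(2)[of i]] by (simp add: normal_pair_def)
  next
    case False
    then show ?thesis using indep[of i j "\<lambda>i z. snd z $ i"] N i m by (simp add: normal_pair_def)
  qed
qed

lemma normal_pair_unique:
  assumes N: "normal_pair \<tau> V N" and N': "normal_pair \<tau> V N'"
  shows "N = N'"
proof (rule jointly_normal_eqI)
  show "jointly_normal N" "jointly_normal N'" using N N' by (auto simp: normal_pair_def)
  show "k \<in> Basis \<Longrightarrow> (\<integral>z. z \<bullet> k \<partial>N) = 0" "k \<in> Basis \<Longrightarrow> (\<integral>z. z \<bullet> k \<partial>N') = 0" for k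
    by (elim Basis_vec_pair_cases; simp add: inner_axis_pair normal_pair_moments[OF N] normal_pair_moments[OF N'])+
  show "(\<integral>z. (z \<bullet> k) * (z \<bullet> l) \<partial>N) = (\<integral>z. (z \<bullet> k) * (z \<bullet> l) \<partial>N')" if "k \<in> Basis" "l \<in> Basis" for k l
    using that
    by (elim Basis_vec_pair_cases;
        simp add: inner_axis_pair normal_pair_moments[OF N] normal_pair_moments[OF N']
          mult.commute[of "snd z $ i" "fst z $ j" for z i j])
qed

section \<open>Change of coordinates\<close>

text \<open>\<open>hat u x\<close> collects the values of \<open>\<Sum>\<^sub>i u\<^sub>i\<^sup>(\<^sup>j\<^sup>) x\<^sub>i\<close> from the definition of the multivariate
  polynomials, \<open>hat_var\<close> their variances \<open>|\<tau>| a\<^sub>j\<close>, and \<open>unhat\<close> inverts \<open>hat\<close>.\<close>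
definition hat_var :: "real ^ 'd \<Rightarrow> ('d \<Rightarrow> real) \<Rightarrow> real ^ 'd" where
  "hat_var \<tau> a = (\<chi> j. total \<tau> * a j)"

definition hat :: "('d \<Rightarrow> real ^ 'd) \<Rightarrow> real ^ 'd \<Rightarrow> real ^ 'd" where
  "hat u x = (\<chi> j. \<Sum>i\<in>UNIV. u j $ i * x $ i)"

definition unhat :: "real ^ 'd \<Rightarrow> ('d \<Rightarrow> real ^ 'd) \<Rightarrow> ('d \<Rightarrow> real) \<Rightarrow> real ^ 'd \<Rightarrow> real ^ 'd" where
  "unhat \<tau> u a w = (\<chi> i. \<tau> $ i * (\<Sum>j\<in>UNIV. u j $ i * w $ j / (total \<tau> * a j)))"

definition hat_pair :: "('d \<Rightarrow> real ^ 'd) \<Rightarrow> (real ^ 'd) \<times> (real ^ 'd) \<Rightarrow> (real ^ 'd) \<times> (real ^ 'd)" where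
  "hat_pair u z = (hat u (fst z), hat u (snd z))"

definition unhat_pair :: "real ^ 'd \<Rightarrow> ('d \<Rightarrow> real ^ 'd) \<Rightarrow> ('d \<Rightarrow> real) \<Rightarrow> (real ^ 'd) \<times> (real ^ 'd) \<Rightarrow> (real ^ 'd) \<times> (real ^ 'd)" where
  "unhat_pair \<tau> u a z = (unhat \<tau> u a (fst z), unhat \<tau> u a (snd z))"

lemma measurable_hat[measurable]: "hat u \<in> borel \<rightarrow>\<^sub>M borel"
  unfolding hat_def[abs_def] by measurable

lemma measurable_unhat[measurable]: "unhat \<tau> u a \<in> borel \<rightarrow>\<^sub>M borel"
  unfolding unhat_def[abs_def] by measurable

lemma measurable_hat_normal: "hat u \<in> normal_product \<tau> \<rightarrow>\<^sub>M borel"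
  by (simp add: measurable_cong_sets[OF sets_normal_product refl] measurable_hat)

lemma measurable_hat_pair: "hat_pair u \<in> borel \<rightarrow>\<^sub>M borel"
  unfolding hat_pair_def[abs_def]
  by (intro borel_measurable_Pair measurable_compose[OF borel_measurable_fst_pair measurable_hat]
      measurable_compose[OF borel_measurable_snd_pair measurable_hat])

lemma measurable_unhat_pair: "unhat_pair \<tau> u a \<in> borel \<rightarrow>\<^sub>M borel"
  unfolding unhat_pair_def[abs_def]
  by (intro borel_measurable_Pair measurable_compose[OF borel_measurable_fst_pair measurable_unhat]
      measurable_compose[OF borel_measurable_snd_pair measurable_unhat])

lemma measurable_unhat_pair_mehler_law: "unhat_pair \<tau> u a \<in> mehler_law b s \<rightarrow>\<^sub>M borel"
  by (simp add: measurable_cong_sets[OF sets_mehler_law refl] measurable_unhat_pair)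

lemma distr_borel_distr:
  "f \<in> borel \<rightarrow>\<^sub>M borel \<Longrightarrow> g \<in> borel \<rightarrow>\<^sub>M borel \<Longrightarrow> sets M = sets borel \<Longrightarrow>
    distr (distr M borel f) borel g = distr M borel (\<lambda>x. g (f x))"
  by (subst distr_distr) (auto simp: comp_def measurable_cong_sets[of M borel])

lemma multi_hermite_eq_herm: "multi_hermite \<tau> u a n x = herm (hat_var \<tau> a) n (hat u x)"
  by (simp add: multi_hermite_def herm_def hat_var_def hat_def)

context
  fixes \<tau> :: "real ^ 'd" and u :: "'d \<Rightarrow> real ^ 'd" and a :: "'d \<Rightarrow> real"
  assumes \<tau>_pos: "\<And>i. \<tau> $ i > 0"
    and basis: "orthogonal_basis (weights \<tau>) u a"
begin

section \<open>Consequences of orthogonality and completeness\<close>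

lemma total_pos: "total \<tau> > 0"
  unfolding total_def using \<tau>_pos by (intro sum_pos) auto

lemma orthogonality: "(\<Sum>i\<in>UNIV. u k $ i * u l $ i * \<tau> $ i) = (if k = l then total \<tau> * a k else 0)"
proof -
  have "(\<Sum>i\<in>UNIV. u k $ i * u l $ i * \<tau> $ i) = total \<tau> * (\<Sum>i\<in>UNIV. u k $ i * u l $ i * weights \<tau> $ i)"
    using total_pos by (simp add: weights_def sum_distrib_left)
  then show ?thesis using basis by (simp add: orthogonal_basis_def)
qed

text \<open>A zero vector could be dropped from a spanning set, and d - 1 vectors cannot span
  dimension d. This is what makes the variances \<open>hat_var\<close> positive.\<close>

lemma basis_nonzero: "u j \<noteq> 0"
proof
  assume "u j = 0"
  then have "range u \<subseteq> span (u ` (UNIV - {j}))"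
    by (auto intro: span_base span_zero) (metis DiffI UNIV_I imageI singletonD span_base span_zero)
  then have "span (range u) \<subseteq> span (u ` (UNIV - {j}))"
    by (rule span_minimal) (rule subspace_span)
  then have "UNIV \<subseteq> span (u ` (UNIV - {j}))"
    using basis by (simp add: orthogonal_basis_def)
  then have "dim (UNIV :: (real ^ 'd) set) \<le> card (u ` (UNIV - {j}))"
    by (rule dim_le_card) simp
  also have "\<dots> \<le> card (UNIV - {j})" by (rule card_image_le) simp
  also have "\<dots> < CARD('d)" by (rule psubset_card_mono) auto
  finally show False by simp
qed

lemma hat_var_pos: "hat_var \<tau> a $ j > 0"
proof -
  obtain i where i: "u j $ i \<noteq> 0" using basis_nonzero[of j] by (auto simp: vec_eq_iff)
  have "0 < (\<Sum>i\<in>UNIV. u j $ i * u j $ i * \<tau> $ i)"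
    by (rule sum_pos2[of _ i]) (use i \<tau>_pos in \<open>auto simp: less_imp_le not_sum_squares_lt_zero zero_less_mult_iff linorder_neq_iff\<close>)
  then show ?thesis by (simp add: orthogonality hat_var_def)
qed

lemma scale_pos: "total \<tau> * a j > 0"
  using hat_var_pos[of j] by (simp add: hat_var_def)

text \<open>Let U have the rows \<open>u j\<close>. Orthogonality says that U times the diagonal
  matrix of \<tau> times the transpose of U is the diagonal matrix of \<open>hat_var\<close>, so
  moving the latter to the left-hand side exhibits a right inverse of U, which is
  \<open>unhat\<close>.\<close>

lemma hat_unhat: "hat u (unhat \<tau> u a w) = w"
proof -
  have "hat u (unhat \<tau> u a w) $ k = w $ k" for k
  proof -
    have "hat u (unhat \<tau> u a w) $ k = (\<Sum>i\<in>UNIV. \<Sum>j\<in>UNIV. (u k $ i * u j $ i * \<tau> $ i) * (w $ j / (total \<tau> * a j)))"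
      by (simp add: hat_def unhat_def sum_distrib_left mult_ac)
    also have "\<dots> = (\<Sum>j\<in>UNIV. (\<Sum>i\<in>UNIV. u k $ i * u j $ i * \<tau> $ i) * (w $ j / (total \<tau> * a j)))"
      by (subst sum.swap) (simp only: sum_distrib_right)
    also have "\<dots> = (\<Sum>j\<in>UNIV. if j = k then w $ k else 0)"
      unfolding orthogonality using scale_pos[of k] by (intro sum.cong) auto
    finally show ?thesis by simp
  qed
  then show ?thesis by (simp add: vec_eq_iff)
qed

text \<open>There are as many basis functions as points, so the matrices are square and a right
  inverse is a left inverse.\<close>

lemma unhat_hat: "unhat \<tau> u a (hat u x) = x"
proof -
  define A :: "real ^ 'd ^ 'd" where "A = (\<chi> j. u j)"
  define B :: "real ^ 'd ^ 'd" where "B = (\<chi> i j. \<tau> $ i * (u j $ i / (total \<tau> * a j)))"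
  have A: "hat u x = A *v x" for x
    by (simp add: hat_def A_def matrix_vector_mult_def)
  have B: "unhat \<tau> u a w = B *v w" for w
    by (simp add: unhat_def B_def matrix_vector_mult_def sum_distrib_left mult_ac)
  have "(A ** B) *v w = mat 1 *v w" for w
    using hat_unhat[of w] by (simp add: A B matrix_vector_mul_assoc[symmetric])
  then have "A ** B = mat 1" by (simp add: matrix_eq)
  then have "B ** A = mat 1" by (simp add: matrix_left_right_inverse)
  then show ?thesis by (simp add: A B matrix_vector_mul_assoc)
qed

lemma hat_pair_unhat_pair: "hat_pair u (unhat_pair \<tau> u a z) = z"
  and unhat_pair_hat_pair: "unhat_pair \<tau> u a (hat_pair u z) = z"
  by (simp_all add: hat_pair_def unhat_pair_def hat_unhat unhat_hat)

text \<open>The quadratic form of the image at t is that of \<tau> at the transposed map applied to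
  t, and orthogonality diagonalizes it.\<close>

lemma distr_hat: "distr (normal_product \<tau>) borel (hat u) = normal_product (hat_var \<tau> a)"
proof (rule char_functional_uniqueness)
  interpret N: prob_space "normal_product \<tau>" by (rule prob_space_normal_product[OF \<tau>_pos])
  show "prob_space (distr (normal_product \<tau>) borel (hat u))" by (rule N.prob_space_distr[OF measurable_hat_normal])
  show "prob_space (normal_product (hat_var \<tau> a))" by (rule prob_space_normal_product[OF hat_var_pos])
  fix t :: "real ^ 'd"
  define s :: "real ^ 'd" where "s = (\<chi> i. \<Sum>j\<in>UNIV. t $ j * u j $ i)"
  have "t \<bullet> hat u x = s \<bullet> x" for x
  proof -
    have "t \<bullet> hat u x = (\<Sum>j\<in>UNIV. \<Sum>i\<in>UNIV. t $ j * u j $ i * x $ i)"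
      by (simp add: inner_vec_def hat_def sum_distrib_left mult_ac)
    also have "\<dots> = s \<bullet> x"
      by (subst sum.swap) (simp add: inner_vec_def s_def sum_distrib_right)
    finally show ?thesis .
  qed
  then have "(CLINT x|distr (normal_product \<tau>) borel (hat u). iexp (t \<bullet> x)) = (CLINT x|normal_product \<tau>. iexp (s \<bullet> x))"
    by (subst integral_distr[OF measurable_hat_normal]) auto
  also have "\<dots> = exp (- ((\<Sum>i\<in>UNIV. \<tau> $ i * (s $ i)\<^sup>2) / 2))"
    by (rule char_normal_product[OF \<tau>_pos])
  also have "(\<Sum>i\<in>UNIV. \<tau> $ i * (s $ i)\<^sup>2) = (\<Sum>j\<in>UNIV. hat_var \<tau> a $ j * (t $ j)\<^sup>2)"
  proof -
    have "(\<Sum>i\<in>UNIV. \<tau> $ i * (s $ i)\<^sup>2) = (\<Sum>i\<in>UNIV. \<Sum>j\<in>UNIV. \<Sum>k\<in>UNIV. (t $ j * t $ k) * (u j $ i * u k $ i * \<tau> $ i))"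
      by (simp add: s_def power2_eq_square sum_product sum_distrib_left mult_ac)
    also have "\<dots> = (\<Sum>j\<in>UNIV. \<Sum>i\<in>UNIV. \<Sum>k\<in>UNIV. (t $ j * t $ k) * (u j $ i * u k $ i * \<tau> $ i))"
      by (rule sum.swap)
    also have "\<dots> = (\<Sum>j\<in>UNIV. \<Sum>k\<in>UNIV. (t $ j * t $ k) * (\<Sum>i\<in>UNIV. u j $ i * u k $ i * \<tau> $ i))"
      by (rule sum.cong[OF refl], subst sum.swap) (simp add: sum_distrib_left)
    also have "\<dots> = (\<Sum>j\<in>UNIV. \<Sum>k\<in>UNIV. if k = j then hat_var \<tau> a $ j * (t $ j)\<^sup>2 else 0)"
      unfolding orthogonality by (intro sum.cong refl) (auto simp: hat_var_def power2_eq_square)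
    finally show ?thesis by simp
  qed
  also have "complex_of_real (exp (- ((\<Sum>j\<in>UNIV. hat_var \<tau> a $ j * (t $ j)\<^sup>2) / 2)))
      = (CLINT x|normal_product (hat_var \<tau> a). iexp (t \<bullet> x))"
    by (rule char_normal_product[OF hat_var_pos, symmetric])
  finally show "(CLINT x|distr (normal_product \<tau>) borel (hat u). iexp (t \<bullet> x))
      = (CLINT x|normal_product (hat_var \<tau> a). iexp (t \<bullet> x))" .
qed auto

lemma distr_unhat: "distr (normal_product (hat_var \<tau> a)) borel (unhat \<tau> u a) = normal_product \<tau>"
  unfolding distr_hat[symmetric]
  by (subst distr_borel_distr) (auto simp: unhat_hat intro: distr_id2)

lemma hermite_h_eq: "hermite_h \<tau> u a n = 1 / herm_norm (hat_var \<tau> a) n"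
proof -
  have "(\<integral>x. (multi_hermite \<tau> u a n x)\<^sup>2 \<partial>normal_product \<tau>)
      = (\<integral>y. (herm (hat_var \<tau> a) n y)\<^sup>2 \<partial>distr (normal_product \<tau>) borel (hat u))"
    by (subst integral_distr[OF measurable_hat_normal]) (auto simp: multi_hermite_eq_herm)
  also have "\<dots> = herm_norm (hat_var \<tau> a) n"
    using herm_orthogonal[OF hat_var_pos, of n n] by (simp add: distr_hat power2_eq_square)
  finally show ?thesis by (simp add: hermite_h_def)
qed

text \<open>\<open>hat_pair u\<close> is a bijection measurable in both directions, so every clause
  transfers both ways.\<close>

lemma lancaster_law_iff_diagonal:
  assumes sets: "sets \<mu> = sets borel"
  shows "lancaster_law \<tau> u a \<rho> \<mu> \<longleftrightarrow> hermite_diagonal (hat_var \<tau> a) \<rho> (distr \<mu> borel (hat_pair u))"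
proof -
  let ?D = "distr \<mu> borel (hat_pair u)"
  have inv_eq: "distr ?D borel (unhat_pair \<tau> u a) = \<mu>"
    by (subst distr_borel_distr) (auto simp: measurable_hat_pair measurable_unhat_pair unhat_pair_hat_pair sets intro: distr_id2)
  have hp: "hat_pair u \<in> \<mu> \<rightarrow>\<^sub>M borel" by (simp add: measurable_cong_sets[OF sets refl] measurable_hat_pair)
  have up: "unhat_pair \<tau> u a \<in> ?D \<rightarrow>\<^sub>M borel" by (simp add: measurable_unhat_pair)
  have "prob_space \<mu> \<longleftrightarrow> prob_space ?D"
    using prob_space.prob_space_distr[OF _ hp] prob_space.prob_space_distr[OF _ up] inv_eq by auto
  moreover have "distr \<mu> borel f = normal_product \<tau> \<longleftrightarrow> distr ?D borel f = normal_product (hat_var \<tau> a)"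
    if f: "f \<in> borel \<rightarrow>\<^sub>M borel" "\<And>z. f (hat_pair u z) = hat u (f z)" for f :: "_ \<Rightarrow> real ^ 'd"
  proof -
    have "distr ?D borel f = distr (distr \<mu> borel f) borel (hat u)"
      using f by (simp add: distr_borel_distr measurable_hat_pair sets)
    moreover have "distr \<mu> borel f = distr (distr ?D borel f) borel (unhat \<tau> u a)"
      using f by (simp add: distr_borel_distr measurable_hat_pair measurable_compose[OF f(1) measurable_hat] sets unhat_hat)
    ultimately show ?thesis using distr_hat distr_unhat by metis
  qed
  from this[OF borel_measurable_fst_pair] this[OF borel_measurable_snd_pair]
  have "distr \<mu> borel fst = normal_product \<tau> \<longleftrightarrow> distr ?D borel fst = normal_product (hat_var \<tau> a)"
    "distr \<mu> borel snd = normal_product \<tau> \<longleftrightarrow> distr ?D borel snd = normal_product (hat_var \<tau> a)"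
    by (simp_all add: hat_pair_def)
  moreover have "(\<integral>z. multi_hermite \<tau> u a m (fst z) * multi_hermite \<tau> u a n (snd z) \<partial>\<mu>) =
     (\<integral>z. herm (hat_var \<tau> a) m (fst z) * herm (hat_var \<tau> a) n (snd z) \<partial>?D)" for m n
    by (subst integral_distr[OF hp]) (auto intro!: borel_measurable_coupling_mult simp: hat_pair_def multi_hermite_eq_herm)
  ultimately show ?thesis
    unfolding lancaster_law_def hermite_diagonal_def by (simp add: sets hermite_h_eq)
qed

lemma lancaster_law_unique:
  assumes "lancaster_law \<tau> u a \<rho> \<mu>" "lancaster_law \<tau> u a \<rho> \<mu>'"
  shows "\<mu> = \<mu>'"
proof -
  have s: "sets \<mu> = sets borel" "sets \<mu>' = sets borel" using assms by (auto simp: lancaster_law_def)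
  have "distr \<mu> borel (hat_pair u) = distr \<mu>' borel (hat_pair u)"
    using assms by (intro hermite_diagonal_unique[OF hat_var_pos]) (auto simp: lancaster_law_iff_diagonal s)
  moreover have "distr (distr L borel (hat_pair u)) borel (unhat_pair \<tau> u a) = L" if "sets L = sets borel" for L
    using that by (subst distr_borel_distr) (auto simp: measurable_hat_pair measurable_unhat_pair unhat_pair_hat_pair intro: distr_id2)
  ultimately show ?thesis using s by metis
qed

text \<open>Lets the moments of a mixing law be read off from its mixture in the final
  theorem.\<close>

lemma lancaster_law_correlation_unique:
  assumes "lancaster_law \<tau> u a \<rho> \<mu>" "lancaster_law \<tau> u a \<rho>' \<mu>"
  shows "\<rho> = \<rho>'"
proof
  fix n
  have "\<rho> n / hermite_h \<tau> u a n = \<rho>' n / hermite_h \<tau> u a n"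
    using assms unfolding lancaster_law_def by metis
  then show "\<rho> n = \<rho>' n"
    using herm_norm_pos[OF hat_var_pos, of n] by (simp add: hermite_h_eq)
qed

section \<open>Conditionally normal pairs in the original coordinates\<close>

definition normal_kernel :: "real ^ 'd \<Rightarrow> ((real ^ 'd) \<times> (real ^ 'd)) measure" where
  "normal_kernel s = distr (mehler_law (hat_var \<tau> a) s) borel (unhat_pair \<tau> u a)"

definition lancaster_mixture :: "(real ^ 'd) measure \<Rightarrow> ((real ^ 'd) \<times> (real ^ 'd)) measure" where
  "lancaster_mixture \<nu> = distr (mehler_mixture (hat_var \<tau> a) \<nu>) borel (unhat_pair \<tau> u a)"

lemma prob_space_normal_kernel: "prob_space (normal_kernel s)"
  unfolding normal_kernel_def
  by (rule prob_space.prob_space_distr[OF prob_space_mehler_law[OF hat_var_pos] measurable_unhat_pair_mehler_law])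

lemma lancaster_law_mixture:
  assumes "cube_law \<nu>" "is_moment_sequence \<rho> \<nu>"
  shows "lancaster_law \<tau> u a \<rho> (lancaster_mixture \<nu>)"
proof -
  have "distr (lancaster_mixture \<nu>) borel (hat_pair u) = mehler_mixture (hat_var \<tau> a) \<nu>"
    unfolding lancaster_mixture_def
    by (subst distr_borel_distr) (auto simp: measurable_hat_pair measurable_unhat_pair hat_pair_unhat_pair intro: distr_id2)
  then show ?thesis
    using hermite_diagonal_mehler_mixture[OF hat_var_pos assms]
    by (subst lancaster_law_iff_diagonal) (auto simp: lancaster_mixture_def)
qed

text \<open>\<open>adj\<close> is the transpose of \<open>unhat\<close>, so the characteristic
  function is \<open>exp (- (v t / 2))\<close> with v the quadratic form of
  \<open>mehler_law\<close> at the transposed arguments; polarization at unit vectors yields the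
  covariances.\<close>

lemma normal_pair_normal_kernel:
  assumes s: "\<And>j. \<bar>s $ j\<bar> \<le> 1"
  shows "normal_pair \<tau> (cross_covariance \<tau> u a s) (normal_kernel s)"
proof -
  define b where "b = hat_var \<tau> a"
  define adj :: "real ^ 'd \<Rightarrow> real ^ 'd" where "adj t = (\<chi> j. \<Sum>i\<in>UNIV. t $ i * \<tau> $ i * u j $ i / (total \<tau> * a j))" for t
  define v where "v t = (\<Sum>j\<in>UNIV. b $ j * ((adj (fst t) $ j)\<^sup>2 + (adj (snd t) $ j)\<^sup>2 + 2 * s $ j
      * adj (fst t) $ j * adj (snd t) $ j))" for t
  have adj: "t \<bullet> unhat \<tau> u a w = adj t \<bullet> w" for t w
  proof -
    have "t \<bullet> unhat \<tau> u a w = (\<Sum>i\<in>UNIV. \<Sum>j\<in>UNIV. t $ i * \<tau> $ i * u j $ i / (total \<tau> * a j) * w $ j)"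
      by (simp add: inner_vec_def unhat_def sum_distrib_left mult_ac)
    also have "\<dots> = adj t \<bullet> w"
      by (subst sum.swap) (simp add: inner_vec_def adj_def sum_distrib_right)
    finally show ?thesis .
  qed
  have sets: "sets (normal_kernel s) = sets borel" by (simp add: normal_kernel_def)
  have char: "(CLINT z|normal_kernel s. iexp (t \<bullet> z)) = complex_of_real (exp (- (v t / 2)))" for t
  proof -
    have "t \<bullet> unhat_pair \<tau> u a z = (adj (fst t), adj (snd t)) \<bullet> z" for z
      by (simp add: inner_prod_def unhat_pair_def adj)
    then have "(CLINT z|normal_kernel s. iexp (t \<bullet> z)) = (CLINT z|mehler_law b s. iexp ((adj (fst t), adj (snd t)) \<bullet> z))"
      unfolding normal_kernel_def b_def
      by (subst integral_distr[OF measurable_unhat_pair_mehler_law]) (auto simp del: inner_Pair)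
    then show ?thesis
      unfolding b_def char_mehler_law[OF hat_var_pos s] by (simp add: v_def b_def)
  qed
  have v0: "v t \<ge> 0" for t
    unfolding v_def
  proof (intro sum_nonneg mult_nonneg_nonneg)
    fix j
    show "0 \<le> b $ j" using hat_var_pos[of j] by (simp add: b_def)
    have "(s $ j)\<^sup>2 \<le> 1" using s[of j] by (simp add: abs_square_le_1)
    \<comment> \<open>The sum of squares
      \<open>(x + s y)\<^sup>2 + (1 - s\<^sup>2) y\<^sup>2\<close> equals
      \<open>x\<^sup>2 + y\<^sup>2 + 2 s x y\<close>.\<close>
    then have "0 \<le> (1 - (s $ j)\<^sup>2) * y\<^sup>2 + (x + s $ j * y)\<^sup>2" for y x :: real by simp
    from this[of "adj (snd t) $ j" "adj (fst t) $ j"] show "0 \<le> (adj (fst t) $ j)\<^sup>2 + (adj (snd t) $ j)\<^sup>2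
        + 2 * s $ j * adj (fst t) $ j * adj (snd t) $ j"
      by (simp add: power2_eq_square algebra_simps)
  qed
  have adj_scale: "adj (r *\<^sub>R t) = r *\<^sub>R adj t" for r t
    by (simp add: adj_def vec_eq_iff sum_distrib_left mult_ac)
  have adj_add: "adj (t + t') = adj t + adj t'" for t t'
    by (simp add: adj_def vec_eq_iff distrib_right add_divide_distrib sum.distrib)
  have v_scale: "v (r *\<^sub>R t) = r\<^sup>2 * v t" for r t
    by (simp add: v_def adj_scale sum_distrib_left power2_eq_square algebra_simps)
  have v_add: "(v (t + t') - v t - v t') / 2 =
     (\<Sum>j\<in>UNIV. b $ j * (adj (fst t) $ j * adj (fst t') $ j + adj (snd t) $ j * adj (snd t') $ j +
        s $ j * (adj (fst t) $ j * adj (snd t') $ j + adj (fst t') $ j * adj (snd t) $ j)))" for t t'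
    unfolding v_def sum_subtractf[symmetric] sum_divide_distrib
    by (intro sum.cong refl) (simp add: adj_add power2_eq_square field_simps)
  note jn = jointly_normal_charI[OF prob_space_normal_kernel sets char v0 v_scale]
  note mean = mean_of_char[OF prob_space_normal_kernel sets char v0 v_scale]
  note cov = covariance_of_char[OF prob_space_normal_kernel sets char v0 v_scale, unfolded v_add]
  have adj_0: "adj 0 = 0" by (simp add: adj_def vec_eq_iff)
  have adj_axis: "adj (axis i 1) $ j = \<tau> $ i * u j $ i / (total \<tau> * a j)" for i j
  proof -
    have "adj (axis i 1) $ j = (\<Sum>k\<in>UNIV. if k = i then \<tau> $ i * u j $ i / (total \<tau> * a j) else 0)"
      unfolding adj_def vec_lambda_beta by (intro sum.cong) (auto simp: axis_def)
    then show ?thesis by simp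
  qed
  have bj: "b $ j = total \<tau> * a j" for j by (simp add: b_def hat_var_def)
  have m: "(\<integral>z. fst z $ i \<partial>normal_kernel s) = 0" "(\<integral>z. snd z $ i \<partial>normal_kernel s) = 0" for i
    using mean[of "(axis i 1, 0)"] mean[of "(0, axis i 1)"] by (simp_all add: inner_axis_pair)
  have cross: "(\<integral>z. fst z $ i * snd z $ k \<partial>normal_kernel s) = cross_covariance \<tau> u a s $ i $ k" for i k
  proof -
    have "(\<integral>z. fst z $ i * snd z $ k \<partial>normal_kernel s) = (\<Sum>j\<in>UNIV. b $ j * (s $ j * (adj (axis i 1) $ j
        * adj (axis k 1) $ j)))"
      using cov[of "(axis i 1, 0)" "(0, axis k 1)"] by (simp add: inner_axis_pair adj_0)
    also have "\<dots> = cross_covariance \<tau> u a s $ i $ k"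
      unfolding cross_covariance_def vec_lambda_beta sum_distrib_left
    proof (intro sum.cong refl)
      fix j
      have "total \<tau> \<noteq> 0" "a j \<noteq> 0" using total_pos scale_pos[of j] by auto
      then show "b $ j * (s $ j * (adj (axis i 1) $ j * adj (axis k 1) $ j)) =
        total \<tau> * weights \<tau> $ i * weights \<tau> $ k * (s $ j * inverse (a j) * u j $ i * u j $ k)"
        unfolding adj_axis bj weights_def by (simp add: field_simps)
    qed
    finally show ?thesis .
  qed
  \<comment> \<open>The dual orthogonality relation at the point i, obtained from
    \<open>unhat_hat\<close> at \<open>\<tau> $ i\<close> times the i-th unit vector.\<close>
  have same: "(\<Sum>j\<in>UNIV. b $ j * (adj (axis i 1) $ j * adj (axis i 1) $ j)) = \<tau> $ i" for i
  proof -
    have "(\<Sum>j\<in>UNIV. b $ j * (adj (axis i 1) $ j * adj (axis i 1) $ j)) = \<tau> $ i * (\<Sum>j\<in>UNIV. u j $ i * (\<tau> $ i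
        * u j $ i) / (total \<tau> * a j))"
      unfolding sum_distrib_left
    proof (intro sum.cong refl)
      fix j
      have "total \<tau> \<noteq> 0" "a j \<noteq> 0" using total_pos scale_pos[of j] by auto
      then show "b $ j * (adj (axis i 1) $ j * adj (axis i 1) $ j) = \<tau> $ i * (u j $ i * (\<tau> $ i * u j $ i) / (total \<tau> * a j))"
        unfolding adj_axis bj by (simp add: field_simps)
    qed
    also have "\<dots> = unhat \<tau> u a (hat u (\<chi> k. if k = i then \<tau> $ i else 0)) $ i"
    proof -
      have "hat u (\<chi> k. if k = i then \<tau> $ i else 0) $ j = \<tau> $ i * u j $ i" for j
      proof -
        have "hat u (\<chi> k. if k = i then \<tau> $ i else 0) $ j = (\<Sum>k\<in>UNIV. if k = i then \<tau> $ i * u j $ i else 0)"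
          unfolding hat_def vec_lambda_beta by (intro sum.cong) auto
        then show ?thesis by simp
      qed
      then show ?thesis by (simp add: unhat_def)
    qed
    also have "\<dots> = \<tau> $ i" by (simp add: unhat_hat)
    finally show ?thesis .
  qed
  have var: "(\<integral>z. fst z $ i * fst z $ i \<partial>normal_kernel s) = \<tau> $ i" "(\<integral>z. snd z $ i
      * snd z $ i \<partial>normal_kernel s) = \<tau> $ i" for i
    using cov[of "(axis i 1, 0)" "(axis i 1, 0)"] cov[of "(0, axis i 1)" "(0, axis i 1)"] same[of i]
        by (simp_all add: inner_axis_pair adj_0)
  interpret K: prob_space "normal_kernel s" by (rule prob_space_normal_kernel)
  have margs: "distr (normal_kernel s) borel fst = normal_product \<tau>" "distr (normal_kernel s) borel snd = normal_product \<tau>"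
  proof -
    have "distr (normal_kernel s) borel fst = distr (distr (mehler_law b s) borel fst) borel (unhat \<tau> u a)"
      unfolding normal_kernel_def b_def
          by (simp add: distr_borel_distr measurable_unhat_pair borel_measurable_fst_pair unhat_pair_def)
    then show "distr (normal_kernel s) borel fst = normal_product \<tau>"
      by (simp add: b_def fst_mehler_law[OF hat_var_pos s] distr_unhat)
    have "distr (normal_kernel s) borel snd = distr (distr (mehler_law b s) borel snd) borel (unhat \<tau> u a)"
      unfolding normal_kernel_def b_def
          by (simp add: distr_borel_distr measurable_unhat_pair borel_measurable_snd_pair unhat_pair_def)
    then show "distr (normal_kernel s) borel snd = normal_product \<tau>"
      by (simp add: b_def snd_mehler_law[OF hat_var_pos s] distr_unhat)
  qed
  \<comment> \<open>Independence of the components depends only on the law of f, so it is inherited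
    from \<open>normal_product \<tau>\<close>.\<close>
  have indep: "K.indep_vars (\<lambda>_. borel) (\<lambda>i z. f z $ i) UNIV"
    if f: "f \<in> normal_kernel s \<rightarrow>\<^sub>M borel" "distr (normal_kernel s) borel f = normal_product \<tau>" for f
  proof -
    interpret N: prob_space "normal_product \<tau>" by (rule prob_space_normal_product[OF \<tau>_pos])
    have [measurable]: "f \<in> normal_kernel s \<rightarrow>\<^sub>M borel" by fact
    have [measurable]: "(\<lambda>x :: real ^ 'd. \<lambda>i\<in>UNIV. x $ i) \<in> borel \<rightarrow>\<^sub>M (\<Pi>\<^sub>M i\<in>(UNIV :: 'd set). borel)"
      by (rule measurable_restrict) measurable
    have "distr (normal_product \<tau>) (\<Pi>\<^sub>M i\<in>UNIV. borel) (\<lambda>x. \<lambda>i\<in>UNIV. x $ i)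
        = (\<Pi>\<^sub>M i\<in>UNIV. distr (normal_product \<tau>) borel (\<lambda>x. x $ i))"
      using indep_normal_product[OF \<tau>_pos]
          by (subst (asm) N.indep_vars_iff_distr_eq_PiM) (auto simp: measurable_cong_sets[OF sets_normal_product refl])
    then have "distr (normal_kernel s) (\<Pi>\<^sub>M i\<in>UNIV. borel) (\<lambda>z. \<lambda>i\<in>UNIV. f z $ i)
        = (\<Pi>\<^sub>M i\<in>UNIV. distr (normal_kernel s) borel (\<lambda>z. f z $ i))"
      unfolding f(2)[symmetric] by (simp add: distr_distr comp_def)
    then show ?thesis by (subst K.indep_vars_iff_distr_eq_PiM) auto
  qed
  show ?thesis
    unfolding normal_pair_def
  proof (intro conjI allI)
    show "K.indep_vars (\<lambda>_. borel) (\<lambda>i z. fst z $ i) UNIV"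
      by (rule indep[OF _ margs(1)]) (simp add: measurable_cong_sets[OF sets refl] borel_measurable_fst_pair)
    show "K.indep_vars (\<lambda>_. borel) (\<lambda>i z. snd z $ i) UNIV"
      by (rule indep[OF _ margs(2)]) (simp add: measurable_cong_sets[OF sets refl] borel_measurable_snd_pair)
  qed (simp_all add: jn m covariance_def var cross)
qed

lemma measurable_normal_kernel: "normal_kernel \<in> borel \<rightarrow>\<^sub>M prob_algebra borel"
  unfolding normal_kernel_def[abs_def]
  using measurable_mehler_law[OF hat_var_pos] measurable_distr_prob_space[OF measurable_unhat_pair]
  by (rule measurable_compose)

text \<open>The kernel of a conditionally normal pair is determined almost everywhere, because a normal
  pair is determined by its covariances.\<close>
lemma normal_mixture_iff:
  assumes cube: "cube_law \<nu>"
  shows "normal_mixture \<tau> u a \<nu> \<mu> \<longleftrightarrow> \<mu> = lancaster_mixture \<nu>"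
proof
  have sets_mix: "sets (lancaster_mixture \<nu>) = sets borel" by (simp add: lancaster_mixture_def)
  have ub: "unhat_pair \<tau> u a -` B \<in> sets borel" if "B \<in> sets borel" for B
    using measurable_sets[OF measurable_unhat_pair that] by simp
  have em_kernel: "emeasure (normal_kernel s) B
      = emeasure (mehler_law (hat_var \<tau> a) s) (unhat_pair \<tau> u a -` B)" if "B \<in> sets borel" for s B
    unfolding normal_kernel_def using that
    by (subst emeasure_distr[OF measurable_unhat_pair_mehler_law]) (auto simp: mehler_law_def)
  have em_mix: "emeasure (lancaster_mixture \<nu>) B = (\<integral>\<^sup>+s. emeasure (normal_kernel s) B \<partial>\<nu>)" if B: "B \<in> sets borel" for B
  proof -
    have "emeasure (lancaster_mixture \<nu>) B = emeasure (mehler_mixture (hat_var \<tau> a) \<nu>) (unhat_pair \<tau> u a -` B)"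
      unfolding lancaster_mixture_def using B
      by (subst emeasure_distr) (auto simp: measurable_cong_sets[OF sets_mehler_mixture refl] measurable_unhat_pair mehler_mixture_def)
    then show ?thesis
      by (simp add: emeasure_mehler_mixture[OF hat_var_pos cube ub[OF B]] em_kernel[OF B])
  qed
  {
    assume "normal_mixture \<tau> u a \<nu> \<mu>"
    then obtain M :: "((real ^ 'd) \<times> ((real ^ 'd) \<times> (real ^ 'd))) measure" and K where
      M: "prob_space M" "sets M = sets borel" "distr M borel fst = \<nu>" "distr M borel snd = \<mu>"
      and K: "conditional_law M fst (\<lambda>\<omega>. (fst (snd \<omega>), snd (snd \<omega>))) K"
      and np: "AE s in \<nu>. normal_pair \<tau> (cross_covariance \<tau> u a s) (K s)"
      unfolding normal_mixture_def conditionally_normal_def by auto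
    have sets_\<mu>: "sets \<mu> = sets borel" using M(4) by auto
    have sp: "space M = UNIV" using sets_eq_imp_space_eq[OF M(2)] by simp
    have "AE s in \<nu>. K s = normal_kernel s"
      using np AE_cube_law[OF cube]
      by eventually_elim (auto intro: normal_pair_unique normal_pair_normal_kernel)
    then have "emeasure \<mu> B = emeasure (lancaster_mixture \<nu>) B" if B: "B \<in> sets borel" for B
    proof -
      have sm: "snd \<in> M \<rightarrow>\<^sub>M borel" by (simp add: measurable_cong_sets[OF M(2) refl] borel_measurable_snd_pair)
      have "emeasure \<mu> B = emeasure M {\<omega> \<in> space M. fst \<omega> \<in> UNIV \<and> (fst (snd \<omega>), snd (snd \<omega>)) \<in> B}"
        unfolding M(4)[symmetric] using B by (subst emeasure_distr[OF sm]) (auto intro!: arg_cong[of _ _ "emeasure M"])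
      also have "\<dots> = (\<integral>\<^sup>+s. emeasure (K s) B * indicator UNIV s \<partial>\<nu>)"
        using K[unfolded conditional_law_def, THEN conjunct2, THEN conjunct2, THEN conjunct2, rule_format, of UNIV B] B M(3)
        by simp
      also have "\<dots> = (\<integral>\<^sup>+s. emeasure (normal_kernel s) B \<partial>\<nu>)"
        using \<open>AE s in \<nu>. K s = normal_kernel s\<close> by (intro nn_integral_cong_AE) auto
      finally show ?thesis by (simp add: em_mix[OF B])
    qed
    then show "\<mu> = lancaster_mixture \<nu>"
      by (intro measure_eqI) (auto simp: sets_\<mu> sets_mix)
  }
  {
    assume \<mu>: "\<mu> = lancaster_mixture \<nu>"
    define b where "b = hat_var \<tau> a"
    let ?P = "\<nu> \<Otimes>\<^sub>M normal_square b"
    \<comment> \<open>The sample point is (\<xi>, (W, Z)), and g maps it to \<xi> together with the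
      pair in the original coordinates; the image law is the required joint law.\<close>
    define g where "g x = (fst x, unhat_pair \<tau> u a (mehler_map (fst x) (snd x)))" for x :: "(real ^ 'd) \<times> ((real ^ 'd) \<times> (real ^ 'd))"
    define M where "M = distr ?P borel g"
    interpret nu: prob_space \<nu> using cube by (simp add: cube_law_def)
    have sets_\<nu>: "sets \<nu> = sets borel" using cube by (simp add: cube_law_def)
    interpret NN: prob_space "normal_square b"
      unfolding b_def by (rule prob_space_normal_pair_measure[OF hat_var_pos])
    interpret P: pair_prob_space \<nu> "normal_square b" ..
    have fm: "fst \<in> ?P \<rightarrow>\<^sub>M borel"
      using measurable_fst[of \<nu>] by (simp add: measurable_cong_sets[OF refl sets_\<nu>])
    have mm: "(\<lambda>x. mehler_map (fst x) (snd x)) \<in> ?P \<rightarrow>\<^sub>M borel"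
      by (rule measurable_mehler_map_joint_normal[OF sets_\<nu>])
    have gm: "g \<in> ?P \<rightarrow>\<^sub>M borel"
      unfolding g_def[abs_def] by (intro borel_measurable_Pair fm measurable_compose[OF mm measurable_unhat_pair])
    have M: "prob_space M" "sets M = sets borel"
      unfolding M_def by (rule P.prob_space_distr[OF gm]) simp
    have M_fst: "distr M borel fst = \<nu>"
    proof -
      have "distr M borel fst = distr ?P \<nu> fst"
        unfolding M_def by (subst distr_distr[OF borel_measurable_fst_pair gm]) (auto simp: comp_def g_def sets_\<nu> intro!: distr_cong)
      then show ?thesis by (simp add: NN.distr_pair_fst)
    qed
    have M_snd: "distr M borel snd = \<mu>"
      unfolding M_def \<mu> lancaster_mixture_def mehler_mixture_def b_def[symmetric]
      by (subst distr_distr[OF borel_measurable_snd_pair gm], subst distr_distr[OF measurable_unhat_pair mm]) (auto simp: comp_def g_def)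
    have "conditional_law M fst (\<lambda>\<omega>. (fst (snd \<omega>), snd (snd \<omega>))) normal_kernel"
      unfolding conditional_law_def
    proof (intro conjI ballI)
      show "fst \<in> M \<rightarrow>\<^sub>M borel" by (simp add: measurable_cong_sets[OF M(2) refl] borel_measurable_fst_pair)
      show "(\<lambda>\<omega>. (fst (snd \<omega>), snd (snd \<omega>))) \<in> M \<rightarrow>\<^sub>M borel"
          by (simp add: measurable_cong_sets[OF M(2) refl] borel_measurable_snd_pair)
      show "normal_kernel \<in> borel \<rightarrow>\<^sub>M prob_algebra borel" by (rule measurable_normal_kernel)
      fix A :: "(real ^ 'd) set" and B :: "((real ^ 'd) \<times> (real ^ 'd)) set"
      assume A: "A \<in> sets borel" and B: "B \<in> sets borel"
      have S: "{\<omega> \<in> space M. fst \<omega> \<in> A \<and> (fst (snd \<omega>), snd (snd \<omega>)) \<in> B} = (fst -` A \<inter> snd -` B)"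
        by (auto simp: M_def)
      have "fst -` A \<inter> snd -` B \<in> sets (borel :: ((real ^ 'd) \<times> ((real ^ 'd) \<times> (real ^ 'd))) measure)"
        using measurable_sets[OF borel_measurable_fst_pair A] measurable_sets[OF borel_measurable_snd_pair B] by auto
      then have "emeasure M (fst -` A \<inter> snd -` B) = emeasure ?P (g -` (fst -` A \<inter> snd -` B) \<inter> space ?P)"
        unfolding M_def by (rule emeasure_distr[OF gm])
      also have "g -` (fst -` A \<inter> snd -` B) \<inter> space ?P =
         {x \<in> space ?P. fst x \<in> A \<and> mehler_map (fst x) (snd x) \<in> unhat_pair \<tau> u a -` B}"
        by (auto simp: g_def)
      also have "emeasure ?P \<dots> = (\<integral>\<^sup>+s. emeasure (mehler_law b s) (unhat_pair \<tau> u a -` B) * indicator A s \<partial>\<nu>)"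
        unfolding b_def by (rule emeasure_mehler_joint[OF hat_var_pos cube A ub[OF B]])
      also have "\<dots> = (\<integral>\<^sup>+s. emeasure (normal_kernel s) B * indicator A s \<partial>\<nu>)"
        by (simp add: em_kernel[OF B] b_def)
      finally show "emeasure M {\<omega> \<in> space M. fst \<omega> \<in> A \<and> (fst (snd \<omega>), snd (snd \<omega>)) \<in> B} =
          (\<integral>\<^sup>+s. emeasure (normal_kernel s) B * indicator A s \<partial>distr M borel fst)"
        unfolding S M_fst .
    qed
    moreover have "AE s in distr M borel fst. normal_pair \<tau> (cross_covariance \<tau> u a s) (normal_kernel s)"
      unfolding M_fst using AE_cube_law[OF cube] by eventually_elim (auto intro: normal_pair_normal_kernel)
    ultimately show "normal_mixture \<tau> u a \<nu> \<mu>"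
      unfolding normal_mixture_def conditionally_normal_def using M M_fst M_snd by blast
  }
qed

end

theorem theorem7:
  fixes \<tau> :: "real ^ 'd"
    and u :: "'d \<Rightarrow> real ^ 'd"
    and a :: "'d \<Rightarrow> real"
    and j0 :: 'd
    and \<rho> :: "nat ^ 'd \<Rightarrow> real"
  assumes "\<And>i. \<tau> $ i > 0"
    and "orthogonal_basis (weights \<tau>) u a"
    and "\<And>i. u j0 $ i = 1"
    and "\<rho> 0 = 1"
  shows "((\<exists>\<mu>. lancaster_law \<tau> u a \<rho> \<mu>) \<longleftrightarrow> (\<exists>\<nu>. cube_law \<nu> \<and> is_moment_sequence \<rho> \<nu>)) \<and>
    (\<forall>\<mu> \<nu>. cube_law \<nu> \<longrightarrow>
      (lancaster_law \<tau> u a \<rho> \<mu> \<longrightarrow> (is_moment_sequence \<rho> \<nu> \<longleftrightarrow> normal_mixture \<tau> u a \<nu> \<mu>)) \<and>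
      (is_moment_sequence \<rho> \<nu> \<longrightarrow> (lancaster_law \<tau> u a \<rho> \<mu> \<longleftrightarrow> normal_mixture \<tau> u a \<nu> \<mu>)))"
proof -
  note pos = assms(1) and basis = assms(2)
  have "\<exists>\<nu>. cube_law \<nu> \<and> is_moment_sequence \<rho> \<nu>" if "lancaster_law \<tau> u a \<rho> \<mu>" for \<mu>
  proof -
    have "sets \<mu> = sets borel" using that by (simp add: lancaster_law_def)
    with that show ?thesis
      using hermite_diagonal_moment_sequence[OF hat_var_pos[OF pos basis]]
      by (simp add: lancaster_law_iff_diagonal[OF pos basis])
  qed
  moreover have "lancaster_law \<tau> u a \<rho> \<mu> \<longleftrightarrow> \<mu> = lancaster_mixture \<tau> u a \<nu>"
    if "cube_law \<nu>" "is_moment_sequence \<rho> \<nu>" for \<mu> \<nu>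
    using lancaster_law_mixture[OF pos basis that] lancaster_law_unique[OF pos basis] by blast
  moreover have "is_moment_sequence \<rho> \<nu>"
    if \<nu>: "cube_law \<nu>" and \<mu>: "lancaster_law \<tau> u a \<rho> \<mu>" "\<mu> = lancaster_mixture \<tau> u a \<nu>" for \<mu> \<nu>
  proof -
    \<comment> \<open>The mixture of \<nu> is a Lancaster law for the moments of \<nu>, whatever
      they are; as correlations are unique, these moments are \<rho>.\<close>
    have m: "is_moment_sequence (\<lambda>n. \<integral>s. (\<Prod>j\<in>UNIV. (s $ j) ^ (n $ j)) \<partial>\<nu>) \<nu>"
      by (simp add: is_moment_sequence_def)
    show ?thesis
      using lancaster_law_correlation_unique[OF pos basis \<mu>(1)] lancaster_law_mixture[OF pos basis \<nu> m] m \<mu>(2) by simp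
  qed
  \<comment> \<open>By \<open>normal_mixture_iff\<close> both equivalences become statements about
    \<open>\<mu> = lancaster_mixture \<tau> u a \<nu>\<close>.\<close>
  ultimately show ?thesis
    by (simp add: normal_mixture_iff[OF pos basis]) blast
qed

end
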